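(* Fix a compactly supported smooth function $\chi:\mathbb C\to[0,\infty)$ with $\int\chi\,dm=1$ and $\chi(-z)=\chi(z)$ for all $z$. There exists a constant $K>0$ with the following property. For an entire function $\psi:\mathbb C\to\mathbb C$ put $\phi(z)=\frac12\log|\psi(z)|-\frac14|z|^2$ and \[ R(z)=\sup_{w\in\mathbb C}\Big(\sqrt{K\,(1+(|\phi|*\chi)(w))}-|w-z|\Big). \] If $R(0)<\infty$, then there exists a bijection between the lattice $\sqrt\pi\mathbb Z^2=\{\sqrt\pi(k+li):k,l\in\mathbb Z\}$ and the zero set $\psi^{-1}(0)$ (zeros counted with multiplicities) such that for every pair of corresponding points $z\in\psi^{-1}(0)$ and $\sqrt\pi(k+li)$, \[ |z-\sqrt\pi(k+li)|\le R\big(\sqrt\pi(k+li)\big). \]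
   Context: $m$ is Lebesgue measure on $\mathbb C$; $|\phi|*\chi$ denotes the convolution of the pointwise absolute value of $\phi$ with $\chi$. *)

theory Defs
  imports "HOL-Complex_Analysis.Complex_Analysis"
begin

coinductive smooth_C_inf :: "(complex \<Rightarrow> real) \<Rightarrow> bool" where
  "f differentiable_on UNIV \<Longrightarrow> (\<forall>v. smooth_C_inf (\<lambda>z. frechet_derivative f (at z) v))
     \<Longrightarrow> smooth_C_inf f"

definition abs_conv :: "(complex \<Rightarrow> real) \<Rightarrow> (complex \<Rightarrow> real) \<Rightarrow> complex \<Rightarrow> ennreal" where
  "abs_conv phi chi w = (\<integral>\<^sup>+ y. ennreal (\<bar>phi (w - y)\<bar> * chi y) \<partial>lborel)"

definition phi_of :: "(complex \<Rightarrow> complex) \<Rightarrow> complex \<Rightarrow> real" where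
  "phi_of \<psi> z = (1/2) * ln (cmod (\<psi> z)) - (1/4) * (cmod z)^2"

definition Rfun :: "real \<Rightarrow> (complex \<Rightarrow> real) \<Rightarrow> (complex \<Rightarrow> complex) \<Rightarrow> complex \<Rightarrow> ereal" where
  "Rfun K chi \<psi> z = (SUP w. (if abs_conv (phi_of \<psi>) chi w = \<infinity> then \<infinity>
      else ereal (sqrt (K * (1 + enn2real (abs_conv (phi_of \<psi>) chi w))) - cmod (w - z))))"

definition lattice_pt :: "int \<times> int \<Rightarrow> complex" where
  "lattice_pt p = complex_of_real (sqrt pi) * (of_int (fst p) + of_int (snd p) * \<i>)"

end

theory Submission
  imports Defs
begin

text \<open>Since \<open>\<Delta> log \<bar>z\<bar> = 2 \<pi> \<delta>\<^sub>0\<close>, in the sense of distributions \<open>\<Delta> \<phi>\<close> is \<open>\<pi>\<close> times the counting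
  measure of the zeros minus Lebesgue measure. Normalise bumps of radius \<open>R/10\<close> around the lattice
  points to a partition of unity \<open>\<theta>\<^sub>p\<close>. The \<open>\<theta>\<^sub>p\<close>-mass of the zeros and the \<open>\<theta>\<^sub>p\<close>-area differ by
  \<open>\<integral> \<phi> \<Delta> \<theta>\<^sub>p\<close>. Because \<open>\<Sum> \<theta>\<^sub>p = 1\<close>, for a set \<open>I\<close> of indices the function \<open>\<Sum>\<^sub>I \<Delta> \<theta>\<^sub>p\<close> is controlled by
  terms \<open>O(R\<^sup>-\<^sup>4)\<close> living on the bumps just outside (or just inside) \<open>I\<close>, and \<open>R\<^sup>2 \<ge> K \<bar>\<phi>\<bar> * \<chi>\<close> makes the
  integral of \<open>\<bar>\<phi>\<bar>\<close> against each of them at most \<open>O(1/K)\<close>, hence smaller than the area of that bump.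
  So passing from \<open>I\<close> to its neighbours compensates every deficit; as the cells of the lattice have
  area \<open>\<pi>\<close>, Hall's condition holds in both directions between zeros and lattice points.\<close>

section \<open>Matchings in infinite locally finite bipartite graphs\<close>

text \<open>The scale has to vary because \<open>R\<close> need not be bounded. What controls it is
  that \<open>R\<close> is a supremum of 1-Lipschitz functions of \<open>z\<close>: it is finite
  everywhere once it is finite at 0, and bumps meeting at a point have radii in a bounded ratio.
  About R^2 bumps overlap at each point, so a normalised bump has height R^-2 and Laplacian R^-4,
  while its area stays above an absolute constant. Over a disc of radius R/10 the integral of
  |\<phi>| is at most a constant times R^2 * R^2 / K, so the powers of R cancel and a fixed K
  suffices. Hall's condition compares cardinalities without any loss, so a small relative error
  would not do; the error has to be absorbed completely by a further layer of bumps, and 1/10 is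
  small enough for the extra layer to stay within distance R. Local integrability of log |\<psi>| is
  never proved by itself; it comes with the finiteness of the convolution. Both directions of Hall's
  condition are needed because in an infinite graph a matching that covers one side need not cover
  the other.\<close>

lemma hall_injection:
  fixes E :: "('a \<times> 'b) set"
  assumes fin: "\<And>i. i \<in> I \<Longrightarrow> finite (E `` {i})"
    and hall: "\<And>J. finite J \<Longrightarrow> J \<subseteq> I \<Longrightarrow> card J \<le> card (E `` J)"
  obtains f where "inj_on f I" "\<And>i. i \<in> I \<Longrightarrow> (i, f i) \<in> E"
proof -
  define H where "H = (\<lambda>F::('a \<times> 'b) set. \<forall>J. finite J \<longrightarrow> J \<subseteq> I \<longrightarrow> card J \<le> card (F `` J))"
  \<comment> \<open>Rado's argument: delete a maximal set \<open>X\<close> of edges subject to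
    Hall's condition; what remains turns out to be a matching.\<close>
  define \<A> where "\<A> = {X. X \<subseteq> E \<and> H (E - X)}"
  have finJ: "finite (E `` J)" if "finite J" "J \<subseteq> I" for J
  proof -
    have "E `` J = (\<Union>i\<in>J. E `` {i})" by blast
    then show ?thesis using that fin by auto
  qed
  have "\<exists>M\<in>\<A>. \<forall>X\<in>\<A>. M \<subseteq> X \<longrightarrow> X = M"
  proof (rule subset_Zorn)
    fix C assume C: "subset.chain \<A> C"
    show "\<exists>U\<in>\<A>. \<forall>X\<in>C. X \<subseteq> U"
    proof (cases "C = {}")
      case True
      have "{} \<in> \<A>" using hall by (auto simp: \<A>_def H_def)
      then show ?thesis using True by auto
    next
      case False
      have CA: "C \<subseteq> \<A>" using C by (auto simp: subset.chain_def)
      have "H (E - \<Union>C)"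
        unfolding H_def
      proof (intro allI impI)
        fix J assume J: "finite J" "J \<subseteq> I"
        \<comment> \<open>Finite degrees leave only finitely many deleted edges at \<open>J\<close>,
          so one member of the chain contains them all and vouches for Hall's condition at
          \<open>J\<close>.\<close>
        let ?T = "\<Union>C \<inter> (J \<times> UNIV)"
        have "?T \<subseteq> J \<times> (E `` J)" using CA by (auto simp: \<A>_def)
        then have "finite ?T" by (rule finite_subset) (use finJ[OF J] J(1) in simp)
        then obtain B where B: "B \<in> C" "?T \<subseteq> B"
          by (rule finite_subset_Union_chain[OF _ Int_lower1 False C])
        have "(E - \<Union>C) `` J = (E - B) `` J" using B by blast
        moreover have "H (E - B)" using B CA by (auto simp: \<A>_def)
        ultimately show "card J \<le> card ((E - \<Union>C) `` J)" using J by (auto simp: H_def)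
      qed
      moreover have "\<Union>C \<subseteq> E" using CA by (auto simp: \<A>_def)
      ultimately have "\<Union>C \<in> \<A>" by (simp add: \<A>_def)
      then show ?thesis by blast
    qed
  qed
  then obtain X where X: "X \<in> \<A>" and max: "\<And>Y. Y \<in> \<A> \<Longrightarrow> X \<subseteq> Y \<Longrightarrow> Y = X" by blast
  define F where "F = E - X"
  have HF: "H F" and FE: "F \<subseteq> E" using X by (auto simp: \<A>_def F_def)
  have finF: "finite (F `` J)" if "finite J" "J \<subseteq> I" for J
    using finJ[OF that] FE by (meson Image_mono finite_subset order_refl)
  \<comment> \<open>By maximality every remaining edge is critical: deleting it breaks Hall's
    condition, necessarily on a set containing \<open>i\<close>. Dropping \<open>i\<close> from that
    set turns the strict inequality into \<open>\<le>\<close>.\<close>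
  have witness: "\<exists>J. finite J \<and> J \<subseteq> I \<and> i \<notin> J \<and> card (F `` J \<union> (F `` {i} - {x})) \<le> card J"
    if i: "i \<in> I" and x: "(i, x) \<in> F" for i x
  proof -
    have "insert (i, x) X \<notin> \<A>" using max[of "insert (i, x) X"] x by (auto simp: F_def)
    moreover have "insert (i, x) X \<subseteq> E" using X x by (auto simp: \<A>_def F_def)
    ultimately have "\<not> H (E - insert (i, x) X)" by (simp add: \<A>_def)
    moreover have "E - insert (i, x) X = F - {(i, x)}" by (auto simp: F_def)
    ultimately obtain J where J: "finite J" "J \<subseteq> I" and lt: "card ((F - {(i, x)}) `` J) < card J"
      by (auto simp: H_def not_le)
    have "i \<in> J"
    proof (rule ccontr)
      assume "i \<notin> J"
      then have "(F - {(i, x)}) `` J = F `` J" by auto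
      then show False using lt HF J by (auto simp: H_def not_less)
    qed
    have eq: "(F - {(i, x)}) `` J = F `` (J - {i}) \<union> (F `` {i} - {x})" using \<open>i \<in> J\<close> by auto
    have "card J = Suc (card (J - {i}))" using J \<open>i \<in> J\<close> by (metis card.remove)
    then show ?thesis using lt J eq by (intro exI[of _ "J - {i}"]) auto
  qed
  \<comment> \<open>Two edges at \<open>i\<close> give two such critical sets. The union
    \<open>?P \<union> ?Q\<close> holds all neighbours of \<open>insert i (J \<union> K)\<close>,
    the intersection those of \<open>J \<inter> K\<close>; adding both counts exceeds
    \<open>card J + card K\<close> by one.\<close>
  have uniq: "x = y" if i: "i \<in> I" and x: "(i, x) \<in> F" and y: "(i, y) \<in> F" for i x y
  proof (rule ccontr)
    assume ne: "x \<noteq> y"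
    obtain J where J: "finite J" "J \<subseteq> I" "i \<notin> J" "card (F `` J \<union> (F `` {i} - {x})) \<le> card J"
      using witness[OF i x] by blast
    obtain K where K: "finite K" "K \<subseteq> I" "i \<notin> K" "card (F `` K \<union> (F `` {i} - {y})) \<le> card K"
      using witness[OF i y] by blast
    let ?P = "F `` J \<union> (F `` {i} - {x})" and ?Q = "F `` K \<union> (F `` {i} - {y})"
    have fi: "finite (F `` {i})" using finF[of "{i}"] i by auto
    have fP: "finite ?P" "finite ?Q" using fi finF J K by auto
    have "?P \<union> ?Q = F `` (insert i (J \<union> K))" using ne by auto
    moreover have "card (insert i (J \<union> K)) \<le> card (F `` (insert i (J \<union> K)))"
      using HF[unfolded H_def, rule_format, of "insert i (J \<union> K)"] J(1,2) K(1,2) i by simp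
    ultimately have "card (insert i (J \<union> K)) \<le> card (?P \<union> ?Q)" by simp
    then have 1: "Suc (card (J \<union> K)) \<le> card (?P \<union> ?Q)" using J(1,3) K(1,3) by simp
    have "card (J \<inter> K) \<le> card (F `` (J \<inter> K))"
      using HF[unfolded H_def, rule_format, of "J \<inter> K"] J(1,2) K(1,2) by (simp add: le_infI1)
    also have "\<dots> \<le> card (?P \<inter> ?Q)" using fP by (intro card_mono) auto
    finally have 2: "card (J \<inter> K) \<le> card (?P \<inter> ?Q)" .
    show False using 1 2 card_Un_Int[OF fP] card_Un_Int[OF J(1) K(1)] J(4) K(4) by linarith
  qed
  have ex: "\<exists>x. (i, x) \<in> F" if "i \<in> I" for i
  proof (rule ccontr)
    assume "\<not> ?thesis"
    then have "F `` {i} = {}" by blast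
    moreover have "card {i} \<le> card (F `` {i})"
      using HF[unfolded H_def, rule_format, of "{i}"] that by simp
    ultimately show False by simp
  qed
  define f where "f = (\<lambda>i. SOME x. (i, x) \<in> F)"
  have fF: "(i, f i) \<in> F" if "i \<in> I" for i using someI_ex[OF ex[OF that]] by (simp add: f_def)
  show thesis
  proof
    show "inj_on f I"
    proof (rule inj_onI)
      fix i j assume ij: "i \<in> I" "j \<in> I" "f i = f j"
      have "F `` {i, j} \<subseteq> {f i}" using uniq[OF ij(1) _ fF[OF ij(1)]] uniq[OF ij(2) _ fF[OF ij(2)]] ij(3) by auto
      then have "card (F `` {i, j}) \<le> card {f i}" by (rule card_mono[rotated]) simp
      then have "card {i, j} \<le> 1" using HF[unfolded H_def, rule_format, of "{i, j}"] ij by simp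
      then show "i = j" by (auto simp: card_insert_if split: if_splits)
    qed
    show "(i, f i) \<in> E" if "i \<in> I" for i using fF[OF that] FE by auto
  qed
qed

text \<open>The Schroeder-Bernstein construction sends each point either by \<open>f\<close> or by
  the inverse of \<open>g\<close>, so the bijection stays inside any relation that both maps
  respect. It merges the two one-sided matchings.\<close>

lemma bij_betw_along_relation:
  assumes f: "inj_on f X" "\<And>x. x \<in> X \<Longrightarrow> f x \<in> Y \<and> (x, f x) \<in> E"
    and g: "inj_on g Y" "\<And>y. y \<in> Y \<Longrightarrow> g y \<in> X \<and> (g y, y) \<in> E"
  obtains h where "bij_betw h X Y" "\<And>x. x \<in> X \<Longrightarrow> (x, h x) \<in> E"
proof -
  define S where "S = lfp (\<lambda>S. X - g ` (Y - f ` S))"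
  have S: "S = X - g ` (Y - f ` S)"
    unfolding S_def by (rule lfp_unfold, rule monoI) (intro Diff_mono image_mono subset_refl, auto)
  have SX: "S \<subseteq> X" using S by blast
  have XS: "X - S = g ` (Y - f ` S)" using S g by blast
  define h where "h = (\<lambda>x. if x \<in> S then f x else inv_into Y g x)"
  have inv: "inv_into Y g (g y) = y" if "y \<in> Y" for y using g that by simp
  have "bij_betw f S (f ` S)" using f SX by (meson inj_on_imp_bij_betw inj_on_subset)
  then have b1: "bij_betw h S (f ` S)" by (subst bij_betw_cong[of _ _ f]) (auto simp: h_def)
  have "inj_on g (Y - f ` S)" using g(1) by (rule inj_on_subset) auto
  then have "bij_betw g (Y - f ` S) (X - S)" using XS by (simp add: bij_betw_def)
  then have "bij_betw (inv_into (Y - f ` S) g) (X - S) (Y - f ` S)" by (rule bij_betw_inv_into)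
  moreover have "h x = inv_into (Y - f ` S) g x" if "x \<in> X - S" for x
  proof -
    have "x \<in> g ` (Y - f ` S)" using that XS by simp
    then obtain y where y: "y \<in> Y - f ` S" "x = g y" by (auto elim!: imageE)
    then have "inv_into (Y - f ` S) g x = y" using \<open>inj_on g (Y - f ` S)\<close> by simp
    then show ?thesis using y inv that by (simp add: h_def)
  qed
  ultimately have b2: "bij_betw h (X - S) (Y - f ` S)"
    using bij_betw_cong[of "X - S" h "inv_into (Y - f ` S) g" "Y - f ` S"] by blast
  have "bij_betw h (S \<union> (X - S)) (f ` S \<union> (Y - f ` S))"
    by (rule bij_betw_combine[OF b1 b2]) auto
  moreover have "S \<union> (X - S) = X" "f ` S \<union> (Y - f ` S) = Y" using SX f by auto
  ultimately have "bij_betw h X Y" by simp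
  moreover have "(x, h x) \<in> E" if x: "x \<in> X" for x
  proof (cases "x \<in> S")
    case True then show ?thesis using f x by (simp add: h_def)
  next
    case False
    then have "x \<in> g ` (Y - f ` S)" using x XS by auto
    then obtain y where y: "y \<in> Y - f ` S" "x = g y" by (auto elim!: imageE)
    then show ?thesis using g inv False by (auto simp: h_def)
  qed
  ultimately show thesis using that by blast
qed

section \<open>Green's identity for the logarithm of an entire function\<close>

text \<open>Green's identity needs only pure partial derivatives, so a one-variable derivative along
  a line is enough. The derivative is passed as a function of the point so that it can be
  differentiated again.\<close>

definition has_dir_deriv :: "(complex \<Rightarrow> real) \<Rightarrow> complex \<Rightarrow> (complex \<Rightarrow> real) \<Rightarrow> complex \<Rightarrow> bool" where
  "has_dir_deriv f v f' z \<longleftrightarrow> ((\<lambda>t. f (z + of_real t * v)) has_real_derivative f' z) (at 0)"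

lemma has_dir_deriv_line:
  assumes "has_dir_deriv f v f' (z + of_real t * v)"
  shows "((\<lambda>t. f (z + of_real t * v)) has_real_derivative f' (z + of_real t * v)) (at t)"
proof -
  have "((\<lambda>s. f (z + of_real (s + t) * v)) has_real_derivative f' (z + of_real t * v)) (at 0)"
    using assms by (simp add: has_dir_deriv_def algebra_simps)
  then show ?thesis
    using DERIV_shift[of "\<lambda>t. f (z + of_real t * v)" "f' (z + of_real t * v)" 0 t] by simp
qed

lemma has_dir_deriv_transform:
  assumes "has_dir_deriv f v f' z" "open S" "z \<in> S" "\<And>w. w \<in> S \<Longrightarrow> f w = g w" "f' z = g' z"
  shows "has_dir_deriv g v g' z"
proof -
  have "open ((\<lambda>t::real. z + of_real t * v) -` S)"
    by (intro open_vimage assms continuous_intros)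
  then have "((\<lambda>t. g (z + of_real t * v)) has_real_derivative f' z) (at 0)"
    using assms unfolding has_dir_deriv_def
    by (elim has_field_derivative_transform_within_open) auto
  then show ?thesis using assms(5) by (simp add: has_dir_deriv_def)
qed

section \<open>Integration by parts against compactly supported functions\<close>

lemma integrable_continuous_compact_support:
  fixes f :: "complex \<Rightarrow> real"
  assumes "continuous_on UNIV f" "compact C" "\<And>z. z \<notin> C \<Longrightarrow> f z = 0"
  shows "integrable lborel f"
proof -
  have "integrable lborel (\<lambda>z. indicator C z *\<^sub>R f z)"
    using assms by (intro borel_integrable_compact) (auto intro: continuous_on_subset)
  also have "(\<lambda>z. indicator C z *\<^sub>R f z) = f"
    using assms(3) by (intro ext) (auto simp: indicator_def)
  finally show ?thesis .
qed

lemma integral_translate: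
  fixes f :: "complex \<Rightarrow> real"
  assumes "f \<in> borel_measurable borel"
  shows "(\<integral>z. f (z + c) \<partial>lborel) = (\<integral>z. f z \<partial>lborel)"
proof -
  have "(\<integral>z. f z \<partial>lborel) = (\<integral>z. f z \<partial>distr lborel borel ((+) c))" by (simp add: lborel_distr_plus)
  also have "\<dots> = (\<integral>z. f (c + z) \<partial>lborel)" using assms by (intro integral_distr) auto
  finally show ?thesis by (simp add: add.commute)
qed

text \<open>The difference quotients of \<open>V\<close> have integral zero by translation invariance, so no
  iterated integral is needed.\<close>

lemma integral_dir_deriv_eq_0:
  fixes V W :: "complex \<Rightarrow> real"
  assumes der: "\<And>z. has_dir_deriv V v W z"
    and cont: "continuous_on UNIV V" "continuous_on UNIV W"
    and C: "compact C" "\<And>z. z \<notin> C \<Longrightarrow> V z = 0" "\<And>z. z \<notin> C \<Longrightarrow> W z = 0"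
  shows "(\<integral>z. W z \<partial>lborel) = 0"
proof -
  have [measurable]: "V \<in> borel_measurable borel" "W \<in> borel_measurable borel"
    using cont by (auto intro: borel_measurable_continuous_onI)
  define X :: "nat \<Rightarrow> real" where "X n = inverse (real (Suc n))" for n
  have X: "0 < X n" "X n \<le> 1" for n by (simp_all add: X_def inverse_le_1_iff)
  have X0: "X \<longlonglongrightarrow> 0" unfolding X_def by (rule LIMSEQ_inverse_real_of_nat)
  define F where "F n z = (V (z + of_real (X n) * v) - V z) / X n" for n z
  have intV: "integrable lborel V" by (rule integrable_continuous_compact_support[OF cont(1) C(1) C(2)])
  have F0: "(\<integral>z. F n z \<partial>lborel) = 0" for n
  proof -
    have "integrable (distr lborel borel ((+) (of_real (X n) * v))) V"
      using intV by (simp add: lborel_distr_plus)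
    then have "integrable lborel (\<lambda>z. V (of_real (X n) * v + z))"
      by (subst (asm) integrable_distr_eq) auto
    then have "integrable lborel (\<lambda>z. V (z + of_real (X n) * v))" by (simp add: add.commute)
    then show ?thesis using intV integral_translate[of V "of_real (X n) * v"]
      by (simp add: F_def)
  qed
  obtain \<rho> where \<rho>: "C \<subseteq> cball 0 \<rho>"
    using compact_imp_bounded[OF C(1)] by (metis bounded_iff mem_cball_0 subsetI)
  have "bounded (W ` C)"
    by (rule compact_imp_bounded[OF compact_continuous_image[OF continuous_on_subset[OF cont(2)] C(1)]]) simp
  then obtain B where B: "B > 0" "\<And>z. z \<in> C \<Longrightarrow> \<bar>W z\<bar> \<le> B" unfolding bounded_pos by auto
  have WB: "\<bar>W z\<bar> \<le> B" for z using B C(3) by (cases "z \<in> C") auto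
  have mvt: "\<bar>F n z\<bar> \<le> B" for n z
  proof -
    have "\<exists>\<xi>. 0 < \<xi> \<and> \<xi> < X n \<and> V (z + of_real (X n) * v) - V (z + of_real 0 * v)
        = (X n - 0) * W (z + of_real \<xi> * v)"
      by (rule MVT2[OF X(1)]) (rule has_dir_deriv_line[OF der])
    then obtain \<xi> where "V (z + of_real (X n) * v) - V z = X n * W (z + of_real \<xi> * v)" by auto
    then have "F n z = W (z + of_real \<xi> * v)" using X(1)[of n] by (simp add: F_def)
    then show ?thesis using WB by simp
  qed
  have supp: "F n z = 0" if "z \<notin> cball 0 (\<rho> + cmod v)" for n z
  proof -
    have v: "cmod (of_real (X n) * v) \<le> cmod v"
      using X[of n] by (auto simp: norm_mult intro: mult_left_le_one_le)
    have z: "\<rho> + cmod v < cmod z" using that by (simp add: not_le)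
    then have "\<not> cmod z \<le> \<rho>" using norm_ge_zero[of v] by linarith
    moreover have "\<not> cmod (z + of_real (X n) * v) \<le> \<rho>"
      using norm_triangle_ineq2[of z "- (of_real (X n) * v)"] v z by (simp add: not_le)
    ultimately have "z \<notin> C" "z + of_real (X n) * v \<notin> C" using \<rho> by (auto simp: subset_iff)
    then show ?thesis using C(2) by (simp add: F_def)
  qed
  have "(\<lambda>n. \<integral>z. F n z \<partial>lborel) \<longlonglongrightarrow> (\<integral>z. W z \<partial>lborel)"
  proof (rule integral_dominated_convergence)
    show "integrable lborel (\<lambda>z. B * indicator (cball 0 (\<rho> + cmod v)) z)"
      by (intro integrable_mult_right integrable_real_indicator emeasure_lborel_cball_finite) auto
    show "AE z in lborel. norm (F n z) \<le> B * indicator (cball 0 (\<rho> + cmod v)) z" for n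
      using mvt supp by (intro AE_I2) (auto simp: indicator_def)
    show "AE z in lborel. (\<lambda>n. F n z) \<longlonglongrightarrow> W z"
    proof (intro AE_I2)
      fix z
      have "((\<lambda>t. (V (z + of_real t * v) - V z) / t) \<longlongrightarrow> W z) (at 0)"
        using der[of z] by (simp add: has_dir_deriv_def has_field_derivative_iff)
      moreover have "filterlim X (at 0) sequentially"
        using X0 X(1) by (auto simp: filterlim_at less_le)
      ultimately show "(\<lambda>n. F n z) \<longlonglongrightarrow> W z"
        unfolding F_def by (rule filterlim_compose)
    qed
    show "(\<lambda>z. W z) \<in> borel_measurable lborel" "F n \<in> borel_measurable lborel" for n
      unfolding F_def by measurable
  qed
  then show ?thesis by (simp add: F0 LIMSEQ_const_iff)
qed

text \<open>\<open>S\<close> and \<open>- C\<close> form an open cover, and on \<open>- C\<close>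
  the product vanishes, so the behaviour of \<open>u\<close> outside \<open>S\<close> does not
  matter. This allows \<open>u\<close> to be well behaved only near the support of the test
  function.\<close>

lemma continuous_on_mult_compact_support:
  fixes u h :: "complex \<Rightarrow> real"
  assumes "open S" "closed C" "C \<subseteq> S" "continuous_on S u" "continuous_on UNIV h" "\<And>z. z \<notin> C \<Longrightarrow> h z = 0"
  shows "continuous_on UNIV (\<lambda>z. u z * h z)"
proof -
  have "continuous_on S (\<lambda>z. u z * h z)"
    using assms by (intro continuous_on_mult) (auto intro: continuous_on_subset)
  moreover have "continuous_on (- C) (\<lambda>z. u z * h z)"
    using assms by (subst continuous_on_cong[of _ _ _ "\<lambda>_. 0"]) auto
  ultimately have "continuous_on (S \<union> - C) (\<lambda>z. u z * h z)"
    using assms by (intro continuous_on_open_Un) auto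
  moreover have "S \<union> - C = UNIV" using assms by auto
  ultimately show ?thesis by simp
qed

text \<open>The difference of the two integrands is the derivative of the Wronskian
  \<open>u * h1 - u1 * h\<close>, so both integrations by parts happen in one step.\<close>

lemma green_direction:
  fixes u u1 u2 h h1 h2 :: "complex \<Rightarrow> real"
  assumes S: "open S" "compact C" "C \<subseteq> S"
    and u: "\<And>z. z \<in> S \<Longrightarrow> has_dir_deriv u v u1 z" "\<And>z. z \<in> S \<Longrightarrow> has_dir_deriv u1 v u2 z"
    and cu: "continuous_on S u" "continuous_on S u1" "continuous_on S u2"
    and h: "\<And>z. has_dir_deriv h v h1 z" "\<And>z. has_dir_deriv h1 v h2 z"
    and ch: "continuous_on UNIV h" "continuous_on UNIV h1" "continuous_on UNIV h2"
    and h0: "\<And>z. z \<notin> C \<Longrightarrow> h z = 0" "\<And>z. z \<notin> C \<Longrightarrow> h1 z = 0" "\<And>z. z \<notin> C \<Longrightarrow> h2 z = 0"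
  shows "integrable lborel (\<lambda>z. u z * h2 z)" "integrable lborel (\<lambda>z. u2 z * h z)"
    "(\<integral>z. u z * h2 z \<partial>lborel) = (\<integral>z. u2 z * h z \<partial>lborel)"
proof -
  have cl: "closed C" using S(2) by (rule compact_imp_closed)
  note cont = continuous_on_mult_compact_support[OF S(1) cl S(3)]
  show i1: "integrable lborel (\<lambda>z. u z * h2 z)"
    by (rule integrable_continuous_compact_support[OF cont S(2)]) (use cu ch h0 in auto)
  show i2: "integrable lborel (\<lambda>z. u2 z * h z)"
    by (rule integrable_continuous_compact_support[OF cont S(2)]) (use cu ch h0 in auto)
  have "(\<integral>z. u z * h2 z - u2 z * h z \<partial>lborel) = 0"
  proof (rule integral_dir_deriv_eq_0[where V = "\<lambda>z. u z * h1 z - u1 z * h z" and v = v and C = C])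
    fix z
    show "has_dir_deriv (\<lambda>z. u z * h1 z - u1 z * h z) v (\<lambda>z. u z * h2 z - u2 z * h z) z"
    proof (cases "z \<in> S")
      case True
      note d = u(1)[OF True] u(2)[OF True] h(1)[of z] h(2)[of z]
      show ?thesis using d unfolding has_dir_deriv_def
        by (auto intro!: derivative_eq_intros simp: algebra_simps)
    next
      case False
      have zC: "z \<in> - C" using False S(3) by blast
      have "has_dir_deriv (\<lambda>_. 0) v (\<lambda>_. 0) z" by (simp add: has_dir_deriv_def)
      then show ?thesis
        by (rule has_dir_deriv_transform[where S = "- C"]) (use zC cl h0 in auto)
    qed
    show "continuous_on UNIV (\<lambda>z. u z * h1 z - u1 z * h z)" "continuous_on UNIV (\<lambda>z. u z * h2 z - u2 z * h z)"
      by (intro continuous_on_diff cont cu ch h0; assumption)+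
  qed (use S h0 in auto)
  then show "(\<integral>z. u z * h2 z \<partial>lborel) = (\<integral>z. u2 z * h z \<partial>lborel)" using i1 i2 by simp
qed

text \<open>The data of a compactly supported \<open>C\<^sup>2\<close> function: its support \<open>C\<close>, and its pure first and
  second partial derivatives, direction \<open>1\<close> or \<open>\<i>\<close> being the second argument of \<open>h1\<close>, \<open>h2\<close>.\<close>

locale C2_compact =
  fixes C :: "complex set" and h :: "complex \<Rightarrow> real" and h1 h2 :: "complex \<Rightarrow> complex \<Rightarrow> real"
  assumes C: "compact C"
    and deriv: "\<And>v z. v \<in> {1, \<i>} \<Longrightarrow> has_dir_deriv h v (h1 v) z" "\<And>v z. v \<in> {1, \<i>} \<Longrightarrow> has_dir_deriv (h1 v) v (h2 v) z"
    and cont: "continuous_on UNIV h" "\<And>v. v \<in> {1, \<i>} \<Longrightarrow> continuous_on UNIV (h1 v)"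
      "\<And>v. v \<in> {1, \<i>} \<Longrightarrow> continuous_on UNIV (h2 v)"
    and supp: "\<And>z. z \<notin> C \<Longrightarrow> h z = 0" "\<And>v z. v \<in> {1, \<i>} \<Longrightarrow> z \<notin> C \<Longrightarrow> h1 v z = 0"
      "\<And>v z. v \<in> {1, \<i>} \<Longrightarrow> z \<notin> C \<Longrightarrow> h2 v z = 0"
begin

definition lap where "lap z = h2 1 z + h2 \<i> z"

lemma continuous_lap: "continuous_on UNIV lap"
  unfolding lap_def by (intro continuous_on_add cont) auto

lemma lap_supp: "z \<notin> C \<Longrightarrow> lap z = 0"
  by (simp add: lap_def supp)

lemma integrable_h: "integrable lborel h"
  by (rule integrable_continuous_compact_support[OF cont(1) C supp(1)])

lemma bounded_lap: obtains B where "B \<ge> 0" "\<And>z. \<bar>lap z\<bar> \<le> B"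
proof -
  have "bounded (lap ` C)"
    by (rule compact_imp_bounded[OF compact_continuous_image[OF continuous_on_subset[OF continuous_lap] C]]) simp
  then obtain B where B: "B > 0" "\<And>z. z \<in> C \<Longrightarrow> \<bar>lap z\<bar> \<le> B" unfolding bounded_pos by auto
  then have "\<bar>lap z\<bar> \<le> B" for z using lap_supp by (cases "z \<in> C") auto
  then show thesis using that B(1) by (meson less_imp_le)
qed

lemma bounded_h: obtains B where "B \<ge> 0" "\<And>z. \<bar>h z\<bar> \<le> B"
proof -
  have "bounded (h ` C)"
    by (rule compact_imp_bounded[OF compact_continuous_image[OF continuous_on_subset[OF cont(1)] C]]) simp
  then obtain B where B: "B > 0" "\<And>z. z \<in> C \<Longrightarrow> \<bar>h z\<bar> \<le> B" unfolding bounded_pos by auto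
  then have "\<bar>h z\<bar> \<le> B" for z using supp(1) by (cases "z \<in> C") auto
  then show thesis using that B(1) by (meson less_imp_le)
qed

lemma green:
  assumes S: "open S" "C \<subseteq> S"
    and u: "\<And>v z. v \<in> {1, \<i>} \<Longrightarrow> z \<in> S \<Longrightarrow> has_dir_deriv u v (u1 v) z"
      "\<And>v z. v \<in> {1, \<i>} \<Longrightarrow> z \<in> S \<Longrightarrow> has_dir_deriv (u1 v) v (u2 v) z"
    and cu: "continuous_on S u" "\<And>v. v \<in> {1, \<i>} \<Longrightarrow> continuous_on S (u1 v)"
      "\<And>v. v \<in> {1, \<i>} \<Longrightarrow> continuous_on S (u2 v)"
  shows "integrable lborel (\<lambda>z. u z * lap z)"
    "(\<integral>z. u z * lap z \<partial>lborel) = (\<integral>z. (u2 1 z + u2 \<i> z) * h z \<partial>lborel)"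
proof -
  have g: "integrable lborel (\<lambda>z. u z * h2 v z)" "integrable lborel (\<lambda>z. u2 v z * h z)"
    "(\<integral>z. u z * h2 v z \<partial>lborel) = (\<integral>z. u2 v z * h z \<partial>lborel)" if "v \<in> {1, \<i>}" for v
    using green_direction[OF S(1) C S(2) u(1)[OF that] u(2)[OF that] cu(1) cu(2)[OF that] cu(3)[OF that]
        deriv(1)[OF that] deriv(2)[OF that] cont(1) cont(2)[OF that] cont(3)[OF that]
        supp(1) supp(2)[OF that] supp(3)[OF that]] by auto
  have g1: "integrable lborel (\<lambda>z. u z * h2 1 z)" "integrable lborel (\<lambda>z. u2 1 z * h z)"
    "(\<integral>z. u z * h2 1 z \<partial>lborel) = (\<integral>z. u2 1 z * h z \<partial>lborel)" using g[of 1] by auto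
  have gi: "integrable lborel (\<lambda>z. u z * h2 \<i> z)" "integrable lborel (\<lambda>z. u2 \<i> z * h z)"
    "(\<integral>z. u z * h2 \<i> z \<partial>lborel) = (\<integral>z. u2 \<i> z * h z \<partial>lborel)" using g[of \<i>] by auto
  show "integrable lborel (\<lambda>z. u z * lap z)" "(\<integral>z. u z * lap z \<partial>lborel) = (\<integral>z. (u2 1 z + u2 \<i> z) * h z \<partial>lborel)"
    using g1 gi by (simp_all add: lap_def distrib_left distrib_right)
qed

end

section \<open>The regularised logarithm and its Laplacian\<close>

definition dot :: "complex \<Rightarrow> complex \<Rightarrow> real" where
  "dot z v = Re z * Re v + Im z * Im v"

text \<open>A smooth approximation of ln |z - a| from above. Its Laplacian is a positive kernel
  concentrating at \<open>a\<close>, which replaces the delta distribution.\<close>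

definition reg_log :: "real \<Rightarrow> complex \<Rightarrow> complex \<Rightarrow> real" where
  "reg_log \<epsilon> a z = ln ((cmod (z - a))\<^sup>2 + \<epsilon>\<^sup>2) / 2"

lemma has_dir_deriv_norm_sq:
  "has_dir_deriv (\<lambda>z. (cmod (z - a))\<^sup>2) v (\<lambda>z. 2 * dot (z - a) v) z"
  unfolding has_dir_deriv_def cmod_power2 dot_def
  by (auto intro!: derivative_eq_intros simp: algebra_simps)

lemma has_dir_deriv_dot:
  "has_dir_deriv (\<lambda>z. dot (z - a) v) v (\<lambda>z. (cmod v)\<^sup>2) z"
  unfolding has_dir_deriv_def cmod_power2 dot_def
  by (auto intro!: derivative_eq_intros simp: algebra_simps power2_eq_square)

lemma continuous_on_dot: "continuous_on S (\<lambda>z. dot (z - a) v)"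
  unfolding dot_def by (intro continuous_intros)

lemma reg_log_arg_pos: "\<epsilon> > 0 \<Longrightarrow> 0 < (cmod (z - a))\<^sup>2 + \<epsilon>\<^sup>2"
  by (simp add: add_nonneg_pos)

lemma has_dir_deriv_reg_log:
  assumes "\<epsilon> > 0"
  shows "has_dir_deriv (reg_log \<epsilon> a) v (\<lambda>z. dot (z - a) v / ((cmod (z - a))\<^sup>2 + \<epsilon>\<^sup>2)) z"
    "has_dir_deriv (\<lambda>z. dot (z - a) v / ((cmod (z - a))\<^sup>2 + \<epsilon>\<^sup>2)) v
      (\<lambda>z. (cmod v)\<^sup>2 / ((cmod (z - a))\<^sup>2 + \<epsilon>\<^sup>2) - 2 * (dot (z - a) v)\<^sup>2 / ((cmod (z - a))\<^sup>2 + \<epsilon>\<^sup>2)\<^sup>2) z"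
proof -
  define f where "f t = (cmod (z + of_real t * v - a))\<^sup>2 + \<epsilon>\<^sup>2" for t :: real
  define g where "g t = dot (z + of_real t * v - a) v" for t :: real
  have q: "f 0 > 0" using reg_log_arg_pos[OF assms, of z a] by (simp add: f_def)
  have f: "(f has_real_derivative 2 * g 0) (at 0)"
    unfolding f_def g_def
    using DERIV_add[OF has_dir_deriv_norm_sq[of a v z, unfolded has_dir_deriv_def] DERIV_const[of "\<epsilon>\<^sup>2"]] by simp
  have g: "(g has_real_derivative (cmod v)\<^sup>2) (at 0)"
    unfolding g_def using has_dir_deriv_dot[of a v z] by (simp add: has_dir_deriv_def)
  have "((\<lambda>t. ln (f t) / 2) has_real_derivative g 0 / f 0) (at 0)"
    using f q by (auto intro!: derivative_eq_intros)
  then show "has_dir_deriv (reg_log \<epsilon> a) v (\<lambda>z. dot (z - a) v / ((cmod (z - a))\<^sup>2 + \<epsilon>\<^sup>2)) z"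
    by (simp add: has_dir_deriv_def reg_log_def f_def g_def)
  have "((\<lambda>t. g t / f t) has_real_derivative (cmod v)\<^sup>2 / f 0 - 2 * (g 0)\<^sup>2 / (f 0)\<^sup>2) (at 0)"
    using f g q by (auto intro!: derivative_eq_intros simp: field_simps power2_eq_square)
  then show "has_dir_deriv (\<lambda>z. dot (z - a) v / ((cmod (z - a))\<^sup>2 + \<epsilon>\<^sup>2)) v
      (\<lambda>z. (cmod v)\<^sup>2 / ((cmod (z - a))\<^sup>2 + \<epsilon>\<^sup>2) - 2 * (dot (z - a) v)\<^sup>2 / ((cmod (z - a))\<^sup>2 + \<epsilon>\<^sup>2)\<^sup>2) z"
    by (simp add: has_dir_deriv_def f_def g_def)
qed

text \<open>The squares of \<open>dot\<close> along \<open>1\<close> and \<open>\<i>\<close> add up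
  to |z - a|^2. In two dimensions the numerator over the common denominator is therefore 2 (q - |z -
  a|^2), and only the regularisation survives.\<close>

lemma reg_log_lap:
  assumes "\<epsilon> > 0"
  shows "(\<Sum>v\<in>{1, \<i>}. (cmod v)\<^sup>2 / ((cmod (z - a))\<^sup>2 + \<epsilon>\<^sup>2)
      - 2 * (dot (z - a) v)\<^sup>2 / ((cmod (z - a))\<^sup>2 + \<epsilon>\<^sup>2)\<^sup>2) = 2 * \<epsilon>\<^sup>2 / ((cmod (z - a))\<^sup>2 + \<epsilon>\<^sup>2)\<^sup>2"
proof -
  define q where "q = (cmod (z - a))\<^sup>2 + \<epsilon>\<^sup>2"
  have q: "q > 0" using reg_log_arg_pos[OF assms] by (simp add: q_def)
  have "(\<Sum>v\<in>{1, \<i>}. (cmod v)\<^sup>2 / q - 2 * (dot (z - a) v)\<^sup>2 / q\<^sup>2) = 2 / q - 2 * (cmod (z - a))\<^sup>2 / q\<^sup>2"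
    by (simp add: dot_def cmod_power2 add_divide_distrib algebra_simps)
  also have "\<dots> = 2 * (q - (cmod (z - a))\<^sup>2) / q\<^sup>2"
    using q by (simp add: field_simps power2_eq_square)
  also have "q - (cmod (z - a))\<^sup>2 = \<epsilon>\<^sup>2" by (simp add: q_def)
  finally show ?thesis by (simp add: q_def)
qed

section \<open>The approximate identity produced by the regularisation\<close>

lemma kernel_integral:
  "integrable lborel (\<lambda>w::complex. 1 / (1 + (cmod w)\<^sup>2)\<^sup>2)"
  "(\<integral>w. 1 / (1 + (cmod w)\<^sup>2)\<^sup>2 \<partial>lborel) = pi"
proof -
  have psf: "pair_sigma_finite (lborel :: complex measure) (lborel :: real measure)" ..
  have lim1: "((\<lambda>t::real. - 1 / (1 + t)\<^sup>2) \<longlongrightarrow> 0) at_top"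
    by real_asymp
  \<comment> \<open>Layer-cake form in place of polar coordinates: the kernel is the integral of 2 /
    (1 + t)^3 over t \<ge> |w|^2, so after exchanging the integrals only the area
    \<open>pi * t\<close> of a disc is needed.\<close>
  have 1: "ennreal (1 / (1 + (cmod w)\<^sup>2)\<^sup>2) = (\<integral>\<^sup>+t. ennreal (2 / (1 + t) ^ 3) * indicator {(cmod w)\<^sup>2 ..} t \<partial>lborel)" for w
  proof -
    have "(\<integral>\<^sup>+t. ennreal (2 / (1 + t) ^ 3) * indicator {(cmod w)\<^sup>2 ..} t \<partial>lborel)
       = ennreal (0 - (- 1 / (1 + (cmod w)\<^sup>2)\<^sup>2))"
    proof (rule nn_integral_FTC_atLeast[OF _ _ _ lim1])
      fix t :: real assume "(cmod w)\<^sup>2 \<le> t"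
      then have t: "t \<ge> 0" by (rule order_trans[rotated]) simp
      then have "1 + t \<noteq> 0" by simp
      moreover have "- ((- 2 - 2 * t) / (1 + t) ^ 4) = 2 / (1 + t) ^ 3"
      proof -
        have "- ((- 2 - 2 * t) / (1 + t) ^ 4) = (2 * (1 + t)) / ((1 + t) ^ 3 * (1 + t))"
          by (simp add: eval_nat_numeral minus_divide_left mult_ac)
        then show ?thesis using \<open>1 + t \<noteq> 0\<close> using mult_divide_mult_cancel_right[of "1 + t" 2 "(1 + t) ^ 3"] by metis
      qed
      ultimately show "((\<lambda>t. - 1 / (1 + t)\<^sup>2) has_real_derivative 2 / (1 + t) ^ 3) (at t)"
        by (auto intro!: derivative_eq_intros)
      show "0 \<le> 2 / (1 + t) ^ 3" using t by simp
    qed simp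
    then show ?thesis by simp
  qed
  \<comment> \<open>This function vanishes at 0 and is the antiderivative of 2 pi t / (1 + t)^3, the
    integrand left after the exchange.\<close>
  have lim2: "((\<lambda>t::real. pi * t\<^sup>2 / (1 + t)\<^sup>2) \<longlongrightarrow> pi) at_top"
    by real_asymp
  have em: "emeasure lborel {w::complex. (cmod w)\<^sup>2 \<le> t} = ennreal (pi * t)" if "t \<ge> 0" for t
  proof -
    have "{w::complex. (cmod w)\<^sup>2 \<le> t} = cball 0 (sqrt t)"
      using that by (auto simp: real_le_rsqrt sqrt_ge_absD intro: power_mono dest: real_sqrt_le_mono)
    then show ?thesis using that by (simp add: emeasure_cball eval_unit_ball_vol)
  qed
  have "(\<integral>\<^sup>+w. ennreal (1 / (1 + (cmod w)\<^sup>2)\<^sup>2) \<partial>lborel)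
    = (\<integral>\<^sup>+w. (\<integral>\<^sup>+t. ennreal (2 / (1 + t) ^ 3) * indicator {t. (cmod w)\<^sup>2 \<le> t} t \<partial>lborel) \<partial>lborel)"
    by (simp add: 1 atLeast_def)
  also have "\<dots> = (\<integral>\<^sup>+t. (\<integral>\<^sup>+w. ennreal (2 / (1 + t) ^ 3) * indicator {t. (cmod w)\<^sup>2 \<le> t} t \<partial>lborel) \<partial>lborel)"
    by (rule pair_sigma_finite.Fubini'[OF psf, symmetric]) (simp add: split_beta' indicator_def of_bool_def)
  also have "\<dots> = (\<integral>\<^sup>+t. ennreal (2 * pi * t / (1 + t) ^ 3) * indicator {0..} t \<partial>lborel)"
  proof (intro nn_integral_cong)
    fix t :: real
    have "(\<integral>\<^sup>+w. ennreal (2 / (1 + t) ^ 3) * indicator {t. (cmod w)\<^sup>2 \<le> t} t \<partial>lborel)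
      = (\<integral>\<^sup>+w. ennreal (2 / (1 + t) ^ 3) * indicator {w. (cmod w)\<^sup>2 \<le> t} w \<partial>lborel)"
      by (intro nn_integral_cong) (auto simp: indicator_def)
    also have "\<dots> = ennreal (2 / (1 + t) ^ 3) * emeasure lborel {w::complex. (cmod w)\<^sup>2 \<le> t}"
      by (intro nn_integral_cmult_indicator) auto
    also have "\<dots> = ennreal (2 * pi * t / (1 + t) ^ 3) * indicator {0..} t"
    proof (cases "t \<ge> 0")
      case True then show ?thesis by (simp add: em ennreal_mult[symmetric])
    next
      case False
      then have "{w::complex. (cmod w)\<^sup>2 \<le> t} = {}" by (auto simp: not_le intro: less_le_trans)
      then show ?thesis using False by simp
    qed
    finally show "(\<integral>\<^sup>+w. ennreal (2 / (1 + t) ^ 3) * indicator {t. (cmod w)\<^sup>2 \<le> t} t \<partial>lborel)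
      = ennreal (2 * pi * t / (1 + t) ^ 3) * indicator {0..} t" .
  qed
  also have "\<dots> = ennreal (pi - pi * 0\<^sup>2 / (1 + 0)\<^sup>2)"
  proof (rule nn_integral_FTC_atLeast[OF _ _ _ lim2])
    fix t :: real assume t: "0 \<le> t"
    then have "1 + t \<noteq> 0" by simp
    moreover have "(2 * t * pi * s\<^sup>2 - pi * t\<^sup>2 * (2 * s)) / (s\<^sup>2 * s\<^sup>2) = 2 * pi * t / s ^ 3" if "s = 1 + t" for s
    proof -
      have "s \<noteq> 0" using t that by simp
      then have "(2 * t * pi * s\<^sup>2 - pi * t\<^sup>2 * (2 * s)) / (s\<^sup>2 * s\<^sup>2) = 2 * pi * t * (s - t) / s ^ 3"
        by (simp add: power2_eq_square power3_eq_cube field_simps)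
      then show ?thesis using that by simp
    qed
    ultimately show "((\<lambda>t. pi * t\<^sup>2 / (1 + t)\<^sup>2) has_real_derivative 2 * pi * t / (1 + t) ^ 3) (at t)"
      by (auto intro!: derivative_eq_intros)
    show "0 \<le> 2 * pi * t / (1 + t) ^ 3" using t by simp
  qed simp
  finally have nn: "(\<integral>\<^sup>+w. ennreal (1 / (1 + (cmod w)\<^sup>2)\<^sup>2) \<partial>lborel) = ennreal pi" by simp
  have m: "(\<lambda>w::complex. 1 / (1 + (cmod w)\<^sup>2)\<^sup>2) \<in> borel_measurable lborel" by measurable
  have hb: "has_bochner_integral lborel (\<lambda>w::complex. 1 / (1 + (cmod w)\<^sup>2)\<^sup>2) pi"
    by (rule has_bochner_integral_nn_integral[OF m _ _ nn]) auto
  show "integrable lborel (\<lambda>w::complex. 1 / (1 + (cmod w)\<^sup>2)\<^sup>2)"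
    "(\<integral>w. 1 / (1 + (cmod w)\<^sup>2)\<^sup>2 \<partial>lborel) = pi"
    using hb by (auto simp: has_bochner_integral_iff)
qed

lemma integral_rescale:
  fixes f :: "complex \<Rightarrow> real"
  assumes "f \<in> borel_measurable borel" "\<epsilon> > 0"
  shows "(\<integral>z. f z \<partial>lborel) = (\<integral>w. \<epsilon>\<^sup>2 * f (a + of_real \<epsilon> * w) \<partial>lborel)"
proof -
  have "(\<integral>z. f z \<partial>lborel) = (\<integral>z. f z \<partial>density (distr lborel borel (\<lambda>x. a + \<epsilon> *\<^sub>R x)) (\<lambda>_. \<bar>\<epsilon>\<bar> ^ DIM(complex)))"
    using assms lborel_affine[of \<epsilon> a] by simp
  also have "\<dots> = (\<integral>z. \<epsilon>\<^sup>2 * f z \<partial>distr lborel borel (\<lambda>x. a + \<epsilon> *\<^sub>R x))"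
    using assms by (subst integral_density) (auto simp: ennreal_power)
  also have "\<dots> = (\<integral>w. \<epsilon>\<^sup>2 * f (a + \<epsilon> *\<^sub>R w) \<partial>lborel)"
    using assms by (intro integral_distr) auto
  finally show ?thesis by (simp add: scaleR_conv_of_real)
qed

text \<open>Substituting z = a + \<epsilon> w frees the kernel of \<epsilon> and moves it into the
  argument of \<open>h\<close>. Since \<open>h\<close> is bounded, a multiple of the fixed kernel
  dominates.\<close>

lemma approximate_identity:
  assumes h: "continuous_on UNIV h" "\<And>z. \<bar>h z\<bar> \<le> B" and \<epsilon>: "\<And>n. \<epsilon> n > 0" "\<epsilon> \<longlonglongrightarrow> 0"
  shows "(\<lambda>n. \<integral>z. 2 * (\<epsilon> n)\<^sup>2 / ((cmod (z - a))\<^sup>2 + (\<epsilon> n)\<^sup>2)\<^sup>2 * h z \<partial>lborel) \<longlonglongrightarrow> 2 * pi * h a"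
proof -
  have [measurable]: "h \<in> borel_measurable borel" using h(1) by (rule borel_measurable_continuous_onI)
  have eq: "(\<integral>z. 2 * (\<epsilon> n)\<^sup>2 / ((cmod (z - a))\<^sup>2 + (\<epsilon> n)\<^sup>2)\<^sup>2 * h z \<partial>lborel)
     = (\<integral>w. 2 * (1 / (1 + (cmod w)\<^sup>2)\<^sup>2) * h (a + of_real (\<epsilon> n) * w) \<partial>lborel)" for n
  proof -
    have alg: "e\<^sup>2 * (2 * e\<^sup>2 / (e\<^sup>2 * x + e\<^sup>2)\<^sup>2 * y) = 2 * (1 / (1 + x)\<^sup>2) * y" if "e > 0" "x \<ge> 0" for e x y :: real
    proof -
      have sq: "(e\<^sup>2 * x + e\<^sup>2)\<^sup>2 = e\<^sup>2 * e\<^sup>2 * (1 + x)\<^sup>2" by (simp add: power2_eq_square algebra_simps)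
      have cancel: "E * (2 * E / (E * E * X) * y) = 2 * (1 / X) * y" if "E \<noteq> 0" "X \<noteq> 0" for E X :: real
        using that by (simp add: field_simps)
      show ?thesis unfolding sq by (rule cancel) (use that in auto)
    qed
    have "(\<integral>z. 2 * (\<epsilon> n)\<^sup>2 / ((cmod (z - a))\<^sup>2 + (\<epsilon> n)\<^sup>2)\<^sup>2 * h z \<partial>lborel)
      = (\<integral>w. (\<epsilon> n)\<^sup>2 * (2 * (\<epsilon> n)\<^sup>2 / ((cmod (a + of_real (\<epsilon> n) * w - a))\<^sup>2 + (\<epsilon> n)\<^sup>2)\<^sup>2
          * h (a + of_real (\<epsilon> n) * w)) \<partial>lborel)"
      by (rule integral_rescale[OF _ \<epsilon>(1)]) measurable
    also have "\<dots> = (\<integral>w. 2 * (1 / (1 + (cmod w)\<^sup>2)\<^sup>2) * h (a + of_real (\<epsilon> n) * w) \<partial>lborel)"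
      by (intro Bochner_Integration.integral_cong refl)
        (simp only: add_diff_cancel_left' norm_mult norm_of_real power_mult_distrib power2_abs
          alg[OF \<epsilon>(1) zero_le_power2])
    finally show ?thesis .
  qed
  have "(\<lambda>n. \<integral>w. 2 * (1 / (1 + (cmod w)\<^sup>2)\<^sup>2) * h (a + of_real (\<epsilon> n) * w) \<partial>lborel)
     \<longlonglongrightarrow> (\<integral>w. 2 * (1 / (1 + (cmod w)\<^sup>2)\<^sup>2) * h a \<partial>lborel)"
  proof (rule integral_dominated_convergence)
    show "integrable lborel (\<lambda>w::complex. 2 * B * (1 / (1 + (cmod w)\<^sup>2)\<^sup>2))"
      by (intro integrable_mult_right kernel_integral)
    show "AE w in lborel. (\<lambda>n. 2 * (1 / (1 + (cmod w)\<^sup>2)\<^sup>2) * h (a + of_real (\<epsilon> n) * w))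
      \<longlonglongrightarrow> 2 * (1 / (1 + (cmod w)\<^sup>2)\<^sup>2) * h a"
    proof (intro AE_I2 tendsto_mult tendsto_const)
      fix w
      have "isCont h (a + of_real 0 * w)" using h(1) by (simp add: continuous_on_eq_continuous_at)
      moreover have "(\<lambda>n. a + of_real (\<epsilon> n) * w) \<longlonglongrightarrow> a + of_real 0 * w"
        by (intro tendsto_intros \<epsilon>)
      ultimately have "(\<lambda>n. h (a + of_real (\<epsilon> n) * w)) \<longlonglongrightarrow> h (a + of_real 0 * w)"
        by (rule isCont_tendsto_compose)
      then show "(\<lambda>n. h (a + of_real (\<epsilon> n) * w)) \<longlonglongrightarrow> h a" by simp
    qed
    show "AE w in lborel. norm (2 * (1 / (1 + (cmod w)\<^sup>2)\<^sup>2) * h (a + of_real (\<epsilon> n) * w))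
      \<le> 2 * B * (1 / (1 + (cmod w)\<^sup>2)\<^sup>2)" for n
      using h(2) by (intro AE_I2) (auto simp: abs_mult divide_right_mono)
  qed measurable
  moreover have "(\<integral>w. 2 * (1 / (1 + (cmod w)\<^sup>2)\<^sup>2) * h a \<partial>lborel) = 2 * pi * h a"
    by (simp only: integral_mult_left_zero integral_mult_right_zero kernel_integral(2))
  ultimately show ?thesis by (simp only: eq)
qed

lemma (in C2_compact) green_reg_log:
  assumes "\<epsilon> > 0"
  shows "integrable lborel (\<lambda>z. reg_log \<epsilon> a z * lap z)"
    "(\<integral>z. reg_log \<epsilon> a z * lap z \<partial>lborel) = (\<integral>z. 2 * \<epsilon>\<^sup>2 / ((cmod (z - a))\<^sup>2 + \<epsilon>\<^sup>2)\<^sup>2 * h z \<partial>lborel)"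
proof -
  note q = reg_log_arg_pos[OF assms]
  have nz: "(cmod (z - a))\<^sup>2 + \<epsilon>\<^sup>2 \<noteq> 0" for z using q[of z a] by (rule less_imp_neq[symmetric])
  have c: "continuous_on UNIV (reg_log \<epsilon> a)"
    unfolding reg_log_def using nz by (intro continuous_intros) auto
  have c1: "continuous_on UNIV (\<lambda>z. dot (z - a) v / ((cmod (z - a))\<^sup>2 + \<epsilon>\<^sup>2))" for v
    using nz by (intro continuous_intros continuous_on_dot) auto
  have c2: "continuous_on UNIV (\<lambda>z. (cmod v)\<^sup>2 / ((cmod (z - a))\<^sup>2 + \<epsilon>\<^sup>2)
      - 2 * (dot (z - a) v)\<^sup>2 / ((cmod (z - a))\<^sup>2 + \<epsilon>\<^sup>2)\<^sup>2)" for v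
    using nz by (intro continuous_intros continuous_on_dot) auto
  note g = green[OF open_UNIV subset_UNIV has_dir_deriv_reg_log(1)[OF assms]
      has_dir_deriv_reg_log(2)[OF assms] c c1 c2]
  show "integrable lborel (\<lambda>z. reg_log \<epsilon> a z * lap z)" by (rule g(1))
  show "(\<integral>z. reg_log \<epsilon> a z * lap z \<partial>lborel) = (\<integral>z. 2 * \<epsilon>\<^sup>2 / ((cmod (z - a))\<^sup>2 + \<epsilon>\<^sup>2)\<^sup>2 * h z \<partial>lborel)"
    using g(2) reg_log_lap[OF assms, of _ a] by simp
qed

text \<open>|z|^2 has the constant Laplacian 4, so the term -|z|^2 / 4 of \<phi> contributes minus
  Lebesgue measure.\<close>

lemma (in C2_compact) green_norm_sq:
  "integrable lborel (\<lambda>z. (cmod z)\<^sup>2 * lap z)" "(\<integral>z. (cmod z)\<^sup>2 * lap z \<partial>lborel) = 4 * (\<integral>z. h z \<partial>lborel)"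
proof -
  have d2: "has_dir_deriv (\<lambda>z. 2 * dot (z - 0) v) v (\<lambda>z. 2 * (cmod v)\<^sup>2) z" for v z
    using has_dir_deriv_dot[of 0 v z] unfolding has_dir_deriv_def by (auto intro!: derivative_eq_intros)
  note g = green[OF open_UNIV subset_UNIV has_dir_deriv_norm_sq[of 0] d2]
  have c: "continuous_on UNIV (\<lambda>z. (cmod (z - 0))\<^sup>2)" "continuous_on UNIV (\<lambda>z. 2 * dot (z - 0) v)"
    "continuous_on UNIV (\<lambda>z::complex. 2 * (cmod v)\<^sup>2)" for v
    by (intro continuous_intros continuous_on_dot)+
  show "integrable lborel (\<lambda>z. (cmod z)\<^sup>2 * lap z)" using g(1)[OF c] by simp
  show "(\<integral>z. (cmod z)\<^sup>2 * lap z \<partial>lborel) = 4 * (\<integral>z. h z \<partial>lborel)" using g(2)[OF c] by simp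
qed

lemma (in C2_compact) green_harmonic:
  assumes S: "open S" "C \<subseteq> S" and G: "G holomorphic_on S"
  shows "integrable lborel (\<lambda>z. Re (G z) * lap z)" "(\<integral>z. Re (G z) * lap z \<partial>lborel) = 0"
proof -
  \<comment> \<open>The factor \<open>c\<close> makes the fact reusable for \<open>deriv G\<close>:
    the second derivative along \<open>v\<close> carries \<open>v * v\<close>, and the sum over
    \<open>1\<close> and \<open>\<i>\<close> vanishes because these squares are 1 and -1.\<close>
  have d: "has_dir_deriv (\<lambda>z. Re (F z * c)) v (\<lambda>z. Re (deriv F z * (c * v))) z"
    if "F holomorphic_on S" "z \<in> S" for F z v c
  proof -
    have F: "(F has_field_derivative deriv F z) (at z)" using that(1) S(1) that(2) by (rule holomorphic_derivI)
    have "((\<lambda>t::real. z + of_real t * v) has_vector_derivative v) (at 0)"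
      by (auto intro!: derivative_eq_intros)
    then have "((F \<circ> (\<lambda>t::real. z + of_real t * v)) has_vector_derivative v * deriv F z) (at 0)"
      by (rule field_vector_diff_chain_at) (use F in simp)
    then have "((\<lambda>t::real. F (z + of_real t * v) * c) has_vector_derivative v * deriv F z * c) (at 0)"
      by (intro has_vector_derivative_mult_left) (simp add: o_def)
    then have "((\<lambda>t::real. Re (F (z + of_real t * v) * c)) has_vector_derivative Re (v * deriv F z * c)) (at 0)"
      by (rule bounded_linear.has_vector_derivative[OF bounded_linear_Re])
    then show ?thesis
      by (simp add: has_dir_deriv_def has_real_derivative_iff_has_vector_derivative mult_ac)
  qed
  have G': "deriv G holomorphic_on S" and G'': "deriv (deriv G) holomorphic_on S"
    using G S(1) by (auto intro: holomorphic_deriv)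
  have cG: "continuous_on S (\<lambda>z. Re (G z * 1))" "continuous_on S (\<lambda>z. Re (deriv G z * (1 * v)))"
    "continuous_on S (\<lambda>z. Re (deriv (deriv G) z * ((1 * v) * v)))" for v
    by (intro continuous_intros holomorphic_on_imp_continuous_on G G' G'')+
  note g = green[OF S d[OF G] d[OF G'] cG]
  show "integrable lborel (\<lambda>z. Re (G z) * lap z)" using g(1) by simp
  show "(\<integral>z. Re (G z) * lap z \<partial>lborel) = 0" using g(2) by (simp add: mult.assoc)
qed

section \<open>Factoring out the zeros of an entire function\<close>

lemma entire_zorder:
  assumes "\<psi> holomorphic_on UNIV" "\<psi> w0 \<noteq> 0"
  shows "if \<psi> z = 0 then zorder \<psi> z > 0 else zorder \<psi> z = 0"
    "\<exists>r>0. zor_poly \<psi> z holomorphic_on cball z r \<and>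
      (\<forall>w\<in>cball z r. \<psi> w = zor_poly \<psi> z w * (w - z) ^ nat (zorder \<psi> z) \<and> zor_poly \<psi> z w \<noteq> 0)"
  using zorder_exist_zero[OF assms(1) open_UNIV connected_UNIV UNIV_I, of z] assms(2) by blast+

lemma entire_finite_zeros:
  assumes "\<psi> holomorphic_on UNIV" "\<psi> w0 \<noteq> 0"
  shows "finite {z \<in> cball a \<rho>. \<psi> z = 0}"
proof (cases "\<psi> constant_on UNIV")
  case True
  then have "{z \<in> cball a \<rho>. \<psi> z = 0} = {}" using assms(2) by (auto simp: constant_on_def)
  then show ?thesis by (simp only: finite.emptyI)
next
  case False
  then show ?thesis
    using holomorphic_compact_finite_zeros[OF assms(1) open_UNIV connected_UNIV compact_cball] by blast
qed

text \<open>Each step divides by the power at one point \<open>b\<close>. Near \<open>b\<close> the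
  quotient is \<open>q / P\<close>, away from \<open>b\<close> it is \<open>g / (z - b) ^ n\<close>;
  the two agree on the overlap, so the glued function is entire and nonzero at
  \<open>b\<close>.\<close>

lemma entire_divide_zeros:
  assumes \<psi>: "\<psi> holomorphic_on UNIV" "\<psi> w0 \<noteq> 0" and "finite A"
  shows "\<exists>g. g holomorphic_on UNIV \<and> (\<forall>z. \<psi> z = g z * (\<Prod>a\<in>A. (z - a) ^ nat (zorder \<psi> a))) \<and> (\<forall>a\<in>A. g a \<noteq> 0)"
  using \<open>finite A\<close>
proof induction
  case empty
  then show ?case using \<psi> by auto
next
  case (insert b A)
  define P where "P z = (\<Prod>a\<in>A. (z - a) ^ nat (zorder \<psi> a))" for z
  define n where "n = nat (zorder \<psi> b)"
  obtain g where g: "g holomorphic_on UNIV" "\<And>z. \<psi> z = g z * P z" "\<And>a. a \<in> A \<Longrightarrow> g a \<noteq> 0"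
    using insert.IH by (auto simp: P_def)
  define q where "q = zor_poly \<psi> b"
  obtain r where r: "r > 0" "q holomorphic_on cball b r" "\<And>w. w \<in> cball b r \<Longrightarrow> \<psi> w = q w * (w - b) ^ n"
    "\<And>w. w \<in> cball b r \<Longrightarrow> q w \<noteq> 0"
    using entire_zorder(2)[OF \<psi>, of b] by (auto simp: q_def n_def)
  have holP: "P holomorphic_on S" for S unfolding P_def by (intro holomorphic_intros)
  define U where "U = ball b r \<inter> - A"
  have U: "open U" "b \<in> U"
    using r(1) insert.hyps by (auto simp: U_def intro: finite_imp_closed)
  have PU: "P w \<noteq> 0" if "w \<in> U" for w using that insert.hyps by (auto simp: P_def U_def)
  define g' where "g' w = (if w = b then q b / P b else g w / (w - b) ^ n)" for w
  have eqU: "g' w = q w / P w" if "w \<in> U" for w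
  proof (cases "w = b")
    case False
    have "g w * P w = q w * (w - b) ^ n" using g(2)[of w] r(3)[of w] that by (simp add: U_def)
    then show ?thesis using False PU[OF that] by (simp add: g'_def field_simps)
  qed (simp add: g'_def)
  have "q holomorphic_on U" using r(2) by (rule holomorphic_on_subset) (auto simp: U_def)
  then have "(\<lambda>w. q w / P w) holomorphic_on U" using holP PU by (intro holomorphic_intros) auto
  then have 1: "g' holomorphic_on U" using eqU by (simp cong: holomorphic_cong)
  have "(\<lambda>w. g w / (w - b) ^ n) holomorphic_on (- {b})"
    using g(1) by (intro holomorphic_intros) (auto intro: holomorphic_on_subset)
  then have 2: "g' holomorphic_on (- {b})" by (rule holomorphic_transform) (auto simp: g'_def)
  have "g' holomorphic_on (U \<union> - {b})" using 1 2 U by (intro holomorphic_on_Un) auto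
  moreover have "U \<union> - {b} = UNIV" using U by auto
  ultimately have hol: "g' holomorphic_on UNIV" by simp
  have "\<psi> z = g' z * (P z * (z - b) ^ n)" for z
  proof (cases "z = b")
    case True
    have "\<psi> b = q b * (b - b) ^ n" using r by simp
    then show ?thesis using True PU[OF U(2)] by (simp add: g'_def)
  next
    case False
    then show ?thesis using g(2)[of z] by (simp add: g'_def)
  qed
  then have "\<psi> z = g' z * (\<Prod>a\<in>insert b A. (z - a) ^ nat (zorder \<psi> a))" for z
    using insert.hyps by (simp add: P_def n_def mult_ac)
  moreover have "g' a \<noteq> 0" if "a \<in> insert b A" for a
    using that g(3) r(1) r(4)[of b] PU[OF U(2)] insert.hyps by (auto simp: g'_def)
  ultimately show ?case using hol by blast
qed

text \<open>Taking the zeros of the closed disc keeps \<open>A\<close> finite and leaves a cofactor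
  without zeros in the open disc, where convexity provides a holomorphic logarithm \<open>G\<close>.
  The real part of \<open>G\<close> is harmonic and drops out of Green's identity.\<close>

lemma log_norm_decomposition:
  fixes \<rho> :: real
  assumes \<psi>: "\<psi> holomorphic_on UNIV" "\<psi> w0 \<noteq> 0"
  defines "A \<equiv> {z \<in> cball 0 \<rho>. \<psi> z = 0}"
  obtains G where "G holomorphic_on ball 0 \<rho>"
    "\<And>z. z \<in> ball 0 \<rho> - A \<Longrightarrow> ln (cmod (\<psi> z)) = (\<Sum>a\<in>A. real (nat (zorder \<psi> a)) * ln (cmod (z - a))) + Re (G z)"
proof -
  have finA: "finite A" unfolding A_def by (rule entire_finite_zeros[OF \<psi>])
  obtain g where g: "g holomorphic_on UNIV" "\<And>z. \<psi> z = g z * (\<Prod>a\<in>A. (z - a) ^ nat (zorder \<psi> a))"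
    "\<And>a. a \<in> A \<Longrightarrow> g a \<noteq> 0"
    using entire_divide_zeros[OF \<psi> finA] by blast
  have gnz: "g z \<noteq> 0" if "z \<in> ball 0 \<rho>" for z
  proof
    assume "g z = 0"
    then have "\<psi> z = 0" using g(2)[of z] by simp
    then have "z \<in> A" using that by (simp add: A_def)
    then show False using g(3) \<open>g z = 0\<close> by blast
  qed
  have "g holomorphic_on ball 0 \<rho>" using g(1) by (rule holomorphic_on_subset) simp
  then obtain G where G: "G holomorphic_on ball 0 \<rho>" "\<And>z. z \<in> ball 0 \<rho> \<Longrightarrow> g z = exp (G z)"
    using contractible_imp_holomorphic_log[of g "ball 0 \<rho>"] gnz convex_imp_contractible[OF convex_ball] by metis
  show thesis
  proof (rule that[OF G(1)])
    fix z assume z: "z \<in> ball 0 \<rho> - A"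
    have nz: "cmod (z - a) > 0" if "a \<in> A" for a using that z by auto
    have "cmod (\<psi> z) = exp (Re (G z)) * (\<Prod>a\<in>A. cmod (z - a) ^ nat (zorder \<psi> a))"
      using G(2)[of z] z g(2)[of z] by (simp add: norm_mult prod_norm[symmetric] norm_power)
    also have "ln \<dots> = Re (G z) + (\<Sum>a\<in>A. ln (cmod (z - a) ^ nat (zorder \<psi> a)))"
      using nz finA by (subst ln_mult) (auto intro!: prod_pos ln_prod simp: less_imp_neq[symmetric])
    finally show "ln (cmod (\<psi> z)) = (\<Sum>a\<in>A. real (nat (zorder \<psi> a)) * ln (cmod (z - a))) + Re (G z)"
      using nz by (simp add: ln_realpow)
  qed
qed

lemma reg_log_tendsto:
  assumes "z \<noteq> a" "\<epsilon> \<longlonglongrightarrow> 0"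
  shows "(\<lambda>n. reg_log (\<epsilon> n) a z) \<longlonglongrightarrow> ln (cmod (z - a))"
proof -
  have "(\<lambda>n. ln ((cmod (z - a))\<^sup>2 + (\<epsilon> n)\<^sup>2) / 2) \<longlonglongrightarrow> ln ((cmod (z - a))\<^sup>2 + 0\<^sup>2) / 2"
    using assms by (intro tendsto_intros) auto
  then show ?thesis using assms by (simp add: reg_log_def ln_realpow)
qed

lemma reg_log_bounds:
  assumes "z \<noteq> a" "0 < \<epsilon>" "\<epsilon> \<le> 1" "cmod (z - a) \<le> M"
  shows "ln (cmod (z - a)) \<le> reg_log \<epsilon> a z" "reg_log \<epsilon> a z \<le> ln (M\<^sup>2 + 1) / 2"
proof -
  have p: "0 < cmod (z - a)" using assms by simp
  have "2 * ln (cmod (z - a)) = ln ((cmod (z - a))\<^sup>2)" using p by (simp add: ln_realpow)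
  also have "\<dots> \<le> ln ((cmod (z - a))\<^sup>2 + \<epsilon>\<^sup>2)" using p by (intro ln_mono) auto
  finally show "ln (cmod (z - a)) \<le> reg_log \<epsilon> a z" by (simp add: reg_log_def)
  have "(cmod (z - a))\<^sup>2 \<le> M\<^sup>2" "\<epsilon>\<^sup>2 \<le> 1" using assms p by (auto intro: power_mono simp: power_le_one)
  then have "ln ((cmod (z - a))\<^sup>2 + \<epsilon>\<^sup>2) \<le> ln (M\<^sup>2 + 1)"
    using p by (intro ln_mono) (auto intro: add_pos_nonneg)
  then show "reg_log \<epsilon> a z \<le> ln (M\<^sup>2 + 1) / 2" by (simp add: reg_log_def)
qed

text \<open>The regularised logarithms lie between \<open>ln \<bar>\<psi>\<bar>\<close> and a constant on \<open>C\<close>, so local integrability of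
  \<open>ln \<bar>\<psi>\<bar>\<close> as a whole provides the dominating function.\<close>

lemma (in C2_compact) green_log_entire:
  assumes \<psi>: "\<psi> holomorphic_on UNIV" "\<psi> w0 \<noteq> 0" and C\<rho>: "C \<subseteq> ball 0 \<rho>"
    and int: "integrable lborel (\<lambda>z. indicator C z * ln (cmod (\<psi> z)))"
  shows "(\<integral>z. ln (cmod (\<psi> z)) * lap z \<partial>lborel)
    = 2 * pi * (\<Sum>a\<in>{z \<in> cball 0 \<rho>. \<psi> z = 0}. real (nat (zorder \<psi> a)) * h a)"
proof -
  define A where "A = {z \<in> cball 0 \<rho>. \<psi> z = 0}"
  define m where "m a = real (nat (zorder \<psi> a))" for a
  have finA: "finite A" unfolding A_def by (rule entire_finite_zeros[OF \<psi>])
  obtain G where G: "G holomorphic_on ball 0 \<rho>"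
    "\<And>z. z \<in> ball 0 \<rho> - A \<Longrightarrow> ln (cmod (\<psi> z)) = (\<Sum>a\<in>A. m a * ln (cmod (z - a))) + Re (G z)"
    unfolding m_def A_def by (rule log_norm_decomposition[OF \<psi>]) blast
  define \<epsilon> :: "nat \<Rightarrow> real" where "\<epsilon> n = inverse (real (Suc n))" for n
  have \<epsilon>: "0 < \<epsilon> n" "\<epsilon> n \<le> 1" for n by (simp_all add: \<epsilon>_def inverse_le_1_iff)
  have \<epsilon>0: "\<epsilon> \<longlonglongrightarrow> 0" unfolding \<epsilon>_def by (rule LIMSEQ_inverse_real_of_nat)
  define U where "U n z = (\<Sum>a\<in>A. m a * reg_log (\<epsilon> n) a z) + Re (G z)" for n z
  note gl = green_reg_log[OF \<epsilon>(1)] and gh = green_harmonic[OF open_ball C\<rho> G(1)]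
  have Ulap: "U n z * lap z = (\<Sum>a\<in>A. m a * (reg_log (\<epsilon> n) a z * lap z)) + Re (G z) * lap z" for n z
    by (simp add: U_def distrib_right sum_distrib_right mult.assoc)
  have intU: "integrable lborel (\<lambda>z. U n z * lap z)" for n
    unfolding Ulap by (intro Bochner_Integration.integrable_add Bochner_Integration.integrable_sum integrable_mult_right gl gh)
  have "(\<integral>z. U n z * lap z \<partial>lborel) = (\<Sum>a\<in>A. m a * (\<integral>z. reg_log (\<epsilon> n) a z * lap z \<partial>lborel))" for n
    unfolding Ulap using gh gl by (subst Bochner_Integration.integral_add) (auto simp: integral_mult_right_zero)
  then have IU: "(\<integral>z. U n z * lap z \<partial>lborel)
      = (\<Sum>a\<in>A. m a * (\<integral>z. 2 * (\<epsilon> n)\<^sup>2 / ((cmod (z - a))\<^sup>2 + (\<epsilon> n)\<^sup>2)\<^sup>2 * h z \<partial>lborel))" for n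
    by (simp add: gl(2))
  obtain Bh where Bh: "Bh \<ge> 0" "\<And>z. \<bar>h z\<bar> \<le> Bh" using bounded_h by blast
  have lim1: "(\<lambda>n. \<integral>z. U n z * lap z \<partial>lborel) \<longlonglongrightarrow> (\<Sum>a\<in>A. m a * (2 * pi * h a))"
    unfolding IU by (intro tendsto_sum tendsto_mult tendsto_const approximate_identity[OF cont(1) Bh(2) \<epsilon>(1) \<epsilon>0])
  have contG: "continuous_on C (\<lambda>z. Re (G z))"
    using G(1) C\<rho> by (intro continuous_intros holomorphic_on_imp_continuous_on) (rule holomorphic_on_subset)
  obtain BG where BG: "\<And>z. z \<in> C \<Longrightarrow> \<bar>Re (G z)\<bar> \<le> BG"
    using compact_imp_bounded[OF compact_continuous_image[OF contG C]] by (auto simp: bounded_iff)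
  obtain BL where BL: "BL \<ge> 0" "\<And>z. \<bar>lap z\<bar> \<le> BL" using bounded_lap by blast
  \<comment> \<open>Points of the disc are at most 2 \<rho> apart, which bounds the regularised
    logarithms from above uniformly in \<open>n\<close>. No such bound holds from below near a zero;
    there ln |\<psi>| itself is the lower bound.\<close>
  define B where "B = \<bar>(\<Sum>a\<in>A. m a * (ln ((2 * \<rho>)\<^sup>2 + 1) / 2)) + BG\<bar>"
  have AEA: "AE z in lborel. z \<notin> A"
    using finA by (intro AE_not_in finite_imp_null_set_lborel)
  have lim2: "(\<lambda>n. \<integral>z. U n z * lap z \<partial>lborel) \<longlonglongrightarrow> (\<integral>z. ln (cmod (\<psi> z)) * lap z \<partial>lborel)"
  proof (rule integral_dominated_convergence)
    show "integrable lborel (\<lambda>z. BL * (\<bar>indicator C z * ln (cmod (\<psi> z))\<bar> + B * indicator C z))"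
      using C by (intro integrable_mult_right Bochner_Integration.integrable_add integrable_abs int
          integrable_real_indicator emeasure_compact_finite) (auto intro: borel_compact)
    have [measurable]: "\<psi> \<in> borel_measurable borel" "lap \<in> borel_measurable borel"
      using \<psi>(1) continuous_lap by (auto intro!: borel_measurable_continuous_onI holomorphic_on_imp_continuous_on)
    show "(\<lambda>z. ln (cmod (\<psi> z)) * lap z) \<in> borel_measurable lborel" by measurable
    show "(\<lambda>z. U n z * lap z) \<in> borel_measurable lborel" for n using intU by (rule borel_measurable_integrable)
    show "AE z in lborel. (\<lambda>n. U n z * lap z) \<longlonglongrightarrow> ln (cmod (\<psi> z)) * lap z"
      using AEA
    proof eventually_elim
      case (elim z)
      show ?case
      proof (cases "z \<in> C")
        case True
        then have "ln (cmod (\<psi> z)) = (\<Sum>a\<in>A. m a * ln (cmod (z - a))) + Re (G z)" using G(2) elim C\<rho> by blast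
        moreover have "(\<lambda>n. U n z) \<longlonglongrightarrow> (\<Sum>a\<in>A. m a * ln (cmod (z - a))) + Re (G z)"
          unfolding U_def using elim
          by (intro tendsto_add tendsto_sum tendsto_mult tendsto_const reg_log_tendsto \<epsilon>0) auto
        ultimately show ?thesis by (intro tendsto_mult tendsto_const) simp
      qed (simp add: lap_supp)
    qed
    show "AE z in lborel. norm (U n z * lap z) \<le> BL * (\<bar>indicator C z * ln (cmod (\<psi> z))\<bar> + B * indicator C z)" for n
      using AEA
    proof eventually_elim
      case (elim z)
      show ?case
      proof (cases "z \<in> C")
        case True
        have za: "z \<noteq> a" "cmod (z - a) \<le> 2 * \<rho>" if "a \<in> A" for a
        proof -
          have "cmod z \<le> \<rho>" "cmod a \<le> \<rho>" using True C\<rho> that by (auto simp: A_def)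
          then show "cmod (z - a) \<le> 2 * \<rho>" using norm_triangle_ineq4[of z a] by linarith
          show "z \<noteq> a" using that elim by auto
        qed
        have eq: "ln (cmod (\<psi> z)) = (\<Sum>a\<in>A. m a * ln (cmod (z - a))) + Re (G z)" using G(2) elim C\<rho> True by blast
        have m0: "m a \<ge> 0" for a by (simp add: m_def)
        have lo: "ln (cmod (\<psi> z)) \<le> U n z"
          unfolding eq U_def using za m0 \<epsilon>
          by (intro add_right_mono sum_mono mult_left_mono reg_log_bounds(1)[where M = "2 * \<rho>"]) auto
        have "(\<Sum>a\<in>A. m a * reg_log (\<epsilon> n) a z) \<le> (\<Sum>a\<in>A. m a * (ln ((2 * \<rho>)\<^sup>2 + 1) / 2))"
          using za m0 \<epsilon> by (intro sum_mono mult_left_mono reg_log_bounds(2)) auto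
        then have "U n z \<le> B" using BG[OF True] unfolding U_def B_def by linarith
        then have "\<bar>U n z\<bar> \<le> \<bar>ln (cmod (\<psi> z))\<bar> + B" using lo B_def by linarith
        then show ?thesis using BL True mult_mono[of "\<bar>lap z\<bar>" BL "\<bar>U n z\<bar>" "\<bar>ln (cmod (\<psi> z))\<bar> + B"]
          by (simp add: abs_mult mult.commute)
      qed (simp add: lap_supp)
    qed
  qed
  have "(\<integral>z. ln (cmod (\<psi> z)) * lap z \<partial>lborel) = (\<Sum>a\<in>A. m a * (2 * pi * h a))"
    using LIMSEQ_unique[OF lim2 lim1] .
  also have "\<dots> = 2 * pi * (\<Sum>a\<in>A. m a * h a)" by (simp add: sum_distrib_left mult_ac)
  finally show ?thesis by (simp add: A_def m_def)
qed

text \<open>Half of the mass 2 pi of a logarithm and a quarter of the Laplacian 4 of |z|^2 give the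
  coefficients \<open>pi\<close> and 1. The freedom in \<open>Z\<close> removes the auxiliary radius
  \<rho> from the result.\<close>

lemma (in C2_compact) green_phi:
  assumes \<psi>: "\<psi> holomorphic_on UNIV" "\<psi> w0 \<noteq> 0"
    and int: "integrable lborel (\<lambda>z. indicator C z * phi_of \<psi> z)"
    and Z: "finite Z" "\<And>z. \<psi> z = 0 \<Longrightarrow> h z \<noteq> 0 \<Longrightarrow> z \<in> Z" "\<And>z. z \<in> Z \<Longrightarrow> \<psi> z = 0"
  shows "integrable lborel (\<lambda>z. phi_of \<psi> z * lap z)"
    "(\<integral>z. phi_of \<psi> z * lap z \<partial>lborel) = pi * (\<Sum>a\<in>Z. real (nat (zorder \<psi> a)) * h a) - (\<integral>z. h z \<partial>lborel)"
proof -
  obtain \<rho> where C\<rho>: "C \<subseteq> ball 0 \<rho>"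
    using bounded_subset_ballD[OF compact_imp_bounded[OF C]] by blast
  have "integrable lborel (\<lambda>z. indicator C z *\<^sub>R (cmod z)\<^sup>2)"
    by (rule borel_integrable_compact[OF C]) (intro continuous_intros)
  then have i2: "integrable lborel (\<lambda>z. indicator C z * (cmod z)\<^sup>2)" by simp
  \<comment> \<open>Solving the definition of \<open>phi_of\<close> for the logarithm converts the
    hypothesis \<open>int\<close> into local integrability of ln |\<psi>|.\<close>
  have "integrable lborel (\<lambda>z. 2 * (indicator C z * phi_of \<psi> z) + (1/2) * (indicator C z * (cmod z)\<^sup>2))"
    by (intro Bochner_Integration.integrable_add integrable_mult_right int i2)
  also have "(\<lambda>z. 2 * (indicator C z * phi_of \<psi> z) + (1/2) * (indicator C z * (cmod z)\<^sup>2))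
      = (\<lambda>z. indicator C z * ln (cmod (\<psi> z)))"
    by (intro ext) (simp add: phi_of_def indicator_def)
  finally have il: "integrable lborel (\<lambda>z. indicator C z * ln (cmod (\<psi> z)))" .
  obtain BL where BL: "BL \<ge> 0" "\<And>z. \<bar>lap z\<bar> \<le> BL" using bounded_lap by blast
  have [measurable]: "\<psi> \<in> borel_measurable borel" "lap \<in> borel_measurable borel"
    using \<psi>(1) continuous_lap by (auto intro!: borel_measurable_continuous_onI holomorphic_on_imp_continuous_on)
  have ill: "integrable lborel (\<lambda>z. ln (cmod (\<psi> z)) * lap z)"
  proof (rule Bochner_Integration.integrable_bound)
    show "integrable lborel (\<lambda>z. BL * \<bar>indicator C z * ln (cmod (\<psi> z))\<bar>)"
      by (intro integrable_mult_right integrable_abs il)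
    show "AE z in lborel. norm (ln (cmod (\<psi> z)) * lap z) \<le> norm (BL * \<bar>indicator C z * ln (cmod (\<psi> z))\<bar>)"
    proof (intro AE_I2)
      fix z
      show "norm (ln (cmod (\<psi> z)) * lap z) \<le> norm (BL * \<bar>indicator C z * ln (cmod (\<psi> z))\<bar>)"
      proof (cases "z \<in> C")
        case True
        then show ?thesis using BL(1) mult_right_mono[OF BL(2)[of z], of "\<bar>ln (cmod (\<psi> z))\<bar>"]
          by (simp add: abs_mult mult.commute)
      qed (simp add: lap_supp)
    qed
  qed measurable
  have eq: "phi_of \<psi> z * lap z = (1/2) * (ln (cmod (\<psi> z)) * lap z) - (1/4) * ((cmod z)\<^sup>2 * lap z)" for z
    by (simp add: phi_of_def algebra_simps)
  show "integrable lborel (\<lambda>z. phi_of \<psi> z * lap z)"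
    unfolding eq by (intro Bochner_Integration.integrable_diff integrable_mult_right ill green_norm_sq)
  define A where "A = {z \<in> cball 0 \<rho>. \<psi> z = 0}"
  have finA: "finite A" unfolding A_def by (rule entire_finite_zeros[OF \<psi>])
  have "(\<integral>z. phi_of \<psi> z * lap z \<partial>lborel)
      = (1/2) * (\<integral>z. ln (cmod (\<psi> z)) * lap z \<partial>lborel) - (1/4) * (\<integral>z. (cmod z)\<^sup>2 * lap z \<partial>lborel)"
    unfolding eq
    by (subst Bochner_Integration.integral_diff[OF integrable_mult_right[OF ill] integrable_mult_right[OF green_norm_sq(1)]])
      (simp only: integral_mult_right_zero)
  also have "\<dots> = pi * (\<Sum>a\<in>A. real (nat (zorder \<psi> a)) * h a) - (\<integral>z. h z \<partial>lborel)"
    by (simp add: green_log_entire[OF \<psi> C\<rho> il] green_norm_sq(2) A_def)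
  also have "(\<Sum>a\<in>A. real (nat (zorder \<psi> a)) * h a) = (\<Sum>a\<in>Z. real (nat (zorder \<psi> a)) * h a)"
  proof (rule sum.mono_neutral_cong[OF Z(1) finA])
    show "real (nat (zorder \<psi> a)) * h a = 0" if "a \<in> Z - A" for a
    proof -
      have "a \<notin> C" using that C\<rho> Z(3) by (auto simp: A_def)
      then show ?thesis by (simp add: supp)
    qed
    show "real (nat (zorder \<psi> a)) * h a = 0" if "a \<in> A - Z" for a
      using that Z(2)[of a] by (auto simp: A_def)
  qed simp
  finally show "(\<integral>z. phi_of \<psi> z * lap z \<partial>lborel) = pi * (\<Sum>a\<in>Z. real (nat (zorder \<psi> a)) * h a) - (\<integral>z. h z \<partial>lborel)" .
qed

section \<open>Counting lattice points\<close>

lemma sqrt_pi_bounds: "1.7 \<le> sqrt pi" "sqrt pi \<le> 1.8"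
proof -
  have "1.7\<^sup>2 \<le> pi" "pi \<le> 1.8\<^sup>2" using pi_approx by (simp_all add: power2_eq_square)
  then have "sqrt (1.7\<^sup>2) \<le> sqrt pi" "sqrt pi \<le> sqrt (1.8\<^sup>2)" by (simp_all only: real_sqrt_le_iff)
  then show "1.7 \<le> sqrt pi" "sqrt pi \<le> 1.8" by simp_all
qed

lemma lattice_pt_simps [simp]: "Re (lattice_pt p) = sqrt pi * of_int (fst p)" "Im (lattice_pt p) = sqrt pi * of_int (snd p)"
  by (simp_all add: lattice_pt_def)

text \<open>Rounding to the nearest lattice point. The half-open squares with constant index tile
  the plane, and each has area \<open>pi\<close>, the weight of a simple zero in Green's
  identity.\<close>

definition cell_index :: "complex \<Rightarrow> int \<times> int" where
  "cell_index z = (\<lfloor>Re z / sqrt pi + 1/2\<rfloor>, \<lfloor>Im z / sqrt pi + 1/2\<rfloor>)"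

lemma cell_index_dist: "cmod (z - lattice_pt (cell_index z)) \<le> 2"
proof -
  have *: "\<bar>x - sqrt pi * of_int \<lfloor>x / sqrt pi + 1/2\<rfloor>\<bar> \<le> 1" for x
  proof -
    define y where "y = x / sqrt pi"
    have "\<bar>y - of_int \<lfloor>y + 1/2\<rfloor>\<bar> \<le> 1/2" by linarith
    then have "sqrt pi * \<bar>y - of_int \<lfloor>y + 1/2\<rfloor>\<bar> \<le> 1.8 * (1/2)"
      using sqrt_pi_bounds by (intro mult_mono) auto
    moreover have "x - sqrt pi * of_int \<lfloor>x / sqrt pi + 1/2\<rfloor> = sqrt pi * (y - of_int \<lfloor>y + 1/2\<rfloor>)"
      by (simp add: y_def algebra_simps)
    ultimately show ?thesis using sqrt_pi_bounds by (simp add: abs_mult)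
  qed
  have "cmod (z - lattice_pt (cell_index z)) \<le> \<bar>Re (z - lattice_pt (cell_index z))\<bar> + \<bar>Im (z - lattice_pt (cell_index z))\<bar>"
    by (rule cmod_le)
  also have "\<dots> \<le> 1 + 1" using * by (intro add_mono) (auto simp: cell_index_def)
  finally show ?thesis by simp
qed

lemma measurable_cell [measurable]: "{z. cell_index z = q} \<in> sets borel"
proof -
  have "{z. cell_index z = q} = {z \<in> space borel. \<lfloor>Re z / sqrt pi + 1/2\<rfloor> = fst q \<and> \<lfloor>Im z / sqrt pi + 1/2\<rfloor> = snd q}"
    by (auto simp: cell_index_def)
  also have "\<dots> \<in> sets borel" by measurable
  finally show ?thesis .
qed

lemma emeasure_cell: "emeasure lborel {z. cell_index z = q} = ennreal pi"
proof -
  define a where "a = lattice_pt q - complex_of_real (sqrt pi / 2) * (1 + \<i>)"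
  define b where "b = lattice_pt q + complex_of_real (sqrt pi / 2) * (1 + \<i>)"
  have ab: "Re a = sqrt pi * of_int (fst q) - sqrt pi / 2" "Im a = sqrt pi * of_int (snd q) - sqrt pi / 2"
    "Re b = sqrt pi * of_int (fst q) + sqrt pi / 2" "Im b = sqrt pi * of_int (snd q) + sqrt pi / 2"
    by (simp_all add: a_def b_def)
  have fl: "\<lfloor>x / sqrt pi + 1/2\<rfloor> = k \<longleftrightarrow> sqrt pi * of_int k - sqrt pi / 2 \<le> x \<and> x < sqrt pi * of_int k + sqrt pi / 2" for x k
  proof -
    have "\<lfloor>x / sqrt pi + 1/2\<rfloor> = k \<longleftrightarrow> of_int k \<le> x / sqrt pi + 1/2 \<and> x / sqrt pi + 1/2 < of_int k + 1"
      by (rule floor_eq_iff)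
    also have "\<dots> \<longleftrightarrow> of_int k - 1/2 \<le> x / sqrt pi \<and> x / sqrt pi < of_int k + 1/2" by auto
    also have "\<dots> \<longleftrightarrow> (of_int k - 1/2) * sqrt pi \<le> x \<and> x < (of_int k + 1/2) * sqrt pi"
      using pi_gt_zero by (simp add: pos_le_divide_eq pos_divide_less_eq)
    finally show ?thesis by (simp add: algebra_simps)
  qed
  have le: "a \<bullet> e \<le> b \<bullet> e" if "e \<in> Basis" for e
    using that pi_gt_zero by (auto simp: Basis_complex_def ab inner_complex_def)
  have vol: "(\<Prod>e\<in>Basis. (b - a) \<bullet> e) = pi"
    by (simp add: Basis_complex_def inner_complex_def ab)
  \<comment> \<open>The half-open square is squeezed between an open and a closed box of equal
    measure.\<close>
  have 1: "box a b \<subseteq> {z. cell_index z = q}" "{z. cell_index z = q} \<subseteq> cbox a b"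
    by (auto simp: in_box_complex_iff in_cbox_complex_iff ab cell_index_def fl prod_eq_iff)
  have "emeasure lborel (box a b) \<le> emeasure lborel {z. cell_index z = q}"
    using 1 measurable_cell by (intro emeasure_mono) auto
  moreover have "emeasure lborel {z. cell_index z = q} \<le> emeasure lborel (cbox a b)"
    using 1 by (intro emeasure_mono) auto
  ultimately show ?thesis
    using emeasure_lborel_box[OF le] emeasure_lborel_cbox[OF le] vol by simp
qed

text \<open>The disc lies in a square of half-side \<rho>. Each coordinate takes at most 2 \<rho> /
  1.7 + 1 values, which is below 1.5 \<rho> because \<rho> \<ge> 10 pays for the 1; then 2.25 is 1.5
  squared.\<close>

lemma lattice_count_upper:
  assumes "\<rho> \<ge> 10"
  shows "finite {p. cmod (z - lattice_pt p) \<le> \<rho>}" "real (card {p. cmod (z - lattice_pt p) \<le> \<rho>}) \<le> 2.25 * \<rho>\<^sup>2"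
proof -
  define J where "J x = {\<lceil>(x - \<rho>) / sqrt pi\<rceil>..\<lfloor>(x + \<rho>) / sqrt pi\<rfloor>}" for x
  have mem: "k \<in> J x" if "\<bar>x - sqrt pi * of_int k\<bar> \<le> \<rho>" for k x
  proof -
    have "(x - \<rho>) / sqrt pi \<le> of_int k" "of_int k \<le> (x + \<rho>) / sqrt pi"
      using that pi_gt_zero by (auto simp: pos_divide_le_eq pos_le_divide_eq abs_le_iff algebra_simps)
    then show ?thesis by (simp add: J_def ceiling_le_iff le_floor_iff)
  qed
  have cardJ: "real (card (J x)) \<le> 1.5 * \<rho>" for x
  proof -
    have "(x + \<rho>) / sqrt pi - (x - \<rho>) / sqrt pi = 2 * \<rho> / sqrt pi" by (simp add: field_simps)
    also have "\<dots> \<le> 2 * \<rho> / 1.7" using sqrt_pi_bounds assms by (intro divide_left_mono) auto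
    also have "\<dots> \<le> 1.2 * \<rho>" using assms by simp
    finally have *: "(x + \<rho>) / sqrt pi - (x - \<rho>) / sqrt pi \<le> 1.2 * \<rho>" .
    have "real_of_int (\<lfloor>(x + \<rho>) / sqrt pi\<rfloor> - \<lceil>(x - \<rho>) / sqrt pi\<rceil> + 1) \<le> 1.2 * \<rho> + 1"
      using * by linarith
    moreover have "real (nat i) \<le> c" if "real_of_int i \<le> c" "0 \<le> c" for i c
      using that by (cases "0 \<le> i") auto
    ultimately have "real (card (J x)) \<le> 1.2 * \<rho> + 1"
      unfolding J_def using assms by (simp add: algebra_simps)
    then show ?thesis using assms by linarith
  qed
  have sub: "{p. cmod (z - lattice_pt p) \<le> \<rho>} \<subseteq> J (Re z) \<times> J (Im z)"
  proof (rule subsetI)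
    fix p assume "p \<in> {p. cmod (z - lattice_pt p) \<le> \<rho>}"
    then have "\<bar>Re z - sqrt pi * of_int (fst p)\<bar> \<le> \<rho>" "\<bar>Im z - sqrt pi * of_int (snd p)\<bar> \<le> \<rho>"
      using abs_Re_le_cmod[of "z - lattice_pt p"] abs_Im_le_cmod[of "z - lattice_pt p"] by simp_all
    then show "p \<in> J (Re z) \<times> J (Im z)" using mem by (cases p) simp
  qed
  have fin: "finite (J x)" for x by (simp add: J_def)
  show "finite {p. cmod (z - lattice_pt p) \<le> \<rho>}" using finite_subset[OF sub] fin by blast
  have "real (card {p. cmod (z - lattice_pt p) \<le> \<rho>}) \<le> real (card (J (Re z) \<times> J (Im z)))"
    by (subst of_nat_le_iff, rule card_mono[OF _ sub]) (use fin in simp)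
  also have "\<dots> = real (card (J (Re z))) * real (card (J (Im z)))" by (simp add: card_cartesian_product)
  also have "\<dots> \<le> (1.5 * \<rho>) * (1.5 * \<rho>)" using cardJ assms by (intro mult_mono) auto
  finally show "real (card {p. cmod (z - lattice_pt p) \<le> \<rho>}) \<le> 2.25 * \<rho>\<^sup>2" by (simp add: power2_eq_square)
qed

text \<open>A square of half-side 0.7 \<rho> fits into the disc since 2 * 0.7^2 < 1, and \<rho>
  \<ge> 10 again pays for the rounding.\<close>

lemma lattice_count_lower:
  assumes "\<rho> \<ge> 10"
  shows "\<rho>\<^sup>2 / 4 \<le> real (card {p. cmod (z - lattice_pt p) \<le> \<rho>})"
proof -
  define J where "J x = {\<lceil>(x - 0.7 * \<rho>) / sqrt pi\<rceil>..\<lfloor>(x + 0.7 * \<rho>) / sqrt pi\<rfloor>}" for x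
  have mem: "\<bar>x - sqrt pi * of_int k\<bar> \<le> 0.7 * \<rho>" if "k \<in> J x" for k x
  proof -
    have "(x - 0.7 * \<rho>) / sqrt pi \<le> of_int k" "of_int k \<le> (x + 0.7 * \<rho>) / sqrt pi"
      using that by (simp_all add: J_def ceiling_le_iff le_floor_iff)
    then have "x - 0.7 * \<rho> \<le> of_int k * sqrt pi" "of_int k * sqrt pi \<le> x + 0.7 * \<rho>"
      using pi_gt_zero by (simp_all add: pos_divide_le_eq pos_le_divide_eq)
    then show ?thesis unfolding abs_le_iff by (simp only: mult.commute[of "sqrt pi"]) linarith
  qed
  have cardJ: "\<rho> / 2 \<le> real (card (J x))" for x
  proof -
    have "1.5 * \<rho> / 2 \<le> 1.4 * \<rho> / 1.8" using assms by simp
    also have "\<dots> \<le> 1.4 * \<rho> / sqrt pi" using sqrt_pi_bounds assms by (intro divide_left_mono) auto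
    also have "\<dots> = (x + 0.7 * \<rho>) / sqrt pi - (x - 0.7 * \<rho>) / sqrt pi" by (simp add: field_simps)
    finally have *: "1.5 * \<rho> / 2 \<le> (x + 0.7 * \<rho>) / sqrt pi - (x - 0.7 * \<rho>) / sqrt pi" .
    have "1.5 * \<rho> / 2 - 1 \<le> real_of_int (\<lfloor>(x + 0.7 * \<rho>) / sqrt pi\<rfloor> - \<lceil>(x - 0.7 * \<rho>) / sqrt pi\<rceil> + 1)"
      using * by linarith
    also have "\<dots> \<le> real (card (J x))" by (simp add: J_def)
    finally show ?thesis using assms by linarith
  qed
  have "cmod (z - lattice_pt p) \<le> \<rho>" if "fst p \<in> J (Re z)" "snd p \<in> J (Im z)" for p
  proof -
    have "\<bar>Re (z - lattice_pt p)\<bar>\<^sup>2 \<le> (0.7 * \<rho>)\<^sup>2" "\<bar>Im (z - lattice_pt p)\<bar>\<^sup>2 \<le> (0.7 * \<rho>)\<^sup>2"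
      using power_mono[OF mem[OF that(1)] abs_ge_zero, of 2] power_mono[OF mem[OF that(2)] abs_ge_zero, of 2]
      by (simp_all only: minus_complex.simps lattice_pt_simps)
    then have "(cmod (z - lattice_pt p))\<^sup>2 \<le> 2 * (0.7 * \<rho>)\<^sup>2" by (simp add: cmod_power2)
    also have "\<dots> \<le> \<rho>\<^sup>2" by (simp add: power2_eq_square)
    finally show ?thesis using assms by (simp add: power2_le_iff_abs_le)
  qed
  then have sub: "J (Re z) \<times> J (Im z) \<subseteq> {p. cmod (z - lattice_pt p) \<le> \<rho>}" by auto
  have "\<rho>\<^sup>2 / 4 = (\<rho> / 2) * (\<rho> / 2)" by (simp add: power2_eq_square)
  also have "\<dots> \<le> real (card (J (Re z))) * real (card (J (Im z)))"
    using cardJ assms by (intro mult_mono) auto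
  also have "\<dots> = real (card (J (Re z) \<times> J (Im z)))" by (simp add: card_cartesian_product)
  also have "\<dots> \<le> real (card {p. cmod (z - lattice_pt p) \<le> \<rho>})"
    using card_mono[OF lattice_count_upper(1)[OF assms] sub] by simp
  finally show ?thesis .
qed

section \<open>Derivatives of truncated powers, the profile of the bumps\<close>

lemma DERIV_max_0_power:
  assumes "n \<noteq> 0"
  shows "((\<lambda>x::real. max 0 x ^ Suc n) has_real_derivative real (Suc n) * max 0 x ^ n) (at x)"
proof -
  consider "x > 0" | "x < 0" | "x = 0" by linarith
  then show ?thesis
  proof cases
    case 1
    have "((\<lambda>x::real. x ^ Suc n) has_real_derivative real (Suc n) * x ^ n) (at x)"
      using DERIV_pow[of "Suc n" x] by simp
    then have "((\<lambda>x::real. max 0 x ^ Suc n) has_real_derivative real (Suc n) * x ^ n) (at x)"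
      by (rule has_field_derivative_transform_within_open[of _ _ _ "{0<..}"]) (use 1 in auto)
    then show ?thesis using 1 by (simp add: max_def)
  next
    case 2
    have "((\<lambda>x::real. 0) has_real_derivative 0) (at x)" by simp
    then have "((\<lambda>x::real. max 0 x ^ Suc n) has_real_derivative 0) (at x)"
      by (rule has_field_derivative_transform_within_open[of _ _ _ "{..<0}"]) (use 2 in auto)
    moreover have "real (Suc n) * max 0 x ^ n = 0" using 2 assms by simp
    ultimately show ?thesis by (simp only:)
  next
    case 3
    have "((\<lambda>h::real. \<bar>h\<bar> ^ n) \<longlongrightarrow> \<bar>0\<bar> ^ n) (at 0)" by (intro tendsto_intros)
    moreover have "\<bar>0::real\<bar> ^ n = 0" using assms by simp
    ultimately have z: "((\<lambda>h::real. \<bar>h\<bar> ^ n) \<longlongrightarrow> 0) (at 0)" by (simp only:)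
    have "((\<lambda>h::real. max 0 h ^ Suc n / h) \<longlongrightarrow> 0) (at 0)"
    proof (rule Lim_null_comparison[OF _ z])
      show "\<forall>\<^sub>F h::real in at 0. norm (max 0 h ^ Suc n / h) \<le> \<bar>h\<bar> ^ n"
        by (rule always_eventually) (auto simp: max_def abs_mult power_abs)
    qed
    moreover have "real (Suc n) * max 0 x ^ n = 0" using 3 assms by simp
    ultimately have "((\<lambda>y. (max 0 y ^ Suc n - max 0 x ^ Suc n) / (y - x)) \<longlongrightarrow> real (Suc n) * max 0 x ^ n) (at x)"
      using 3 by (simp only:) simp
    then show ?thesis by (simp only: has_field_derivative_iff)
  qed
qed

section \<open>A partition of unity at a variable scale\<close>

lemma dot_le: "\<bar>dot z v\<bar> \<le> cmod z * cmod v"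
  using Cauchy_Schwarz_ineq2[of z v] by (simp add: dot_def inner_complex_def)

text \<open>The bound 200 makes discs of radius R/20 large enough for the lattice counts, which
  require radius at least 10. It also makes the distance 2 between a point and its cell centre
  negligible.\<close>

locale lipschitz_scale =
  fixes R :: "complex \<Rightarrow> real"
  assumes lip: "\<bar>R z - R w\<bar> \<le> cmod (z - w)"
    and big: "R z \<ge> 200"
begin

definition rad where "rad p = R (lattice_pt p) / 10"

definition active where "active z = {p. cmod (z - lattice_pt p) < rad p}"

definition depth where "depth p z = 1 - (cmod (z - lattice_pt p))\<^sup>2 / (rad p)\<^sup>2"

text \<open>Three is the least integer power for which the positive part is twice continuously
  differentiable.\<close>

definition bump where "bump p z = max 0 (depth p z) ^ 3"

definition bump1 where "bump1 p v z = 3 * max 0 (depth p z) ^ 2 * (- 2 * dot (z - lattice_pt p) v / (rad p)\<^sup>2)"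

definition bump2 where "bump2 p v z = 6 * max 0 (depth p z) * (- 2 * dot (z - lattice_pt p) v / (rad p)\<^sup>2)\<^sup>2
  + 3 * max 0 (depth p z) ^ 2 * (- 2 * (cmod v)\<^sup>2 / (rad p)\<^sup>2)"

lemma rad_ge: "rad p \<ge> 20" using big[of "lattice_pt p"] by (simp add: rad_def)

lemma depth_pos_iff: "depth p z > 0 \<longleftrightarrow> p \<in> active z"
proof -
  have "depth p z > 0 \<longleftrightarrow> (cmod (z - lattice_pt p))\<^sup>2 < (rad p)\<^sup>2"
    using rad_ge[of p] by (simp add: depth_def)
  also have "\<dots> \<longleftrightarrow> cmod (z - lattice_pt p) < rad p"
    using rad_ge[of p] by (auto intro: power2_less_imp_less power_strict_mono)
  finally show ?thesis by (simp add: active_def)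
qed

lemma depth_le_1: "depth p z \<le> 1" by (simp add: depth_def)

lemma bump_inactive:
  assumes "p \<notin> active z"
  shows "bump p z = 0" "bump1 p v z = 0" "bump2 p v z = 0"
proof -
  have "max 0 (depth p z) = 0" using assms depth_pos_iff[of p z] by simp
  then show "bump p z = 0" "bump1 p v z = 0" "bump2 p v z = 0" by (simp_all add: bump_def bump1_def bump2_def)
qed

lemma bump_nonneg: "bump p z \<ge> 0" by (simp add: bump_def)

lemma bump_le_1: "bump p z \<le> 1"
  unfolding bump_def using depth_le_1[of p z] by (intro power_le_one) auto

lemma has_dir_deriv_bump: "has_dir_deriv (bump p) v (bump1 p v) z" "has_dir_deriv (bump1 p v) v (bump2 p v) z"
proof -
  define f where "f t = depth p (z + of_real t * v)" for t :: real
  define g where "g t = - 2 * dot (z + of_real t * v - lattice_pt p) v / (rad p)\<^sup>2" for t :: real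
  have "((\<lambda>t. 1 - (cmod (z + of_real t * v - lattice_pt p))\<^sup>2 / (rad p)\<^sup>2) has_real_derivative
      0 - 2 * dot (z - lattice_pt p) v / (rad p)\<^sup>2) (at 0)"
    by (intro DERIV_diff DERIV_const DERIV_cdivide has_dir_deriv_norm_sq[unfolded has_dir_deriv_def])
  then have f: "(f has_real_derivative g 0) (at 0)" by (simp add: f_def[abs_def] depth_def g_def)
  have "((\<lambda>t. - 2 * dot (z + of_real t * v - lattice_pt p) v / (rad p)\<^sup>2) has_real_derivative
      - 2 * (cmod v)\<^sup>2 / (rad p)\<^sup>2) (at 0)"
    by (intro DERIV_cdivide DERIV_cmult has_dir_deriv_dot[unfolded has_dir_deriv_def])
  then have g: "(g has_real_derivative - 2 * (cmod v)\<^sup>2 / (rad p)\<^sup>2) (at 0)" by (simp add: g_def[abs_def])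
  have m3: "((\<lambda>t. max 0 (f t) ^ 3) has_real_derivative 3 * max 0 (f 0) ^ 2 * g 0) (at 0)"
    using DERIV_chain2[OF DERIV_max_0_power[of 2 "f 0"] f] by (simp add: eval_nat_numeral)
  have m2: "((\<lambda>t. max 0 (f t) ^ 2) has_real_derivative 2 * max 0 (f 0) * g 0) (at 0)"
    using DERIV_chain2[OF DERIV_max_0_power[of 1 "f 0"] f] by (simp add: eval_nat_numeral)
  show "has_dir_deriv (bump p) v (bump1 p v) z"
    using m3 by (simp add: has_dir_deriv_def bump_def bump1_def f_def g_def)
  have "((\<lambda>t. 3 * max 0 (f t) ^ 2 * g t) has_real_derivative
      (3 * (2 * max 0 (f 0) * g 0)) * g 0 + (- 2 * (cmod v)\<^sup>2 / (rad p)\<^sup>2) * (3 * max 0 (f 0) ^ 2)) (at 0)"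
    by (intro DERIV_mult DERIV_cmult m2 g)
  then have "((\<lambda>t. 3 * max 0 (f t) ^ 2 * g t) has_real_derivative bump2 p v z) (at 0)"
    by (simp add: bump2_def f_def g_def power2_eq_square mult_ac)
  then show "has_dir_deriv (bump1 p v) v (bump2 p v) z"
    by (simp add: has_dir_deriv_def bump1_def f_def g_def)
qed

lemma continuous_bump: "continuous_on S (bump p)" "continuous_on S (bump1 p v)" "continuous_on S (bump2 p v)"
proof -
  have nz: "(rad p)\<^sup>2 \<noteq> 0" using rad_ge[of p] by simp
  have d: "continuous_on S (depth p)" unfolding depth_def using nz by (intro continuous_intros) auto
  show "continuous_on S (bump p)" "continuous_on S (bump1 p v)" "continuous_on S (bump2 p v)"
    unfolding bump_def bump1_def bump2_def by (intro continuous_intros continuous_on_dot d ballI nz)+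
qed

text \<open>An active centre is within a tenth of its own value of \<open>R\<close>, so by the
  Lipschitz bound \<open>R z\<close> lies between 9/10 and 11/10 of that value. From here on all
  estimates at \<open>z\<close> can use the single length \<open>R z / 10\<close>.\<close>

lemma rad_compare:
  assumes "p \<in> active z"
  shows "rad p \<le> 10/9 * (R z / 10)" "10/11 * (R z / 10) \<le> rad p"
proof -
  have "cmod (z - lattice_pt p) < R (lattice_pt p) / 10" using assms by (simp add: active_def rad_def)
  then show "rad p \<le> 10/9 * (R z / 10)" "10/11 * (R z / 10) \<le> rad p"
    using lip[of z "lattice_pt p"] unfolding rad_def abs_le_iff by argo+
qed

lemma active_subset: "active z \<subseteq> {p. cmod (z - lattice_pt p) \<le> 10/9 * (R z / 10)}"
proof (rule subsetI)
  fix p assume "p \<in> active z"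
  then show "p \<in> {p. cmod (z - lattice_pt p) \<le> 10/9 * (R z / 10)}"
    using rad_compare(1)[of p z] by (simp add: active_def)
qed

lemma finite_active: "finite (active z)"
proof (rule finite_subset[OF active_subset lattice_count_upper(1)])
  show "10/9 * (R z / 10) \<ge> 10" using big[of z] by simp
qed

lemma card_active: "real (card (active z)) \<le> 3 * (R z / 10)\<^sup>2"
proof -
  have ge: "10/9 * (R z / 10) \<ge> 10" using big[of z] by simp
  have "real (card (active z)) \<le> real (card {p. cmod (z - lattice_pt p) \<le> 10/9 * (R z / 10)})"
    by (subst of_nat_le_iff, rule card_mono[OF lattice_count_upper(1)[OF ge] active_subset])
  also have "\<dots> \<le> 2.25 * (10/9 * (R z / 10))\<^sup>2" by (rule lattice_count_upper(2)[OF ge])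
  also have "\<dots> \<le> 3 * (R z / 10)\<^sup>2" by (simp add: power2_eq_square)
  finally show ?thesis .
qed

text \<open>Near a fixed point all sums over \<open>active z\<close> are sums over one finite index set.\<close>

definition near where "near z0 = {p. cmod (z0 - lattice_pt p) < rad p + 1}"

lemma finite_near: "finite (near z0)"
proof -
  have "near z0 \<subseteq> {p. cmod (z0 - lattice_pt p) \<le> R z0}"
  proof (rule subsetI)
    fix p assume "p \<in> near z0"
    then have "cmod (z0 - lattice_pt p) < R (lattice_pt p) / 10 + 1" by (simp add: near_def rad_def)
    then have "cmod (z0 - lattice_pt p) \<le> R z0"
      using lip[of z0 "lattice_pt p"] big[of z0] unfolding abs_le_iff by argo
    then show "p \<in> {p. cmod (z0 - lattice_pt p) \<le> R z0}" by simp
  qed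
  moreover have "R z0 \<ge> 10" using big[of z0] by simp
  ultimately show ?thesis using lattice_count_upper(1) finite_subset by blast
qed

lemma sum_active_eq_near:
  assumes "z \<in> ball z0 1" "\<And>p. p \<notin> active z \<Longrightarrow> f p = 0"
  shows "(\<Sum>p\<in>near z0. f p) = (\<Sum>p\<in>active z. f p)"
proof (rule sum.mono_neutral_right[OF finite_near])
  show "active z \<subseteq> near z0"
  proof (rule subsetI)
    fix p assume p: "p \<in> active z"
    have "cmod (z0 - lattice_pt p) \<le> cmod (z0 - z) + cmod (z - lattice_pt p)"
      using norm_triangle_ineq[of "z0 - z" "z - lattice_pt p"] by simp
    then show "p \<in> near z0" using p assms(1) by (simp add: near_def active_def dist_norm)
  qed
qed (use assms(2) in auto)

lemma has_dir_deriv_sum_active: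
  assumes "\<And>p. has_dir_deriv (f p) v (f' p) z0"
    and "\<And>p z. p \<notin> active z \<Longrightarrow> f p z = 0" "\<And>p z. p \<notin> active z \<Longrightarrow> f' p z = 0"
  shows "has_dir_deriv (\<lambda>z. \<Sum>p\<in>active z. f p z) v (\<lambda>z. \<Sum>p\<in>active z. f' p z) z0"
proof (rule has_dir_deriv_transform[OF _ open_ball])
  show "has_dir_deriv (\<lambda>z. \<Sum>p\<in>near z0. f p z) v (\<lambda>z. \<Sum>p\<in>near z0. f' p z) z0"
    using assms(1) unfolding has_dir_deriv_def by (intro DERIV_sum) auto
  show "z0 \<in> ball z0 1" by simp
  show "(\<Sum>p\<in>near z0. f p w) = (\<Sum>p\<in>active w. f p w)" if "w \<in> ball z0 1" for w
    using that assms(2) by (rule sum_active_eq_near)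
  show "(\<Sum>p\<in>near z0. f' p z0) = (\<Sum>p\<in>active z0. f' p z0)"
    using \<open>z0 \<in> ball z0 1\<close> assms(3) by (rule sum_active_eq_near)
qed

lemma continuous_sum_active:
  assumes "\<And>p. continuous_on UNIV (f p)" "\<And>p z. p \<notin> active z \<Longrightarrow> f p z = (0::real)"
  shows "continuous_on UNIV (\<lambda>z. \<Sum>p\<in>active z. f p z)"
proof -
  have "isCont (\<lambda>z. \<Sum>p\<in>active z. f p z) z0" for z0
  proof -
    have "continuous_on (ball z0 1) (\<lambda>z. \<Sum>p\<in>near z0. f p z)"
      using assms(1) by (intro continuous_on_sum) (auto intro: continuous_on_subset)
    then have "continuous_on (ball z0 1) (\<lambda>z. \<Sum>p\<in>active z. f p z)"
      by (rule continuous_on_eq) (rule sum_active_eq_near[OF _ assms(2)])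
    then show ?thesis by (simp add: continuous_on_eq_continuous_at)
  qed
  then show ?thesis by (simp add: continuous_on_eq_continuous_at)
qed

definition total where "total z = (\<Sum>p\<in>active z. bump p z)"
definition total1 where "total1 v z = (\<Sum>p\<in>active z. bump1 p v z)"
definition total2 where "total2 v z = (\<Sum>p\<in>active z. bump2 p v z)"

lemma has_dir_deriv_total: "has_dir_deriv total v (total1 v) z" "has_dir_deriv (total1 v) v (total2 v) z"
proof -
  show "has_dir_deriv total v (total1 v) z" unfolding total_def[abs_def] total1_def[abs_def]
    by (rule has_dir_deriv_sum_active) (simp_all add: has_dir_deriv_bump bump_inactive)
  show "has_dir_deriv (total1 v) v (total2 v) z" unfolding total1_def[abs_def] total2_def[abs_def]
    by (rule has_dir_deriv_sum_active) (simp_all add: has_dir_deriv_bump bump_inactive)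
qed

lemma continuous_total: "continuous_on UNIV total" "continuous_on UNIV (total1 v)" "continuous_on UNIV (total2 v)"
proof -
  show "continuous_on UNIV total" unfolding total_def[abs_def]
    by (rule continuous_sum_active) (simp_all add: continuous_bump bump_inactive)
  show "continuous_on UNIV (total1 v)" unfolding total1_def[abs_def]
    by (rule continuous_sum_active) (simp_all add: continuous_bump bump_inactive)
  show "continuous_on UNIV (total2 v)" unfolding total2_def[abs_def]
    by (rule continuous_sum_active) (simp_all add: continuous_bump bump_inactive)
qed

lemma total_le: "total z \<le> 3 * (R z / 10)\<^sup>2"
proof -
  have "total z \<le> (\<Sum>p\<in>active z. 1)" unfolding total_def by (intro sum_mono bump_le_1)
  then show ?thesis using card_active[of z] by simp
qed

text \<open>Lattice points within s/2 of \<open>z\<close> suffice: there \<open>rad\<close> is at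
  least 0.95 s, hence \<open>depth\<close> at least 7/10 and \<open>bump\<close> at least 0.343.
  There are at least s^2 / 16 of them, and 16 * 3 = 48.\<close>

lemma total_ge: "(R z / 10)\<^sup>2 / 48 \<le> total z"
proof -
  define s where "s = R z / 10"
  define J where "J = {p. cmod (z - lattice_pt p) \<le> s / 2}"
  have s: "s \<ge> 20" using big[of z] by (simp add: s_def)
  have J: "p \<in> active z \<and> 1/3 \<le> bump p z" if "p \<in> J" for p
  proof -
    have d: "cmod (z - lattice_pt p) \<le> s / 2" using that by (simp add: J_def)
    have r: "19/20 * s \<le> rad p"
      using d lip[of z "lattice_pt p"] unfolding rad_def s_def abs_le_iff by argo
    have "(cmod (z - lattice_pt p))\<^sup>2 \<le> (s / 2)\<^sup>2" using d by (intro power_mono) auto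
    also have "\<dots> \<le> 3/10 * (19/20 * s)\<^sup>2" by (simp add: power2_eq_square)
    also have "\<dots> \<le> 3/10 * (rad p)\<^sup>2" using r s by (intro mult_left_mono power_mono) auto
    finally have "(cmod (z - lattice_pt p))\<^sup>2 / (rad p)\<^sup>2 \<le> 3/10"
      using rad_ge[of p] by (simp add: pos_divide_le_eq)
    then have dp: "7/10 \<le> depth p z" by (simp add: depth_def)
    then have "(7/10) ^ 3 \<le> bump p z" unfolding bump_def by (intro power_mono) auto
    moreover have "(1/3::real) \<le> (7/10) ^ 3" by (simp add: power3_eq_cube)
    ultimately show ?thesis using dp depth_pos_iff[of p z] by linarith
  qed
  have s10: "s / 2 \<ge> 10" using s by simp
  have "s\<^sup>2 / 48 = (s / 2)\<^sup>2 / 4 * (1/3)" by (simp add: power2_eq_square)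
  also have "\<dots> \<le> real (card J) * (1/3)"
    using lattice_count_lower[OF s10, of z] by (simp add: J_def)
  also have "\<dots> = (\<Sum>p\<in>J. 1/3)" by simp
  also have "\<dots> \<le> (\<Sum>p\<in>J. bump p z)" using J by (intro sum_mono) blast
  also have "\<dots> \<le> total z" unfolding total_def
    by (rule sum_mono2[OF finite_active]) (use J bump_nonneg in blast)+
  finally show ?thesis by (simp add: s_def)
qed

lemma total_pos: "total z > 0"
proof -
  have "0 < (R z / 10)\<^sup>2 / 48" using big[of z] by simp
  then show ?thesis using total_ge[of z] by linarith
qed

end

section \<open>Normalised bumps and the size of their Laplacians\<close>

context lipschitz_scale
begin

definition theta where "theta p z = bump p z / total z"

definition theta1 where
  "theta1 p v z = bump1 p v z / total z - bump p z * total1 v z / (total z)\<^sup>2"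

definition theta2 where
  "theta2 p v z = bump2 p v z / total z - 2 * bump1 p v z * total1 v z / (total z)\<^sup>2
     + bump p z * (2 * (total1 v z)\<^sup>2 / (total z) ^ 3 - total2 v z / (total z)\<^sup>2)"

definition lap_theta where "lap_theta p z = theta2 p 1 z + theta2 p \<i> z"

lemma theta_inactive:
  assumes "p \<notin> active z"
  shows "theta p z = 0" "theta1 p v z = 0" "theta2 p v z = 0" "lap_theta p z = 0"
  using bump_inactive[OF assms] by (simp_all add: theta_def theta1_def theta2_def lap_theta_def)

lemma theta_nonneg: "theta p z \<ge> 0"
  using bump_nonneg[of p z] total_pos[of z] by (simp add: theta_def)

lemma sum_theta: "(\<Sum>p\<in>active z. theta p z) = 1"
  using total_pos[of z] by (simp add: theta_def sum_divide_distrib[symmetric] total_def)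

text \<open>It is the second derivative of the constant 1, but the index set moves with
  \<open>z\<close>. The quotient-rule formula avoids this: summation turns the bump terms into
  \<open>total\<close>, \<open>total1\<close>, \<open>total2\<close>, and what results cancels
  algebraically.\<close>

lemma sum_theta2: "(\<Sum>p\<in>active z. theta2 p v z) = 0"
proof -
  have "(\<Sum>p\<in>active z. theta2 p v z) = total2 v z / total z - 2 * total1 v z * total1 v z / (total z)\<^sup>2
     + total z * (2 * (total1 v z)\<^sup>2 / (total z) ^ 3 - total2 v z / (total z)\<^sup>2)"
    unfolding theta2_def
    by (simp only: sum.distrib sum_subtractf sum_divide_distrib[symmetric] sum_distrib_right[symmetric]
        sum_distrib_left[symmetric] total_def[symmetric] total1_def[symmetric] total2_def[symmetric])
  also have "\<dots> = 0"
    using total_pos[of z] by (simp add: field_simps power2_eq_square power3_eq_cube)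
  finally show ?thesis .
qed

lemma sum_lap_theta: "(\<Sum>p\<in>active z. lap_theta p z) = 0"
  by (simp add: lap_theta_def sum.distrib sum_theta2)

lemma has_dir_deriv_theta: "has_dir_deriv (theta p) v (theta1 p v) z" "has_dir_deriv (theta1 p v) v (theta2 p v) z"
proof -
  define k where "k t = bump p (z + of_real t * v)" for t :: real
  define k1 where "k1 t = bump1 p v (z + of_real t * v)" for t :: real
  define T where "T t = total (z + of_real t * v)" for t :: real
  define T1 where "T1 t = total1 v (z + of_real t * v)" for t :: real
  have d: "(k has_real_derivative k1 0) (at 0)" "(k1 has_real_derivative bump2 p v z) (at 0)"
    "(T has_real_derivative T1 0) (at 0)" "(T1 has_real_derivative total2 v z) (at 0)"
    using has_dir_deriv_bump[of p v z] has_dir_deriv_total[of v z]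
    by (simp_all add: has_dir_deriv_def k_def[abs_def] k1_def[abs_def] T_def[abs_def] T1_def[abs_def])
  have T0: "T 0 \<noteq> 0" using total_pos[of z] by (simp add: T_def)
  have "((\<lambda>t. k t / T t) has_real_derivative k1 0 / T 0 - k 0 * T1 0 / (T 0)\<^sup>2) (at 0)"
    using d T0 by (auto intro!: derivative_eq_intros simp: field_simps power2_eq_square)
  then show "has_dir_deriv (theta p) v (theta1 p v) z"
    by (simp add: has_dir_deriv_def theta_def theta1_def k_def T_def k1_def T1_def)
  have "((\<lambda>t. k1 t / T t - k t * T1 t / (T t)\<^sup>2) has_real_derivative
      bump2 p v z / T 0 - 2 * k1 0 * T1 0 / (T 0)\<^sup>2
     + k 0 * (2 * (T1 0)\<^sup>2 / (T 0) ^ 3 - total2 v z / (T 0)\<^sup>2)) (at 0)"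
    using T0 by (auto intro!: derivative_eq_intros d simp: field_simps eval_nat_numeral)
  then show "has_dir_deriv (theta1 p v) v (theta2 p v) z"
    by (simp add: has_dir_deriv_def theta1_def theta2_def k_def T_def k1_def T1_def)
qed

lemma continuous_theta: "continuous_on UNIV (theta p)" "continuous_on UNIV (theta1 p v)" "continuous_on UNIV (theta2 p v)"
proof -
  have nz: "total z \<noteq> 0" "(total z)\<^sup>2 \<noteq> 0" "(total z) ^ 3 \<noteq> 0" for z using total_pos[of z] by auto
  show "continuous_on UNIV (theta p)" "continuous_on UNIV (theta1 p v)" "continuous_on UNIV (theta2 p v)"
    unfolding theta_def theta1_def theta2_def
    by (intro continuous_intros continuous_bump continuous_total ballI nz)+
qed

lemma C2_compact_theta: "C2_compact (cball (lattice_pt p) (rad p)) (theta p) (theta1 p) (theta2 p)"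
proof
  have "p \<notin> active z" if "z \<notin> cball (lattice_pt p) (rad p)" for z
    using that by (simp add: active_def dist_norm norm_minus_commute)
  then show "theta p z = 0" "theta1 p v z = 0" "theta2 p v z = 0" if "z \<notin> cball (lattice_pt p) (rad p)" for z v
    using that theta_inactive by blast+
qed (simp_all add: has_dir_deriv_theta continuous_theta)

lemma lap_eq_lap_theta: "C2_compact.lap (theta2 p) = lap_theta p"
  by (rule ext) (simp add: C2_compact.lap_def[OF C2_compact_theta] lap_theta_def)

text \<open>Each derivative costs a factor of order 1 / rad. The constants round up 3 * 11/5 = 6.6
  and 6 * (11/5)^2 + 6 * (11/10)^2 = 36.3.\<close>

lemma bump_deriv_bounds:
  assumes p: "p \<in> active z" and v: "cmod v = 1"
  shows "\<bar>bump1 p v z\<bar> \<le> 7 / (R z / 10)" "\<bar>bump2 p v z\<bar> \<le> 37 / (R z / 10)\<^sup>2"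
proof -
  define s where "s = R z / 10"
  define r where "r = rad p"
  have s: "s > 0" using big[of z] by (simp add: s_def)
  have r: "r > 0" "10/11 * s \<le> r" using rad_ge[of p] rad_compare[OF p] by (simp_all add: r_def s_def)
  have ir: "1 / r \<le> 11/10 / s" using r s by (simp add: field_simps)
  have m: "0 \<le> max 0 (depth p z)" "max 0 (depth p z) \<le> 1" using depth_le_1[of p z] by auto
  have "\<bar>dot (z - lattice_pt p) v\<bar> \<le> r"
    using dot_le[of "z - lattice_pt p" v] p v by (simp add: active_def r_def)
  then have "2 * \<bar>dot (z - lattice_pt p) v\<bar> / r\<^sup>2 \<le> 2 * r / r\<^sup>2"
    by (intro divide_right_mono) auto
  also have "\<dots> = 2 * (1 / r)" using r by (simp add: power2_eq_square)
  also have "\<dots> \<le> 2 * (11/10 / s)" using ir by simp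
  finally have g: "\<bar>- 2 * dot (z - lattice_pt p) v / r\<^sup>2\<bar> \<le> 11/5 / s" by (simp add: abs_mult)
  have "\<bar>bump1 p v z\<bar> = 3 * max 0 (depth p z) ^ 2 * \<bar>- 2 * dot (z - lattice_pt p) v / r\<^sup>2\<bar>"
    by (simp add: bump1_def r_def abs_mult)
  also have "\<dots> \<le> 3 * 1 * (11/5 / s)"
    using g m s by (intro mult_mono power_le_one) auto
  also have "\<dots> \<le> 7 / s" using s by (simp add: field_simps)
  finally show "\<bar>bump1 p v z\<bar> \<le> 7 / (R z / 10)" by (simp add: s_def)
  have g2: "(- 2 * dot (z - lattice_pt p) v / r\<^sup>2)\<^sup>2 \<le> (11/5 / s)\<^sup>2"
    using power_mono[OF g abs_ge_zero, of 2] by (simp only: power2_abs)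
  have h2: "2 / r\<^sup>2 \<le> 2 * (11/10 / s)\<^sup>2"
    using power_mono[OF ir, of 2] r by (simp add: power_one_over power_divide)
  have "\<bar>bump2 p v z\<bar> \<le> 6 * max 0 (depth p z) * (- 2 * dot (z - lattice_pt p) v / r\<^sup>2)\<^sup>2
      + 3 * max 0 (depth p z) ^ 2 * (2 / r\<^sup>2)"
    unfolding bump2_def r_def v using m
    by (intro order_trans[OF abs_triangle_ineq] add_mono) (auto simp: abs_mult)
  also have "\<dots> \<le> 6 * 1 * (11/5 / s)\<^sup>2 + 3 * 1 * (2 * (11/10 / s)\<^sup>2)"
    using g2 h2 m by (intro add_mono mult_mono power_le_one) auto
  also have "\<dots> \<le> 37 / s\<^sup>2" using s by (simp add: power_divide field_simps)
  finally show "\<bar>bump2 p v z\<bar> \<le> 37 / (R z / 10)\<^sup>2" by (simp add: s_def)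
qed

lemma total_deriv_bounds:
  assumes v: "cmod v = 1"
  shows "\<bar>total1 v z\<bar> \<le> 21 * (R z / 10)" "\<bar>total2 v z\<bar> \<le> 111"
proof -
  define s where "s = R z / 10"
  have s: "s > 0" using big[of z] by (simp add: s_def)
  have "\<bar>total1 v z\<bar> \<le> (\<Sum>p\<in>active z. 7 / s)"
    unfolding total1_def s_def by (rule order_trans[OF sum_abs]) (intro sum_mono bump_deriv_bounds v)
  also have "\<dots> \<le> 3 * s\<^sup>2 * (7 / s)"
    using card_active[of z] s by (simp only: sum_constant) (intro mult_right_mono, auto simp: s_def)
  also have "\<dots> = 21 * s" using s by (simp add: power2_eq_square)
  finally show "\<bar>total1 v z\<bar> \<le> 21 * (R z / 10)" by (simp add: s_def)
  have "\<bar>total2 v z\<bar> \<le> (\<Sum>p\<in>active z. 37 / s\<^sup>2)"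
    unfolding total2_def s_def by (rule order_trans[OF sum_abs]) (intro sum_mono bump_deriv_bounds v)
  also have "\<dots> \<le> 3 * s\<^sup>2 * (37 / s\<^sup>2)"
    using card_active[of z] s by (simp only: sum_constant) (intro mult_right_mono, auto simp: s_def)
  also have "\<dots> = 111" using s by simp
  finally show "\<bar>total2 v z\<bar> \<le> 111" .
qed

lemma theta_le:
  assumes "p \<in> active z" shows "theta p z \<le> 48 / (R z / 10)\<^sup>2"
proof -
  have "theta p z \<le> 1 / total z" using bump_le_1[of p z] total_pos[of z] by (simp add: theta_def divide_right_mono)
  also have "\<dots> \<le> 1 / ((R z / 10)\<^sup>2 / 48)"
    using total_ge[of z] big[of z] by (intro divide_left_mono mult_pos_pos total_pos) auto
  finally show ?thesis by simp
qed

lemma theta2_bound: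
  assumes p: "p \<in> active z" and v: "cmod v = 1"
  shows "\<bar>theta2 p v z\<bar> \<le> 10 ^ 8 / (R z / 10) ^ 4"
proof -
  define s where "s = R z / 10"
  \<comment> \<open>With \<open>s * q = 1\<close> the estimate becomes polynomial, and each of the
    four terms of \<open>theta2\<close> visibly has order \<open>q ^ 4\<close>.\<close>
  define q where "q = 1 / s"
  define i where "i = 1 / total z"
  have s: "s > 0" using big[of z] by (simp add: s_def)
  have q: "q > 0" "s * q = 1" using s by (simp_all add: q_def)
  have i0: "i > 0" using total_pos[of z] by (simp add: i_def)
  have "i \<le> 1 / (s\<^sup>2 / 48)"
    unfolding i_def using total_ge[of z] s by (intro divide_left_mono mult_pos_pos total_pos) (auto simp: s_def)
  then have i: "i \<le> 48 * q\<^sup>2" by (simp add: q_def power_divide)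
  have i2: "i\<^sup>2 \<le> (48 * q\<^sup>2)\<^sup>2" and i3: "i ^ 3 \<le> (48 * q\<^sup>2) ^ 3" 
    using power_mono[OF i less_imp_le[OF i0]] by blast+
  have k: "0 \<le> bump p z" "bump p z \<le> 1" using bump_nonneg bump_le_1 by auto
  have k1: "\<bar>bump1 p v z\<bar> \<le> 7 * q" and k2: "\<bar>bump2 p v z\<bar> \<le> 37 * q\<^sup>2"
    using bump_deriv_bounds[OF p v] by (simp_all add: q_def s_def power_divide)
  have T1: "\<bar>total1 v z\<bar> \<le> 21 * s" and T2: "\<bar>total2 v z\<bar> \<le> 111"
    using total_deriv_bounds[OF v] by (simp_all add: s_def)
  have "theta2 p v z = bump2 p v z * i - 2 * bump1 p v z * total1 v z * i\<^sup>2
     + bump p z * (2 * (total1 v z)\<^sup>2 * i ^ 3 - total2 v z * i\<^sup>2)"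
    by (simp add: theta2_def i_def power_divide)
  then have "\<bar>theta2 p v z\<bar> \<le> \<bar>bump2 p v z * i\<bar> + \<bar>2 * bump1 p v z * total1 v z * i\<^sup>2\<bar>
     + \<bar>bump p z * (2 * (total1 v z)\<^sup>2 * i ^ 3 - total2 v z * i\<^sup>2)\<bar>" by linarith
  also have "\<bar>bump p z * (2 * (total1 v z)\<^sup>2 * i ^ 3 - total2 v z * i\<^sup>2)\<bar>
     \<le> 1 * (\<bar>2 * (total1 v z)\<^sup>2 * i ^ 3\<bar> + \<bar>total2 v z * i\<^sup>2\<bar>)"
    unfolding abs_mult[of "bump p z"] using k by (intro mult_mono) (auto intro: abs_triangle_ineq4)
  also have "\<bar>bump2 p v z * i\<bar> \<le> 37 * q\<^sup>2 * (48 * q\<^sup>2)"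
    unfolding abs_mult using k2 i i0 by (intro mult_mono) auto
  also have "\<bar>2 * bump1 p v z * total1 v z * i\<^sup>2\<bar> \<le> 2 * (7 * q) * (21 * s) * (48 * q\<^sup>2)\<^sup>2"
    unfolding abs_mult using k1 T1 i2 i0 q s by (intro mult_mono) auto
  also have "\<bar>2 * (total1 v z)\<^sup>2 * i ^ 3\<bar> \<le> 2 * (21 * s)\<^sup>2 * (48 * q\<^sup>2) ^ 3"
    unfolding abs_mult using power_mono[OF T1 abs_ge_zero, of 2] i3 i0 q s by (intro mult_mono) auto
  also have "\<bar>total2 v z * i\<^sup>2\<bar> \<le> 111 * (48 * q\<^sup>2)\<^sup>2"
    unfolding abs_mult using T2 i2 i0 by (intro mult_mono) auto
  \<comment> \<open>The four coefficients add up to 98477040, just below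
    \<open>10 ^ 8\<close>.\<close>
  also have "37 * q\<^sup>2 * (48 * q\<^sup>2) + 2 * (7 * q) * (21 * s) * (48 * q\<^sup>2)\<^sup>2
      + 1 * (2 * (21 * s)\<^sup>2 * (48 * q\<^sup>2) ^ 3 + 111 * (48 * q\<^sup>2)\<^sup>2)
    = (1776 + 677376 * (s * q) + 97542144 * (s * q)\<^sup>2 + 255744) * q ^ 4"
    by (simp add: algebra_simps eval_nat_numeral)
  also have "\<dots> \<le> 10 ^ 8 * q ^ 4" using q by (intro mult_right_mono) auto
  finally show ?thesis by (simp add: q_def s_def power_divide)
qed

lemma lap_theta_bound:
  assumes "p \<in> active z"
  shows "\<bar>lap_theta p z\<bar> \<le> 2 * 10 ^ 8 / (R z / 10) ^ 4"
  using theta2_bound[OF assms, of 1] theta2_bound[OF assms, of \<i>] unfolding lap_theta_def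
  by (simp add: abs_le_iff)

section \<open>Charging the Laplacian of a partial sum to neighbouring bumps\<close>

definition flux_bound where
  "flux_bound k z = (5 * 10 ^ 10 / (rad k) ^ 4) * indicator (cball (lattice_pt k) (rad k)) z"

lemma flux_bound_nonneg: "flux_bound k z \<ge> 0"
  using rad_ge[of k] by (simp add: flux_bound_def)

text \<open>The left side is what one bump \<open>k\<close> has to carry in the splitting of a
  partial sum. About s^2 Laplacians of size s^-4 times a height s^-2 is again of order s^-4. Passing
  from \<open>R z\<close> to \<open>rad k\<close> costs (10/9)^4 and lifts 3 * 10^10 to 5 * 10^10;
  the bound then depends on \<open>z\<close> only through one disc.\<close>

lemma flux_le:
  assumes k: "k \<in> active z"
  shows "theta k z * (\<Sum>i\<in>active z. \<bar>lap_theta i z\<bar>) + \<bar>lap_theta k z\<bar> \<le> flux_bound k z"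
proof -
  define s where "s = R z / 10"
  define q where "q = 1 / s"
  have s: "s > 0" using big[of z] by (simp add: s_def)
  have q: "q > 0" "s * q = 1" using s by (simp_all add: q_def)
  have lt: "\<bar>lap_theta i z\<bar> \<le> 2 * 10 ^ 8 * q ^ 4" if "i \<in> active z" for i
    using lap_theta_bound[OF that] by (simp add: q_def s_def power_divide)
  have "(\<Sum>i\<in>active z. \<bar>lap_theta i z\<bar>) \<le> (\<Sum>i\<in>active z. 2 * 10 ^ 8 * q ^ 4)"
    by (intro sum_mono lt)
  also have "\<dots> \<le> 3 * s\<^sup>2 * (2 * 10 ^ 8 * q ^ 4)"
    using card_active[of z] q by (simp only: sum_constant) (intro mult_right_mono, auto simp: s_def)
  also have "\<dots> = 6 * 10 ^ 8 * (s * q)\<^sup>2 * q\<^sup>2" by (simp add: algebra_simps eval_nat_numeral)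
  finally have S: "(\<Sum>i\<in>active z. \<bar>lap_theta i z\<bar>) \<le> 6 * 10 ^ 8 * q\<^sup>2" using q by simp
  have t: "theta k z \<le> 48 * q\<^sup>2" using theta_le[OF k] by (simp add: q_def s_def power_divide)
  have "theta k z * (\<Sum>i\<in>active z. \<bar>lap_theta i z\<bar>) + \<bar>lap_theta k z\<bar>
     \<le> (48 * q\<^sup>2) * (6 * 10 ^ 8 * q\<^sup>2) + 2 * 10 ^ 8 * q ^ 4"
    using t S lt[OF k] theta_nonneg by (intro add_mono mult_mono) (auto intro: sum_nonneg)
  also have "\<dots> = (48 * 6 * 10 ^ 8 + 2 * 10 ^ 8) * q ^ 4" by (simp add: algebra_simps)
  also have "\<dots> \<le> 3 * 10 ^ 10 * q ^ 4" using q by (intro mult_right_mono) auto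
  also have "\<dots> \<le> 3 * 10 ^ 10 * (10/9 / rad k) ^ 4"
  proof (intro mult_left_mono power_mono)
    have "rad k \<le> 10/9 * s" using rad_compare(1)[OF k] by (simp add: s_def)
    then show "q \<le> 10/9 / rad k" unfolding q_def using s rad_ge[of k] by (simp add: field_simps)
  qed (use q in auto)
  also have "\<dots> \<le> 5 * 10 ^ 10 / (rad k) ^ 4"
  proof -
    have "0 < rad k ^ 4" using rad_ge[of k] by simp
    then show ?thesis by (simp add: power_divide field_simps)
  qed
  also have "\<dots> = flux_bound k z"
    using k by (simp add: flux_bound_def active_def dist_norm norm_minus_commute)
  finally show ?thesis .
qed

text \<open>With \<open>L\<close>, \<open>\<Theta>\<close> the sums over \<open>B\<close> and \<open>-L\<close>, \<open>1 - \<Theta>\<close> those over \<open>C\<close>, write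
  \<open>L = L (1 - \<Theta>) - (-L) \<Theta>\<close>: every term carries a factor with index in \<open>C\<close>.\<close>

lemma lap_theta_sum_split:
  assumes BC: "B \<union> C = active z" "B \<inter> C = {}"
  shows "\<bar>\<Sum>p\<in>B. lap_theta p z\<bar> \<le> (\<Sum>k\<in>C. flux_bound k z)"
proof -
  have fin: "finite B" "finite C" using BC(1) finite_active[of z] by (metis finite_Un)+
  let ?L = "\<Sum>p\<in>B. lap_theta p z" and ?M = "\<Sum>p\<in>C. lap_theta p z"
  let ?T = "\<Sum>p\<in>B. theta p z" and ?U = "\<Sum>p\<in>C. theta p z"
  let ?S = "\<Sum>i\<in>active z. \<bar>lap_theta i z\<bar>"
  have LM: "?L + ?M = 0"
    using sum.union_disjoint[OF fin BC(2), of "\<lambda>p. lap_theta p z"] BC(1) sum_lap_theta[of z] by simp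
  have TU: "?T + ?U = 1"
    using sum.union_disjoint[OF fin BC(2), of "\<lambda>p. theta p z"] BC(1) sum_theta[of z] by simp
  have T0: "0 \<le> ?T" "0 \<le> ?U" using theta_nonneg by (auto intro: sum_nonneg)
  have "\<bar>?L\<bar> \<le> (\<Sum>p\<in>B. \<bar>lap_theta p z\<bar>)" by (rule sum_abs)
  also have "\<dots> \<le> ?S" using BC(1) finite_active by (intro sum_mono2) auto
  finally have L: "\<bar>?L\<bar> \<le> ?S" .
  have "?L = ?L * (?T + ?U)" using TU by simp
  also have "\<dots> = ?L * ?U - ?M * ?T" using LM by (simp add: algebra_simps add_eq_0_iff2)
  finally have "\<bar>?L\<bar> \<le> \<bar>?L * ?U\<bar> + \<bar>?M * ?T\<bar>" by linarith
  also have "\<bar>?L * ?U\<bar> \<le> ?S * ?U" using L T0 by (simp add: abs_mult mult_right_mono)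
  also have "\<bar>?M * ?T\<bar> \<le> \<bar>?M\<bar> * 1" unfolding abs_mult using T0 TU by (intro mult_left_mono) auto
  also have "\<bar>?M\<bar> * 1 \<le> (\<Sum>k\<in>C. \<bar>lap_theta k z\<bar>)" by (simp add: sum_abs)
  also have "?S * ?U + (\<Sum>k\<in>C. \<bar>lap_theta k z\<bar>) = (\<Sum>k\<in>C. theta k z * ?S + \<bar>lap_theta k z\<bar>)"
    by (simp add: sum.distrib sum_distrib_right mult.commute)
  also have "\<dots> \<le> (\<Sum>k\<in>C. flux_bound k z)" using BC(1) by (intro sum_mono flux_le) auto
  finally show ?thesis by simp
qed

text \<open>Where the active bumps all lie in \<open>I\<close>, or all outside, the sum vanishes.
  Elsewhere the sums inside and outside are opposite, so \<open>S\<close> has to cover only one of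
  the two sides. The outer alternative serves the upper bound for zeros, the inner one the lower
  bound.\<close>

lemma lap_theta_sum_bound:
  assumes "finite I" "finite S"
    and "(active z \<inter> I \<noteq> {} \<longrightarrow> active z - I \<subseteq> S) \<or> (active z - I \<noteq> {} \<longrightarrow> active z \<inter> I \<subseteq> S)"
  shows "\<bar>\<Sum>p\<in>I. lap_theta p z\<bar> \<le> (\<Sum>k\<in>S. flux_bound k z)"
proof -
  let ?B = "active z \<inter> I" and ?C = "active z - I"
  have eq: "(\<Sum>p\<in>I. lap_theta p z) = (\<Sum>p\<in>?B. lap_theta p z)"
    using theta_inactive(4) by (intro sum.mono_neutral_right assms(1)) blast+
  have fin: "finite ?B" "finite ?C" using finite_active by auto
  have opp: "\<bar>\<Sum>p\<in>?B. lap_theta p z\<bar> = \<bar>\<Sum>p\<in>?C. lap_theta p z\<bar>"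
  proof -
    have "(\<Sum>p\<in>?B. lap_theta p z) + (\<Sum>p\<in>?C. lap_theta p z) = (\<Sum>p\<in>?B \<union> ?C. lap_theta p z)"
      using fin by (intro sum.union_disjoint[symmetric]) auto
    also have "?B \<union> ?C = active z" by auto
    finally show ?thesis using sum_lap_theta[of z] by linarith
  qed
  have S0: "0 \<le> (\<Sum>k\<in>S. flux_bound k z)" by (intro sum_nonneg flux_bound_nonneg)
  have mono: "(\<Sum>k\<in>X. flux_bound k z) \<le> (\<Sum>k\<in>S. flux_bound k z)" if "X \<subseteq> S" for X
    using that assms(2) flux_bound_nonneg by (intro sum_mono2) auto
  show ?thesis
  proof (cases "?B = {} \<or> ?C = {}")
    case True
    then have "\<bar>\<Sum>p\<in>?B. lap_theta p z\<bar> = 0" using opp by (metis abs_zero sum.empty)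
    then show ?thesis using S0 eq by simp
  next
    case False
    then consider "?C \<subseteq> S" | "?B \<subseteq> S" using assms(3) by blast
    then show ?thesis
    proof cases
      case 1
      have "\<bar>\<Sum>p\<in>?B. lap_theta p z\<bar> \<le> (\<Sum>k\<in>?C. flux_bound k z)" by (rule lap_theta_sum_split) auto
      then show ?thesis using mono[OF 1] eq by simp
    next
      case 2
      have "\<bar>\<Sum>p\<in>?C. lap_theta p z\<bar> \<le> (\<Sum>k\<in>?B. flux_bound k z)" by (rule lap_theta_sum_split) auto
      then show ?thesis using mono[OF 2] eq opp by simp
    qed
  qed
qed

definition area where "area p = (\<integral>z. theta p z \<partial>lborel)"

lemma integrable_theta: "integrable lborel (theta p)"
  by (rule C2_compact.integrable_h[OF C2_compact_theta])

text \<open>On the disc of half the radius \<open>theta\<close> is at least 1 / (10 r^2), since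
  there \<open>bump\<close> is at least 2/5 and \<open>total\<close> at most 4 r^2. Its area pi r^2
  / 4 gives pi / 40, independent of the scale.\<close>

lemma area_ge: "1/20 \<le> area p"
proof -
  define r where "r = rad p"
  have r: "r > 0" using rad_ge[of p] by (simp add: r_def)
  define B where "B = cball (lattice_pt p) (r / 2)"
  have B: "1/10 / r\<^sup>2 \<le> theta p z" if "z \<in> B" for z
  proof -
    have d: "cmod (z - lattice_pt p) \<le> r / 2" using that by (simp add: B_def dist_norm norm_minus_commute)
    then have p: "p \<in> active z" using r by (simp add: active_def r_def)
    have "(cmod (z - lattice_pt p))\<^sup>2 \<le> (r / 2)\<^sup>2" using d by (intro power_mono) auto
    then have "(cmod (z - lattice_pt p))\<^sup>2 / r\<^sup>2 \<le> 1/4" using r by (simp add: pos_divide_le_eq power_divide)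
    then have "3/4 \<le> depth p z" by (simp add: depth_def r_def)
    then have "(3/4) ^ 3 \<le> bump p z" unfolding bump_def by (intro power_mono) auto
    then have k: "2/5 \<le> bump p z" by (simp add: power3_eq_cube)
    have "10/11 * (R z / 10) \<le> r" using rad_compare(2)[OF p] by (simp add: r_def)
    then have "R z / 10 \<le> 11/10 * r" by simp
    then have "(R z / 10)\<^sup>2 \<le> (11/10 * r)\<^sup>2" using big[of z] by (intro power_mono) auto
    then have "total z \<le> 3 * (11/10 * r)\<^sup>2" using total_le[of z] by linarith
    also have "\<dots> \<le> 4 * r\<^sup>2" by (simp add: power_mult_distrib power_divide)
    finally have "2/5 / (4 * r\<^sup>2) \<le> bump p z / total z"
      using k total_pos[of z] by (intro frac_le) auto
    then show ?thesis by (simp add: theta_def)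
  qed
  have em: "emeasure lborel B = ennreal (pi * (r / 2)\<^sup>2)"
    using r by (simp add: B_def emeasure_cball eval_unit_ball_vol)
  then have mB: "measure lborel B = pi * (r / 2)\<^sup>2" by (simp add: measure_def)
  have iB: "integrable lborel (\<lambda>z. 1/10 / r\<^sup>2 * indicator B z)"
    by (intro integrable_mult_right integrable_real_indicator) (simp_all add: em, simp add: B_def)
  have "1/20 \<le> pi / 40" using pi_gt3 by simp
  also have "\<dots> = 1/10 / r\<^sup>2 * measure lborel B" using r by (simp add: mB power_divide)
  also have "\<dots> = (\<integral>z. 1/10 / r\<^sup>2 * indicator B z \<partial>lborel)"
    by (subst integral_mult_right_zero) (simp add: B_def)
  also have "\<dots> \<le> area p"
    unfolding area_def using B theta_nonneg
    by (intro integral_mono iB integrable_theta) (auto simp: indicator_def)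
  finally show ?thesis .
qed

end

section \<open>Comparing zeros and lattice points\<close>

lemma integral_cells:
  assumes "finite Q"
  shows "integrable lborel (\<lambda>z. indicator {z. cell_index z \<in> Q} z :: real)"
    "(\<integral>z. indicator {z. cell_index z \<in> Q} z \<partial>lborel) = pi * real (card Q)"
proof -
  have eq: "indicator {z. cell_index z \<in> Q} z = (\<Sum>q\<in>Q. indicator {z. cell_index z = q} z :: real)" for z
    using assms by (simp add: indicator_def of_bool_def)
  have i: "integrable lborel (\<lambda>z. indicator {z. cell_index z = q} z :: real)" for q
    by (intro integrable_real_indicator) (simp_all add: emeasure_cell)
  have m: "measure lborel {z. cell_index z = q} = pi" for q
    using emeasure_cell[of q] by (simp add: measure_def)
  show "integrable lborel (\<lambda>z. indicator {z. cell_index z \<in> Q} z :: real)"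
    unfolding eq by (intro Bochner_Integration.integrable_sum i)
  show "(\<integral>z. indicator {z. cell_index z \<in> Q} z \<partial>lborel) = pi * real (card Q)"
    unfolding eq using i by (subst Bochner_Integration.integral_sum) (auto simp: m)
qed

text \<open>The denominator \<open>10 ^ 12\<close> in \<open>small\<close> is tuned so that
  \<open>flux_bound\<close> integrated against |\<phi>| gives at most 5 * 10^10 / 10^12 = 1/20, the
  lower bound for the area of a bump.\<close>

locale zero_transport = lipschitz_scale +
  fixes \<psi> :: "complex \<Rightarrow> complex" and w0
  assumes entire: "\<psi> holomorphic_on UNIV" and nonzero: "\<psi> w0 \<noteq> 0"
    and small: "(\<integral>\<^sup>+z. ennreal (indicator (cball (lattice_pt p) (rad p)) z * \<bar>phi_of \<psi> z\<bar>) \<partial>lborel)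
      \<le> ennreal ((rad p) ^ 4 / 10 ^ 12)"
begin

definition mult where "mult z = real (nat (zorder \<psi> z))"

definition zeros where "zeros p = {z \<in> cball (lattice_pt p) (rad p). \<psi> z = 0}"

definition mass where "mass p = (\<Sum>z\<in>zeros p. mult z * theta p z)"

lemma finite_zeros: "finite (zeros p)"
  unfolding zeros_def by (rule entire_finite_zeros[OF entire nonzero])

lemma phi_measurable [measurable]: "phi_of \<psi> \<in> borel_measurable borel"
proof -
  have [measurable]: "\<psi> \<in> borel_measurable borel"
    using entire by (intro borel_measurable_continuous_onI holomorphic_on_imp_continuous_on)
  show ?thesis unfolding phi_of_def by measurable
qed

lemma phi_integrable:
  "integrable lborel (\<lambda>z. indicator (cball (lattice_pt p) (rad p)) z * phi_of \<psi> z)"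
  "(\<integral>z. indicator (cball (lattice_pt p) (rad p)) z * \<bar>phi_of \<psi> z\<bar> \<partial>lborel) \<le> (rad p) ^ 4 / 10 ^ 12"
proof -
  have n: "ennreal (norm (indicator (cball (lattice_pt p) (rad p)) z * phi_of \<psi> z))
     = ennreal (indicator (cball (lattice_pt p) (rad p)) z * \<bar>phi_of \<psi> z\<bar>)" for z
    by (simp add: abs_mult)
  show int: "integrable lborel (\<lambda>z. indicator (cball (lattice_pt p) (rad p)) z * phi_of \<psi> z)"
    unfolding integrable_iff_bounded n
  proof
    show "(\<lambda>z. indicator (cball (lattice_pt p) (rad p)) z * phi_of \<psi> z) \<in> borel_measurable lborel"
      by (intro borel_measurable_times borel_measurable_indicator) (simp_all add: phi_measurable)
  qed (use le_less_trans[OF small[of p] ennreal_less_top] in simp)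
  have m: "(\<lambda>z. indicator (cball (lattice_pt p) (rad p)) z * \<bar>phi_of \<psi> z\<bar>) \<in> borel_measurable lborel"
    using borel_measurable_integrable[OF integrable_abs[OF int]] by (simp add: abs_mult)
  have "(\<integral>z. indicator (cball (lattice_pt p) (rad p)) z * \<bar>phi_of \<psi> z\<bar> \<partial>lborel)
    = enn2real (\<integral>\<^sup>+z. ennreal (indicator (cball (lattice_pt p) (rad p)) z * \<bar>phi_of \<psi> z\<bar>) \<partial>lborel)"
    by (rule integral_eq_nn_integral[OF m]) simp
  also have "\<dots> \<le> (rad p) ^ 4 / 10 ^ 12"
    using small[of p] rad_ge[of p] by (intro enn2real_leI) auto
  finally show "(\<integral>z. indicator (cball (lattice_pt p) (rad p)) z * \<bar>phi_of \<psi> z\<bar> \<partial>lborel) \<le> (rad p) ^ 4 / 10 ^ 12" .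
qed

lemma mass_balance:
  "integrable lborel (\<lambda>z. phi_of \<psi> z * lap_theta p z)"
  "(\<integral>z. phi_of \<psi> z * lap_theta p z \<partial>lborel) = pi * mass p - area p"
proof -
  interpret T: C2_compact "cball (lattice_pt p) (rad p)" "theta p" "theta1 p" "theta2 p"
    by (rule C2_compact_theta)
  have Z: "z \<in> zeros p" if "\<psi> z = 0" "theta p z \<noteq> 0" for z
    using that T.supp(1)[of z] by (auto simp: zeros_def)
  have Z0: "\<psi> z = 0" if "z \<in> zeros p" for z using that by (simp add: zeros_def)
  note g = T.green_phi[OF entire nonzero phi_integrable(1) finite_zeros Z Z0, unfolded lap_eq_lap_theta]
  show "integrable lborel (\<lambda>z. phi_of \<psi> z * lap_theta p z)" by (rule g(1))
  show "(\<integral>z. phi_of \<psi> z * lap_theta p z \<partial>lborel) = pi * mass p - area p"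
    using g(2) by (simp add: mass_def area_def mult_def)
qed

text \<open>Adding the balance identities over \<open>I\<close> leaves \<phi> integrated against a
  sum of Laplacians, supported where \<open>I\<close> meets its complement. Each bump in
  \<open>S\<close> takes on at most 1/20 of this error, hence no more than its own area, which is
  the currency in which Hall's inequalities are settled.\<close>

lemma imbalance_bound:
  assumes I: "finite I" "finite S"
    and b: "\<And>z. (active z \<inter> I \<noteq> {} \<longrightarrow> active z - I \<subseteq> S) \<or> (active z - I \<noteq> {} \<longrightarrow> active z \<inter> I \<subseteq> S)"
  shows "\<bar>pi * (\<Sum>p\<in>I. mass p) - (\<Sum>p\<in>I. area p)\<bar> \<le> (\<Sum>k\<in>S. area k)"
proof -
  have "pi * (\<Sum>p\<in>I. mass p) - (\<Sum>p\<in>I. area p) = (\<Sum>p\<in>I. \<integral>z. phi_of \<psi> z * lap_theta p z \<partial>lborel)"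
    by (simp add: mass_balance(2) sum_subtractf sum_distrib_left)
  also have "\<dots> = (\<integral>z. (\<Sum>p\<in>I. phi_of \<psi> z * lap_theta p z) \<partial>lborel)"
    by (subst Bochner_Integration.integral_sum) (use mass_balance(1) in auto)
  also have "\<bar>\<dots>\<bar> \<le> (\<integral>z. \<bar>\<Sum>p\<in>I. phi_of \<psi> z * lap_theta p z\<bar> \<partial>lborel)"
    by (rule integral_abs_bound)
  also have "\<dots> \<le> (\<integral>z. (\<Sum>k\<in>S. 5 * 10 ^ 10 / (rad k) ^ 4 *
      \<bar>indicator (cball (lattice_pt k) (rad k)) z * phi_of \<psi> z\<bar>) \<partial>lborel)"
  proof (rule integral_mono)
    show "integrable lborel (\<lambda>z. \<bar>\<Sum>p\<in>I. phi_of \<psi> z * lap_theta p z\<bar>)"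
      by (intro integrable_abs Bochner_Integration.integrable_sum mass_balance(1))
    show "integrable lborel (\<lambda>z. \<Sum>k\<in>S. 5 * 10 ^ 10 / (rad k) ^ 4 *
        \<bar>indicator (cball (lattice_pt k) (rad k)) z * phi_of \<psi> z\<bar>)"
      by (intro Bochner_Integration.integrable_sum integrable_mult_right integrable_abs phi_integrable(1))
    fix z
    have "\<bar>\<Sum>p\<in>I. phi_of \<psi> z * lap_theta p z\<bar> = \<bar>phi_of \<psi> z\<bar> * \<bar>\<Sum>p\<in>I. lap_theta p z\<bar>"
      by (simp add: sum_distrib_left[symmetric] abs_mult)
    also have "\<dots> \<le> \<bar>phi_of \<psi> z\<bar> * (\<Sum>k\<in>S. flux_bound k z)"
      by (intro mult_left_mono lap_theta_sum_bound I b) auto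
    also have "\<dots> = (\<Sum>k\<in>S. 5 * 10 ^ 10 / (rad k) ^ 4 *
        \<bar>indicator (cball (lattice_pt k) (rad k)) z * phi_of \<psi> z\<bar>)"
      by (simp add: flux_bound_def sum_distrib_left abs_mult mult_ac)
    finally show "\<bar>\<Sum>p\<in>I. phi_of \<psi> z * lap_theta p z\<bar> \<le> (\<Sum>k\<in>S. 5 * 10 ^ 10 / (rad k) ^ 4 *
        \<bar>indicator (cball (lattice_pt k) (rad k)) z * phi_of \<psi> z\<bar>)" .
  qed
  also have "\<dots> = (\<Sum>k\<in>S. 5 * 10 ^ 10 / (rad k) ^ 4 *
      (\<integral>z. indicator (cball (lattice_pt k) (rad k)) z * \<bar>phi_of \<psi> z\<bar> \<partial>lborel))"
    by (subst Bochner_Integration.integral_sum)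
      (intro integrable_mult_right integrable_abs phi_integrable(1), simp add: abs_mult)
  also have "\<dots> \<le> (\<Sum>k\<in>S. area k)"
  proof (rule sum_mono)
    fix k
    have r: "(rad k) ^ 4 > 0" using rad_ge[of k] by simp
    have "5 * 10 ^ 10 / (rad k) ^ 4 * (\<integral>z. indicator (cball (lattice_pt k) (rad k)) z * \<bar>phi_of \<psi> z\<bar> \<partial>lborel)
      \<le> 5 * 10 ^ 10 / (rad k) ^ 4 * ((rad k) ^ 4 / 10 ^ 12)"
      using r by (intro mult_left_mono phi_integrable(2)) auto
    also have "\<dots> = 1/20" using r by simp
    finally show "5 * 10 ^ 10 / (rad k) ^ 4 * (\<integral>z. indicator (cball (lattice_pt k) (rad k)) z * \<bar>phi_of \<psi> z\<bar> \<partial>lborel)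
      \<le> area k" using area_ge[of k] by linarith
  qed
  finally show ?thesis .
qed

definition nbr where "nbr I = {j. \<exists>z. j \<in> active z \<and> active z \<inter> I \<noteq> {}}"

lemma active_self: "p \<in> active (lattice_pt p)"
  using rad_ge[of p] by (simp add: active_def)

lemma subset_nbr: "I \<subseteq> nbr I"
  unfolding nbr_def using active_self by blast

lemma lattice_dist:
  assumes "i \<in> active z" "j \<in> active z"
  shows "cmod (lattice_pt i - lattice_pt j) < rad i + rad j"
  using assms norm_triangle_ineq[of "lattice_pt i - z" "z - lattice_pt j"]
  by (simp add: active_def norm_minus_commute)

lemma finite_near_lattice_pt: "finite {j. cmod (lattice_pt i - lattice_pt j) \<le> R (lattice_pt i)}"
  using big[of "lattice_pt i"] by (intro lattice_count_upper(1)) simp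

lemma finite_nbr:
  assumes "finite I" shows "finite (nbr I)"
proof (rule finite_subset)
  show "nbr I \<subseteq> (\<Union>i\<in>I. {j. cmod (lattice_pt i - lattice_pt j) \<le> R (lattice_pt i)})"
  proof (rule subsetI)
    fix j assume "j \<in> nbr I"
    then obtain z i where zi: "j \<in> active z" "i \<in> active z" "i \<in> I" by (auto simp: nbr_def)
    have "cmod (lattice_pt i - lattice_pt j) \<le> R (lattice_pt i)"
      using lattice_dist[OF zi(2,1)] lip[of "lattice_pt i" "lattice_pt j"] big[of "lattice_pt i"]
      unfolding rad_def abs_le_iff by argo
    then show "j \<in> (\<Union>i\<in>I. {j. cmod (lattice_pt i - lattice_pt j) \<le> R (lattice_pt i)})" using zi(3) by blast
  qed
qed (use assms finite_near_lattice_pt in blast)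

text \<open>The route is: zero \<open>z\<close>, bump \<open>i\<close>, neighbouring bump
  \<open>j\<close>, point \<open>w\<close> under \<open>j\<close>, centre of the cell of
  \<open>w\<close>. Its length is at most 2 (rad i + rad j) + 2, and the Lipschitz bound turns this
  into about R / 2 at the end point; 3/4 leaves room for the additive terms.\<close>

lemma chain_dist:
  assumes "i \<in> active z" "i \<in> active u" "j \<in> active u" "j \<in> active w"
  shows "cmod (z - lattice_pt (cell_index w)) \<le> 3/4 * R (lattice_pt (cell_index w))"
proof -
  define q where "q = lattice_pt (cell_index w)"
  have zi: "cmod (z - lattice_pt i) < R (lattice_pt i) / 10" using assms(1) by (simp add: active_def rad_def)
  have ij: "cmod (lattice_pt i - lattice_pt j) < R (lattice_pt i) / 10 + R (lattice_pt j) / 10"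
    using lattice_dist[OF assms(2,3)] by (simp add: rad_def)
  have jw: "cmod (lattice_pt j - w) < R (lattice_pt j) / 10"
    using assms(4) by (simp add: active_def rad_def norm_minus_commute)
  have wq: "cmod (w - q) \<le> 2" unfolding q_def by (rule cell_index_dist)
  have jq: "cmod (lattice_pt j - q) \<le> cmod (lattice_pt j - w) + cmod (w - q)"
    using norm_triangle_ineq[of "lattice_pt j - w" "w - q"] by simp
  have zj: "cmod (z - lattice_pt j) \<le> cmod (z - lattice_pt i) + cmod (lattice_pt i - lattice_pt j)"
    using norm_triangle_ineq[of "z - lattice_pt i" "lattice_pt i - lattice_pt j"] by simp
  have zq: "cmod (z - q) \<le> cmod (z - lattice_pt j) + cmod (lattice_pt j - q)"
    using norm_triangle_ineq[of "z - lattice_pt j" "lattice_pt j - q"] by simp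
  show ?thesis
    using zi ij jw wq jq zj zq lip[of "lattice_pt i" "lattice_pt j"] lip[of "lattice_pt j" q] big[of q]
    unfolding q_def[symmetric] abs_le_iff by argo
qed

section \<open>The admissible pairs and the two Hall inequalities\<close>

definition matched where "matched z q \<longleftrightarrow> cmod (z - lattice_pt q) \<le> 3/4 * R (lattice_pt q)"

lemma finite_matched_lattice: "finite {q. matched z q}"
proof (rule finite_subset)
  show "{q. matched z q} \<subseteq> {q. cmod (z - lattice_pt q) \<le> 3 * R z}"
  proof (rule subsetI)
    fix q assume "q \<in> {q. matched z q}"
    \<comment> \<open>If \<open>q\<close> is within 3/4 of its own value of \<open>R\<close>, that
      value is at most 4 times \<open>R z\<close>, and 3/4 of it at most 3 times
      \<open>R z\<close>.\<close>
    then have "cmod (z - lattice_pt q) \<le> 3 * R z"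
      using lip[of z "lattice_pt q"] unfolding matched_def abs_le_iff mem_Collect_eq by argo
    then show "q \<in> {q. cmod (z - lattice_pt q) \<le> 3 * R z}" by simp
  qed
  show "finite {q. cmod (z - lattice_pt q) \<le> 3 * R z}"
    using big[of z] by (intro lattice_count_upper(1)) simp
qed

lemma finite_matched_zeros: "finite {z. \<psi> z = 0 \<and> matched z q}"
proof (rule finite_subset)
  show "{z. \<psi> z = 0 \<and> matched z q} \<subseteq> {z \<in> cball (lattice_pt q) (3/4 * R (lattice_pt q)). \<psi> z = 0}"
    by (auto simp: matched_def dist_norm norm_minus_commute)
qed (rule entire_finite_zeros[OF entire nonzero])

text \<open>Each \<open>mass p\<close> has its own index set \<open>zeros p\<close>; this moves it
  to a set shared by several bumps, so that sums over bumps and zeros can be exchanged.\<close>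

lemma mass_eq:
  assumes "finite Z" "\<And>z. \<psi> z = 0 \<Longrightarrow> p \<in> active z \<Longrightarrow> z \<in> Z" "\<And>z. z \<in> Z \<Longrightarrow> \<psi> z = 0"
  shows "mass p = (\<Sum>z\<in>Z. mult z * theta p z)"
  unfolding mass_def
proof (rule sum.mono_neutral_cong[OF assms(1) finite_zeros])
  show "mult z * theta p z = 0" if "z \<in> Z - zeros p" for z
  proof -
    have "z \<notin> cball (lattice_pt p) (rad p)" using that assms(3) by (auto simp: zeros_def)
    then have "p \<notin> active z" by (simp add: active_def dist_norm norm_minus_commute)
    then show ?thesis by (simp add: theta_inactive)
  qed
  show "mult z * theta p z = 0" if "z \<in> zeros p - Z" for z
    using that assms(2)[of z] theta_inactive(1)[of p z] by (auto simp: zeros_def)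
qed simp

lemma mult_nonneg: "mult z \<ge> 0" by (simp add: mult_def)

lemma sum_area: "(\<Sum>p\<in>N. area p) = (\<integral>z. (\<Sum>p\<in>N. theta p z) \<partial>lborel)"
  unfolding area_def by (subst Bochner_Integration.integral_sum) (auto intro: integrable_theta)

lemma sum_theta_le_1: "finite N \<Longrightarrow> (\<Sum>p\<in>N. theta p z) \<le> 1"
proof -
  assume N: "finite N"
  have "(\<Sum>p\<in>N. theta p z) = (\<Sum>p\<in>N \<inter> active z. theta p z)"
    using theta_inactive(1) by (intro sum.mono_neutral_right N) blast+
  also have "\<dots> \<le> (\<Sum>p\<in>active z. theta p z)"
    using theta_nonneg finite_active by (intro sum_mono2) auto
  finally show ?thesis by (simp add: sum_theta)
qed

lemma sum_theta_eq_1: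
  assumes "finite N" "active z \<subseteq> N" shows "(\<Sum>p\<in>N. theta p z) = 1"
proof -
  have "(\<Sum>p\<in>N. theta p z) = (\<Sum>p\<in>active z. theta p z)"
    using theta_inactive(1) by (intro sum.mono_neutral_right assms) blast+
  then show ?thesis by (simp add: sum_theta)
qed

text \<open>\<open>I\<close> holds the bumps seen by \<open>B\<close>, so the weights of
  \<open>B\<close> are fully contained in the masses over \<open>I\<close>. The error is charged to
  the outer layer \<open>N - I\<close>, hence \<open>pi\<close> times these masses is at most the
  area over \<open>N\<close>. Every point under \<open>N\<close> lies in a cell matched with
  \<open>B\<close>, and cells have area \<open>pi\<close>.\<close>

lemma zeros_le_lattice:
  assumes B: "finite B" "\<And>z. z \<in> B \<Longrightarrow> \<psi> z = 0"
  shows "(\<Sum>z\<in>B. mult z) \<le> real (card {q. \<exists>z\<in>B. matched z q})"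
proof -
  define I where "I = (\<Union>z\<in>B. active z)"
  define N where "N = nbr I"
  define Q where "Q = {q. \<exists>z\<in>B. matched z q}"
  have fI: "finite I" using B(1) finite_active by (auto simp: I_def)
  have fN: "finite N" and IN: "I \<subseteq> N" using finite_nbr[OF fI] subset_nbr by (auto simp: N_def)
  have "Q = (\<Union>z\<in>B. {q. matched z q})" by (auto simp: Q_def)
  then have fQ: "finite Q" using B(1) finite_matched_lattice by simp
  have "(\<Sum>z\<in>B. mult z) = (\<Sum>z\<in>B. mult z * (\<Sum>p\<in>I. theta p z))"
  proof (rule sum.cong[OF refl])
    fix z assume "z \<in> B"
    then have "active z \<subseteq> I" by (auto simp: I_def)
    then show "mult z = mult z * (\<Sum>p\<in>I. theta p z)" using sum_theta_eq_1[OF fI] by simp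
  qed
  also have "\<dots> = (\<Sum>p\<in>I. \<Sum>z\<in>B. mult z * theta p z)"
    by (simp add: sum_distrib_left) (rule sum.swap)
  also have "\<dots> \<le> (\<Sum>p\<in>I. mass p)"
  proof (rule sum_mono)
    fix p
    have "mass p = (\<Sum>z\<in>B \<union> zeros p. mult z * theta p z)"
    proof (rule mass_eq)
      fix z assume "\<psi> z = 0" "p \<in> active z"
      then show "z \<in> B \<union> zeros p" by (simp add: zeros_def active_def dist_norm norm_minus_commute)
    qed (use B finite_zeros in \<open>auto simp: zeros_def\<close>)
    moreover have "(\<Sum>z\<in>B. mult z * theta p z) \<le> (\<Sum>z\<in>B \<union> zeros p. mult z * theta p z)"
      using B(1) finite_zeros mult_nonneg theta_nonneg by (intro sum_mono2) auto
    ultimately show "(\<Sum>z\<in>B. mult z * theta p z) \<le> mass p" by simp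
  qed
  finally have 1: "(\<Sum>z\<in>B. mult z) \<le> (\<Sum>p\<in>I. mass p)" .
  have "\<bar>pi * (\<Sum>p\<in>I. mass p) - (\<Sum>p\<in>I. area p)\<bar> \<le> (\<Sum>k\<in>N - I. area k)"
  proof (rule imbalance_bound[OF fI])
    fix z
    have "active z - I \<subseteq> N - I" if "active z \<inter> I \<noteq> {}" using that by (auto simp: N_def nbr_def)
    then show "(active z \<inter> I \<noteq> {} \<longrightarrow> active z - I \<subseteq> N - I) \<or> (active z - I \<noteq> {} \<longrightarrow> active z \<inter> I \<subseteq> N - I)"
      by blast
  qed (use fN in simp)
  moreover have "(\<Sum>p\<in>N. area p) = (\<Sum>p\<in>I. area p) + (\<Sum>k\<in>N - I. area k)"
    using sum.subset_diff[OF IN fN, of area] by simp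
  ultimately have 2: "pi * (\<Sum>p\<in>I. mass p) \<le> (\<Sum>p\<in>N. area p)" by linarith
  have "(\<Sum>p\<in>N. area p) = (\<integral>w. (\<Sum>p\<in>N. theta p w) \<partial>lborel)" by (rule sum_area)
  also have "\<dots> \<le> (\<integral>w. indicator {w. cell_index w \<in> Q} w \<partial>lborel)"
  proof (rule integral_mono)
    fix w
    show "(\<Sum>p\<in>N. theta p w) \<le> indicator {w. cell_index w \<in> Q} w"
    proof (cases "active w \<inter> N = {}")
      case True
      then have "(\<Sum>p\<in>N. theta p w) = 0" using theta_inactive(1) by (intro sum.neutral) blast
      then show ?thesis by simp
    next
      case False
      then obtain j u i z where "j \<in> active w" "j \<in> active u" "i \<in> active u" "z \<in> B" "i \<in> active z"
        by (auto simp: N_def nbr_def I_def)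
      then have "matched z (cell_index w)" unfolding matched_def using chain_dist by blast
      then have "cell_index w \<in> Q" using \<open>z \<in> B\<close> by (auto simp: Q_def)
      then show ?thesis using sum_theta_le_1[OF fN, of w] by simp
    qed
  qed (intro Bochner_Integration.integrable_sum integrable_theta integral_cells fQ)+
  also have "\<dots> = pi * real (card Q)" by (rule integral_cells(2)[OF fQ])
  finally have "pi * (\<Sum>p\<in>I. mass p) \<le> pi * real (card Q)" using 2 by linarith
  then have "(\<Sum>p\<in>I. mass p) \<le> real (card Q)" by (rule mult_left_le_imp_le) (rule pi_gt_zero)
  then show ?thesis using 1 by (simp add: Q_def)
qed

text \<open>\<open>J\<close> holds the bumps over the cells of \<open>Q\<close>, so their area is at
  least \<open>pi * card Q\<close>. Now the enlarged set \<open>N\<close> is balanced and the error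
  is charged to its inner layer \<open>N - J\<close>: after this loss the mass over \<open>N\<close>
  still pays for the area over \<open>J\<close>. All zeros under \<open>N\<close> are matched with
  \<open>Q\<close>.\<close>

lemma lattice_le_zeros:
  assumes Q: "finite Q"
  shows "real (card Q) \<le> (\<Sum>z\<in>{z. \<psi> z = 0 \<and> (\<exists>q\<in>Q. matched z q)}. mult z)"
proof -
  define J where "J = {j. \<exists>w. j \<in> active w \<and> cell_index w \<in> Q}"
  define N where "N = nbr J"
  define Z where "Z = {z. \<psi> z = 0 \<and> (\<exists>q\<in>Q. matched z q)}"
  have fJ: "finite J"
  proof (rule finite_subset)
    show "J \<subseteq> (\<Union>q\<in>Q. {j. cmod (lattice_pt q - lattice_pt j) \<le> R (lattice_pt q)})"
    proof (rule subsetI)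
      fix j assume "j \<in> J"
      then obtain w where w: "j \<in> active w" "cell_index w \<in> Q" by (auto simp: J_def)
      have d: "cmod (w - lattice_pt j) < R (lattice_pt j) / 10" using w(1) by (simp add: active_def rad_def)
      have e: "cmod (lattice_pt (cell_index w) - w) \<le> 2" using cell_index_dist[of w] by (simp add: norm_minus_commute)
      have "cmod (lattice_pt (cell_index w) - lattice_pt j) \<le> cmod (lattice_pt (cell_index w) - w) + cmod (w - lattice_pt j)"
        using norm_triangle_ineq[of "lattice_pt (cell_index w) - w" "w - lattice_pt j"] by simp
      then have "cmod (lattice_pt (cell_index w) - lattice_pt j) \<le> R (lattice_pt (cell_index w))"
        using d e lip[of "lattice_pt (cell_index w)" "lattice_pt j"] big[of "lattice_pt (cell_index w)"]
        unfolding abs_le_iff by argo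
      then show "j \<in> (\<Union>q\<in>Q. {j. cmod (lattice_pt q - lattice_pt j) \<le> R (lattice_pt q)})" using w(2) by blast
    qed
  qed (use Q finite_near_lattice_pt in blast)
  have fN: "finite N" and JN: "J \<subseteq> N" using finite_nbr[OF fJ] subset_nbr by (auto simp: N_def)
  have "Z = (\<Union>q\<in>Q. {z. \<psi> z = 0 \<and> matched z q})" by (auto simp: Z_def)
  then have fZ: "finite Z" using Q finite_matched_zeros by simp
  have "pi * real (card Q) = (\<integral>w. indicator {w. cell_index w \<in> Q} w \<partial>lborel)"
    using integral_cells(2)[OF Q] by simp
  also have "\<dots> \<le> (\<integral>w. (\<Sum>p\<in>J. theta p w) \<partial>lborel)"
  proof (rule integral_mono)
    fix w
    show "indicator {w. cell_index w \<in> Q} w \<le> (\<Sum>p\<in>J. theta p w)"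
    proof (cases "cell_index w \<in> Q")
      case True
      then have "active w \<subseteq> J" by (auto simp: J_def)
      then show ?thesis using sum_theta_eq_1[OF fJ] True by simp
    qed (auto intro: sum_nonneg theta_nonneg)
  qed (intro Bochner_Integration.integrable_sum integrable_theta integral_cells Q)+
  also have "\<dots> = (\<Sum>p\<in>J. area p)" by (rule sum_area[symmetric])
  finally have 1: "pi * real (card Q) \<le> (\<Sum>p\<in>J. area p)" .
  have "\<bar>pi * (\<Sum>p\<in>N. mass p) - (\<Sum>p\<in>N. area p)\<bar> \<le> (\<Sum>k\<in>N - J. area k)"
  proof (rule imbalance_bound[OF fN])
    fix z
    \<comment> \<open>A bump of \<open>J\<close> active at \<open>z\<close> would put all of
      \<open>active z\<close> into \<open>N\<close>.\<close>
    have "active z \<inter> N \<subseteq> N - J" if "active z - N \<noteq> {}" using that by (auto simp: N_def nbr_def)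
    then show "(active z \<inter> N \<noteq> {} \<longrightarrow> active z - N \<subseteq> N - J) \<or> (active z - N \<noteq> {} \<longrightarrow> active z \<inter> N \<subseteq> N - J)"
      by blast
  qed (use fN in simp)
  moreover have "(\<Sum>p\<in>N. area p) = (\<Sum>p\<in>J. area p) + (\<Sum>k\<in>N - J. area k)"
    using sum.subset_diff[OF JN fN, of area] by simp
  ultimately have 2: "pi * real (card Q) \<le> pi * (\<Sum>p\<in>N. mass p)" using 1 by linarith
  have "mass p = (\<Sum>z\<in>Z. mult z * theta p z)" if pN: "p \<in> N" for p
  proof (rule mass_eq[OF fZ])
    fix z assume z: "\<psi> z = 0" "p \<in> active z"
    obtain u j w where "p \<in> active u" "j \<in> active u" "j \<in> active w" "cell_index w \<in> Q"
      using pN unfolding N_def nbr_def J_def by blast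
    then have "matched z (cell_index w)" unfolding matched_def using chain_dist[OF z(2)] by blast
    then show "z \<in> Z" using z(1) \<open>cell_index w \<in> Q\<close> by (auto simp: Z_def)
  qed (simp add: Z_def)
  then have "(\<Sum>p\<in>N. mass p) = (\<Sum>p\<in>N. \<Sum>z\<in>Z. mult z * theta p z)" by (rule sum.cong[OF refl])
  also have "\<dots> = (\<Sum>z\<in>Z. mult z * (\<Sum>p\<in>N. theta p z))"
    by (simp add: sum_distrib_left) (rule sum.swap)
  also have "\<dots> \<le> (\<Sum>z\<in>Z. mult z * 1)"
    by (intro sum_mono mult_left_mono sum_theta_le_1 fN mult_nonneg)
  finally have "(\<Sum>p\<in>N. mass p) \<le> (\<Sum>z\<in>Z. mult z)" by simp
  moreover have "real (card Q) \<le> (\<Sum>p\<in>N. mass p)"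
    using 2 by (rule mult_left_le_imp_le) (rule pi_gt_zero)
  ultimately show ?thesis by (simp add: Z_def)
qed

text \<open>The bijection with the multiset of zeros is expressed by the sizes of the fibres. The
  order of a zero is positive, so the value 0 that \<open>card\<close> gives to infinite sets cannot
  hide an infinite fibre.\<close>

lemma ex_bijection:
  "\<exists>f :: int \<times> int \<Rightarrow> complex. (\<forall>p. \<psi> (f p) = 0) \<and>
     (\<forall>z. \<psi> z = 0 \<longrightarrow> card {p. f p = z} = nat (zorder \<psi> z)) \<and> (\<forall>p. matched (f p) p)"
proof -
  \<comment> \<open>One copy \<open>(z, k)\<close> per unit of multiplicity makes the multiset of
    zeros a set.\<close>
  define V where "V = {(z, k). \<psi> z = 0 \<and> k < nat (zorder \<psi> z)}"
  define E where "E = {(q, z, k). (z, k) \<in> V \<and> matched z q}"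
  have cardV: "card {(z, k). z \<in> Z \<and> k < nat (zorder \<psi> z)} = (\<Sum>z\<in>Z. nat (zorder \<psi> z))"
    and finV: "finite {(z, k). z \<in> Z \<and> k < nat (zorder \<psi> z)}" if "finite Z" for Z
  proof -
    have eq: "{(z, k). z \<in> Z \<and> k < nat (zorder \<psi> z)} = (SIGMA z:Z. {..<nat (zorder \<psi> z)})" by auto
    show "card {(z, k). z \<in> Z \<and> k < nat (zorder \<psi> z)} = (\<Sum>z\<in>Z. nat (zorder \<psi> z))"
      unfolding eq using that by (subst card_SigmaI) auto
    show "finite {(z, k). z \<in> Z \<and> k < nat (zorder \<psi> z)}"
      unfolding eq using that by auto
  qed
  have EQ: "E `` Q = {(z, k). z \<in> {z. \<psi> z = 0 \<and> (\<exists>q\<in>Q. matched z q)} \<and> k < nat (zorder \<psi> z)}" for Q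
    by (auto simp: E_def V_def)
  have finZ: "finite {z. \<psi> z = 0 \<and> (\<exists>q\<in>Q. matched z q)}" if "finite Q" for Q
  proof -
    have "{z. \<psi> z = 0 \<and> (\<exists>q\<in>Q. matched z q)} = (\<Union>q\<in>Q. {z. \<psi> z = 0 \<and> matched z q})" by auto
    then show ?thesis using that finite_matched_zeros by simp
  qed
  obtain g where g: "inj_on g UNIV" "\<And>q. q \<in> UNIV \<Longrightarrow> (q, g q) \<in> E"
  proof (rule hall_injection[where E = E and I = UNIV])
    fix q show "finite (E `` {q})" unfolding EQ by (rule finV[OF finZ]) simp
  next
    fix Q :: "(int \<times> int) set" assume Q: "finite Q"
    have "real (card Q) \<le> real (\<Sum>z\<in>{z. \<psi> z = 0 \<and> (\<exists>q\<in>Q. matched z q)}. nat (zorder \<psi> z))"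
      using lattice_le_zeros[OF Q] by (simp add: mult_def)
    then show "card Q \<le> card (E `` Q)" unfolding EQ cardV[OF finZ[OF Q]] by (simp only: of_nat_le_iff)
  qed blast
  obtain h where h: "inj_on h V" "\<And>v. v \<in> V \<Longrightarrow> (v, h v) \<in> E\<inverse>"
  proof (rule hall_injection[where E = "E\<inverse>" and I = V])
    fix v assume v: "v \<in> V"
    have "E\<inverse> `` {v} \<subseteq> {q. matched (fst v) q}" by (auto simp: E_def)
    then show "finite (E\<inverse> `` {v})" using finite_matched_lattice finite_subset by blast
  next
    fix J assume J: "finite J" "J \<subseteq> V"
    \<comment> \<open>Adjacency ignores the copy number, so the worst case for Hall's condition is
      the set of all copies of the zeros occurring in \<open>J\<close>.\<close>
    define B where "B = fst ` J"
    have B: "finite B" "\<And>z. z \<in> B \<Longrightarrow> \<psi> z = 0" using J by (auto simp: B_def V_def)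
    have "J \<subseteq> {(z, k). z \<in> B \<and> k < nat (zorder \<psi> z)}" using J(2) by (force simp: B_def V_def)
    then have "card J \<le> (\<Sum>z\<in>B. nat (zorder \<psi> z))"
      using card_mono[OF finV[OF B(1)]] cardV[OF B(1)] by simp
    moreover have "real (\<Sum>z\<in>B. nat (zorder \<psi> z)) \<le> real (card {q. \<exists>z\<in>B. matched z q})"
      using zeros_le_lattice[OF B] by (simp add: mult_def)
    moreover have "{q. \<exists>z\<in>B. matched z q} = E\<inverse> `` J"
      using J(2) by (force simp: B_def E_def)
    ultimately show "card J \<le> card (E\<inverse> `` J)" by (simp only: of_nat_le_iff)
  qed blast
  obtain F where F: "bij_betw F UNIV V" "\<And>q. q \<in> UNIV \<Longrightarrow> (q, F q) \<in> E"
  proof (rule bij_betw_along_relation[where f = g and X = UNIV and Y = V and E = E and g = h])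
    show "g q \<in> V \<and> (q, g q) \<in> E" for q using g(2)[of q] by (auto simp: E_def)
    show "h v \<in> UNIV \<and> (h v, v) \<in> E" if "v \<in> V" for v using h(2)[OF that] by simp
  qed (use g(1) h(1) in blast)+
  have FV: "F p \<in> V" for p using F(1) by (auto simp: bij_betw_def)
  show ?thesis
  proof (intro exI[of _ "\<lambda>p. fst (F p)"] conjI allI impI)
    fix p
    show "\<psi> (fst (F p)) = 0" using FV[of p] by (auto simp: V_def)
    show "matched (fst (F p)) p" using F(2)[of p] by (auto simp: E_def)
  next
    fix z assume z: "\<psi> z = 0"
    have "bij_betw F {p. fst (F p) = z} (F ` {p. fst (F p) = z})"
      using F(1) by (auto simp: bij_betw_def intro: inj_on_subset)
    then have "card {p. fst (F p) = z} = card (F ` {p. fst (F p) = z})" by (rule bij_betw_same_card)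
    also have "F ` {p. fst (F p) = z} = {v \<in> V. fst v = z}"
      using F(1) FV by (force simp: bij_betw_def image_iff)
    also have "\<dots> = (\<lambda>k. (z, k)) ` {..<nat (zorder \<psi> z)}" using z by (auto simp: V_def)
    also have "card \<dots> = nat (zorder \<psi> z)" by (subst card_image) (auto simp: inj_on_def)
    finally show "card {p. fst (F p) = z} = nat (zorder \<psi> z)" .
  qed
qed

end

section \<open>The convolution and the scale function\<close>

lemma nn_integral_translate:
  assumes [measurable]: "f \<in> borel_measurable borel"
  shows "(\<integral>\<^sup>+w. f (w - y) \<partial>lborel) = (\<integral>\<^sup>+w. f w \<partial>(lborel :: complex measure))"
proof -
  have "(\<integral>\<^sup>+w. f w \<partial>lborel) = (\<integral>\<^sup>+w. f w \<partial>distr lborel borel ((+) (- y)))" by (simp add: lborel_distr_plus)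
  also have "\<dots> = (\<integral>\<^sup>+w. f (- y + w) \<partial>lborel)" by (intro nn_integral_distr) simp_all
  finally show ?thesis by simp
qed

lemma nn_integral_le_abs_conv:
  fixes chi phi :: "complex \<Rightarrow> real"
  assumes [measurable]: "chi \<in> borel_measurable borel" "phi \<in> borel_measurable borel"
    and chi: "\<And>y. chi y \<ge> 0" "(\<integral>\<^sup>+y. ennreal (chi y) \<partial>lborel) = 1" "\<And>y. chi y \<noteq> 0 \<Longrightarrow> cmod y \<le> \<rho>"
  shows "(\<integral>\<^sup>+z. ennreal (indicator (cball c r) z * \<bar>phi z\<bar>) \<partial>lborel)
    \<le> (\<integral>\<^sup>+w. abs_conv phi chi w * indicator (cball c (r + \<rho>)) w \<partial>lborel)"
proof -
  define F where "F z = ennreal (indicator (cball c r) z * \<bar>phi z\<bar>)" for z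
  have [measurable]: "cball c r \<in> sets borel" by simp
  have Fm [measurable]: "F \<in> borel_measurable borel" unfolding F_def by measurable
  have psf: "pair_sigma_finite (lborel :: complex measure) (lborel :: complex measure)" ..
  have "(\<integral>\<^sup>+z. F z \<partial>lborel) = (\<integral>\<^sup>+y. ennreal (chi y) \<partial>lborel) * (\<integral>\<^sup>+z. F z \<partial>lborel)"
    by (simp add: chi(2))
  also have "\<dots> = (\<integral>\<^sup>+y. ennreal (chi y) * (\<integral>\<^sup>+z. F z \<partial>lborel) \<partial>lborel)"
    by (rule nn_integral_multc[symmetric]) simp
  also have "\<dots> = (\<integral>\<^sup>+y. (\<integral>\<^sup>+w. ennreal (chi y) * F (w - y) \<partial>lborel) \<partial>lborel)"
    by (subst nn_integral_cmult) (simp_all add: nn_integral_translate[OF Fm])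
  also have "\<dots> = (\<integral>\<^sup>+w. (\<integral>\<^sup>+y. ennreal (chi y) * F (w - y) \<partial>lborel) \<partial>lborel)"
    by (rule pair_sigma_finite.Fubini'[OF psf]) (simp add: split_beta')
  also have "\<dots> \<le> (\<integral>\<^sup>+w. abs_conv phi chi w * indicator (cball c (r + \<rho>)) w \<partial>lborel)"
  proof (rule nn_integral_mono)
    fix w
    have "(\<integral>\<^sup>+y. ennreal (chi y) * F (w - y) \<partial>lborel)
        \<le> (\<integral>\<^sup>+y. ennreal (\<bar>phi (w - y)\<bar> * chi y) * indicator (cball c (r + \<rho>)) w \<partial>lborel)"
    proof (rule nn_integral_mono)
      fix y
      show "ennreal (chi y) * F (w - y) \<le> ennreal (\<bar>phi (w - y)\<bar> * chi y) * indicator (cball c (r + \<rho>)) w"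
      proof (cases "chi y \<noteq> 0 \<and> w - y \<in> cball c r")
        case True
        have "cmod (c - w) \<le> cmod (c - (w - y)) + cmod y"
          using norm_triangle_ineq4[of "c - (w - y)" y] by simp
        then have "w \<in> cball c (r + \<rho>)" using True chi(3)[of y] by (simp add: dist_norm)
        then show ?thesis using True chi(1)[of y]
          by (simp add: F_def ennreal_mult[symmetric] mult.commute)
      next
        case False
        then show ?thesis by (auto simp: F_def)
      qed
    qed
    also have "\<dots> = abs_conv phi chi w * indicator (cball c (r + \<rho>)) w"
      unfolding abs_conv_def by (rule nn_integral_multc) measurable
    finally show "(\<integral>\<^sup>+y. ennreal (chi y) * F (w - y) \<partial>lborel)
        \<le> abs_conv phi chi w * indicator (cball c (r + \<rho>)) w" .
  qed
  finally show ?thesis by (simp add: F_def)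
qed

theorem theorem4p1:
  fixes chi :: "complex \<Rightarrow> real"
  assumes "smooth_C_inf chi"
    and "compact (closure {z. chi z \<noteq> 0})"
    and "\<And>z. chi z \<ge> 0"
    and "integral\<^sup>L lborel chi = 1"
    and "\<And>z. chi (- z) = chi z"
  shows "\<exists>K>0. \<forall>\<psi>. \<psi> holomorphic_on UNIV \<longrightarrow> (\<exists>z. \<psi> z \<noteq> 0) \<longrightarrow> Rfun K chi \<psi> 0 < \<infinity> \<longrightarrow>
     (\<exists>f :: int \<times> int \<Rightarrow> complex.
        (\<forall>p. \<psi> (f p) = 0) \<and>
        (\<forall>z. \<psi> z = 0 \<longrightarrow> card {p. f p = z} = nat (zorder \<psi> z)) \<and>
        (\<forall>p. ereal (cmod (f p - lattice_pt p)) \<le> Rfun K chi \<psi> (lattice_pt p)))"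
proof -
  have "chi differentiable_on UNIV" using assms(1) by (cases rule: smooth_C_inf.cases)
  then have chi_m: "chi \<in> borel_measurable borel"
    by (intro borel_measurable_continuous_onI differentiable_imp_continuous_on)
  \<comment> \<open>A non-integrable function has integral 0 by convention, so the value 1 forces
    integrability.\<close>
  have "integrable lborel chi" using assms(4) not_integrable_integral_eq by fastforce
  then have chi_1: "(\<integral>\<^sup>+y. ennreal (chi y) \<partial>lborel) = 1"
    using assms(3,4) by (subst nn_integral_eq_integral) auto
  obtain \<rho> where \<rho>: "\<rho> \<ge> 0" "\<And>y. chi y \<noteq> 0 \<Longrightarrow> cmod y \<le> \<rho>"
  proof -
    obtain B where B: "\<And>y. y \<in> closure {z. chi z \<noteq> 0} \<Longrightarrow> cmod y \<le> B"
      using compact_imp_bounded[OF assms(2)] by (auto simp: bounded_iff)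
    show thesis
    proof (rule that[of "max 0 B"])
      fix y assume "chi y \<noteq> 0"
      then have "y \<in> closure {z. chi z \<noteq> 0}" by (intro subsetD[OF closure_subset]) simp
      then show "cmod y \<le> max 0 B" using B[of y] by simp
    qed simp
  qed
  \<comment> \<open>The summand \<open>10 ^ 16\<close> makes \<open>R\<close> at least
    \<open>10 ^ 8\<close> and exceeds 576 * pi * 10^12, as the smallness estimate requires. The
    summand \<open>(10 * \<rho>)\<^sup>2\<close> makes \<open>rad\<close> at least
    \<open>\<rho>\<close>, so the enlargement by \<open>\<rho>\<close> at most doubles a
    disc.\<close>
  define K :: real where "K = 10 ^ 16 + (10 * \<rho>)\<^sup>2"
  have K: "K \<ge> 10 ^ 16" "K \<ge> (10 * \<rho>)\<^sup>2" by (simp_all add: K_def)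
  have K0: "K > 0" using K(1) by simp
  have "(10 ^ 8)\<^sup>2 \<le> K" using K(1) by simp
  then have sqrtK: "10 ^ 8 \<le> sqrt K" "10 * \<rho> \<le> sqrt K"
    using K(2) real_le_rsqrt by blast+
  show ?thesis
  proof (intro exI[of _ K] conjI K0 allI impI)
    fix \<psi> assume \<psi>: "\<psi> holomorphic_on UNIV" and nz: "\<exists>z. \<psi> z \<noteq> 0" and R0: "Rfun K chi \<psi> 0 < \<infinity>"
    obtain w0 where w0: "\<psi> w0 \<noteq> 0" using nz by blast
    define A where "A w = abs_conv (phi_of \<psi>) chi w" for w
    define g where "g w = sqrt (K * (1 + enn2real (A w)))" for w
    have up0: "(if A w = \<infinity> then \<infinity> else ereal (g w - cmod (w - 0))) \<le> Rfun K chi \<psi> 0" for w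
      unfolding Rfun_def A_def g_def by (rule SUP_upper) simp
    \<comment> \<open>A single infinite value of the convolution makes the supremum infinite at
      every point. Excluding it also ensures that \<open>enn2real\<close> never replaces an infinite
      value by 0.\<close>
    have Afin: "A w \<noteq> \<infinity>" for w
    proof
      assume "A w = \<infinity>"
      then have "\<infinity> \<le> Rfun K chi \<psi> 0" using up0[of w] by simp
      then show False using R0 by simp
    qed
    have Rf: "Rfun K chi \<psi> z = (SUP w. ereal (g w - cmod (w - z)))" for z
      using Afin by (simp add: Rfun_def A_def g_def)
    define R where "R z = real_of_ereal (Rfun K chi \<psi> z)" for z
    have up: "ereal (g w - cmod (w - z)) \<le> Rfun K chi \<psi> z" for w z
      unfolding Rf by (rule SUP_upper) simp
    have least: "Rfun K chi \<psi> z \<le> x" if "\<And>w. ereal (g w - cmod (w - z)) \<le> x" for x z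
      unfolding Rf using that by (rule SUP_least)
    have R0': "Rfun K chi \<psi> 0 = ereal (R 0)"
      using R0 up[of 0 0] by (cases "Rfun K chi \<psi> 0") (auto simp: R_def)
    have RR: "Rfun K chi \<psi> z = ereal (R z)" for z
    proof -
      \<comment> \<open>Moving the base point from 0 to \<open>z\<close> changes each term of the
        supremum by at most |z|.\<close>
      have "Rfun K chi \<psi> z \<le> ereal (R 0 + cmod z)"
      proof (rule least)
        fix w
        have "cmod w \<le> cmod (w - z) + cmod z" using norm_triangle_ineq[of "w - z" z] by simp
        moreover have "g w - cmod w \<le> R 0" using up[of w 0] by (simp add: R0')
        ultimately show "ereal (g w - cmod (w - z)) \<le> ereal (R 0 + cmod z)" by simp
      qed
      then show ?thesis using up[of z z] by (cases "Rfun K chi \<psi> z") (auto simp: R_def)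
    qed
    have gR: "g w - cmod (w - z) \<le> R z" for w z using up[of w z] by (simp add: RR)
    have lip1: "R z \<le> R w + cmod (z - w)" for z w
    proof -
      have "Rfun K chi \<psi> z \<le> ereal (R w + cmod (z - w))"
      proof (rule least)
        fix u
        have "cmod (u - w) \<le> cmod (u - z) + cmod (z - w)" using norm_triangle_ineq[of "u - z" "z - w"] by simp
        then show "ereal (g u - cmod (u - z)) \<le> ereal (R w + cmod (z - w))" using gR[of u w] by simp
      qed
      then show ?thesis by (simp add: RR)
    qed
    have gle: "g z \<le> R z" for z using gR[of z z] by simp
    have gK: "sqrt K \<le> g z" for z using K0 by (simp add: g_def)
    have RK: "sqrt K \<le> R z" for z using gle gK order_trans by blast
    interpret lipschitz_scale R
    proof
      show "\<bar>R z - R w\<bar> \<le> cmod (z - w)" for z w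
        using lip1[of z w] lip1[of w z] by (simp add: abs_le_iff norm_minus_commute)
      show "200 \<le> R z" for z using RK[of z] sqrtK(1) by simp
    qed
    \<comment> \<open>Testing the supremum with its own base point gives
      \<open>g w \<le> R w\<close>; this is where \<open>R\<close> bounds the size of
      \<phi>.\<close>
    have AR: "A w \<le> ennreal ((R w)\<^sup>2 / K)" for w
    proof -
      have "(g w)\<^sup>2 \<le> (R w)\<^sup>2" using gle[of w] by (intro power_mono) (auto simp: g_def K0 less_imp_le)
      then have "K * (1 + enn2real (A w)) \<le> (R w)\<^sup>2" using K0 by (simp add: g_def)
      then have "K * enn2real (A w) \<le> (R w)\<^sup>2" using K0 unfolding distrib_left by linarith
      then have "enn2real (A w) \<le> (R w)\<^sup>2 / K" using K0 by (simp add: pos_le_divide_eq mult.commute)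
      then have "ennreal (enn2real (A w)) \<le> ennreal ((R w)\<^sup>2 / K)" by (rule ennreal_leI)
      then show ?thesis using Afin[of w] by (simp add: less_top)
    qed
    interpret zero_transport R \<psi> w0
    proof
      fix p
      define r where "r = rad p"
      define c where "c = lattice_pt p"
      have Rc: "R c = 10 * r" by (simp add: c_def r_def rad_def)
      have r: "r > 0" "\<rho> \<le> r" using RK[of c] sqrtK by (simp_all add: Rc)
      have "\<psi> \<in> borel_measurable borel"
        using \<psi> by (intro borel_measurable_continuous_onI holomorphic_on_imp_continuous_on)
      then have phi_m: "phi_of \<psi> \<in> borel_measurable borel" unfolding phi_of_def[abs_def] by measurable
      \<comment> \<open>Within 2 r of \<open>c\<close>, where \<open>R c = 10 * r\<close>, the
        Lipschitz bound gives \<open>R w \<le> 12 * r\<close>, hence the factor 144. The disc of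
        radius 2 r contributes another 4 * pi.\<close>
      have bound: "A w * indicator (cball c (r + \<rho>)) w \<le> ennreal (144 * r\<^sup>2 / K) * indicator (cball c (2 * r)) w" for w
      proof (cases "w \<in> cball c (r + \<rho>)")
        case True
        then have d: "cmod (w - c) \<le> 2 * r" using r by (simp add: dist_norm norm_minus_commute)
        then have "0 \<le> R w" "R w \<le> 12 * r"
          using lip[of w c] big[of w] by (simp_all only: Rc abs_le_iff) linarith+
        then have "(R w)\<^sup>2 \<le> (12 * r)\<^sup>2" by (intro power_mono)
        then have "(R w)\<^sup>2 / K \<le> 144 * r\<^sup>2 / K" using K0 by (intro divide_right_mono) (simp_all add: power_mult_distrib)
        then have "A w \<le> ennreal (144 * r\<^sup>2 / K)" using AR[of w] ennreal_leI order_trans by blast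
        then show ?thesis using True d by (simp add: dist_norm norm_minus_commute)
      qed simp
      have "(\<integral>\<^sup>+z. ennreal (indicator (cball c r) z * \<bar>phi_of \<psi> z\<bar>) \<partial>lborel)
          \<le> (\<integral>\<^sup>+w. A w * indicator (cball c (r + \<rho>)) w \<partial>lborel)"
        unfolding A_def by (rule nn_integral_le_abs_conv[OF chi_m phi_m assms(3) chi_1 \<rho>(2)])
      also have "\<dots> \<le> (\<integral>\<^sup>+w. ennreal (144 * r\<^sup>2 / K) * indicator (cball c (2 * r)) w \<partial>lborel)"
        by (intro nn_integral_mono bound)
      also have "\<dots> = ennreal (144 * r\<^sup>2 / K) * emeasure lborel (cball c (2 * r))"
        by (rule nn_integral_cmult_indicator) simp
      also have "\<dots> = ennreal (144 * r\<^sup>2 / K * (pi * (2 * r)\<^sup>2))"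
        using r K0 by (simp add: emeasure_cball eval_unit_ball_vol ennreal_mult[symmetric])
      also have "\<dots> \<le> ennreal (r ^ 4 / 10 ^ 12)"
      proof (rule ennreal_leI)
        have "144 * r\<^sup>2 / K * (pi * (2 * r)\<^sup>2) = 576 * pi / K * r ^ 4"
          by (simp add: power2_eq_square eval_nat_numeral)
        also have "\<dots> \<le> 576 * 4 / 10 ^ 16 * r ^ 4"
          using K pi_less_4 r by (intro mult_right_mono frac_le) auto
        also have "\<dots> \<le> r ^ 4 / 10 ^ 12" using r by simp
        finally show "144 * r\<^sup>2 / K * (pi * (2 * r)\<^sup>2) \<le> r ^ 4 / 10 ^ 12" .
      qed
      finally show "(\<integral>\<^sup>+z. ennreal (indicator (cball (lattice_pt p) (rad p)) z * \<bar>phi_of \<psi> z\<bar>) \<partial>lborel)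
          \<le> ennreal ((rad p) ^ 4 / 10 ^ 12)" by (simp add: r_def c_def)
    qed (rule \<psi> w0)+
    obtain f where f: "\<And>p. \<psi> (f p) = 0" "\<And>z. \<psi> z = 0 \<Longrightarrow> card {p. f p = z} = nat (zorder \<psi> z)"
      "\<And>p. matched (f p) p"
      using ex_bijection by blast
    have "ereal (cmod (f p - lattice_pt p)) \<le> Rfun K chi \<psi> (lattice_pt p)" for p
      using f(3)[of p] big[of "lattice_pt p"] by (simp add: matched_def RR)
    then show "\<exists>f :: int \<times> int \<Rightarrow> complex.
        (\<forall>p. \<psi> (f p) = 0) \<and>
        (\<forall>z. \<psi> z = 0 \<longrightarrow> card {p. f p = z} = nat (zorder \<psi> z)) \<and>
        (\<forall>p. ereal (cmod (f p - lattice_pt p)) \<le> Rfun K chi \<psi> (lattice_pt p))"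
      using f(1,2) by blast
  qed
qed

end
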